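(* Let $T=S^1\times S^1$ be the torus and $f:T\to\mathbb{R}^3$ a smooth embedding. Then there exist a basis of $H_1(T;\mathbb{Z})\cong\mathbb{Z}^2$ and a sign $\epsilon\in\{+1,-1\}$ such that, writing elements in this basis as $(x,y)$, $L(f)((x_1,y_1),(x_2,y_2))=\epsilon\, x_1y_2$ for all $(x_1,y_1),(x_2,y_2)\in H_1(T;\mathbb{Z})$.
   Context: Orientations on $T$ and on $\mathbb{R}^3$ are fixed. For a smooth embedding $f:T\to\mathbb{R}^3$, a shift $\overline f$ of $f$ is defined by $\overline f(x)=f(x)+\varepsilon n(x)$, where $n(x)$ is a vector normal to $f(T)$ at $f(x)$ such that (the orientation of $T_xT$ pushed forward by $df$, followed by $n(x)$) agrees with the orientation of $\mathbb{R}^3$, and $\varepsilon>0$ is small. For integer 1-cycles $b,c$ on $T$, $L(f)(b,c)$ is the linking number in $\mathbb{R}^3$ of $f|_b$ and $\overline f|_c$; this gives the Seifert form $L(f)$ on $H_1(T;\mathbb{Z})$. *)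

theory Defs
  imports "HOL-Analysis.Analysis"
begin

text \<open>The torus T = S^1 x S^1 is modelled as R^2 / Z^2. A map T -> R^3 is a map
  f :: real x real -> real^3 that is 1-periodic in both variables. The orientation of T
  is the one induced by the coordinates (s,t); the orientation of R^3 is the standard one.\<close>

coinductive smooth_map :: "('a::real_normed_vector \<Rightarrow> 'b::real_normed_vector) \<Rightarrow> bool" where
  "(\<forall>x. f differentiable (at x)) \<Longrightarrow>
   (\<forall>v. smooth_map (\<lambda>x. frechet_derivative f (at x) v)) \<Longrightarrow> smooth_map f"

definition torus_periodic :: "(real \<times> real \<Rightarrow> 'b) \<Rightarrow> bool" where
  "torus_periodic f \<longleftrightarrow> (\<forall>s t. f (s + 1, t) = f (s, t) \<and> f (s, t + 1) = f (s, t))"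

definition d_s :: "(real \<times> real \<Rightarrow> real^3) \<Rightarrow> real \<times> real \<Rightarrow> real^3" where
  "d_s f p = frechet_derivative f (at p) (1, 0)"

definition d_t :: "(real \<times> real \<Rightarrow> real^3) \<Rightarrow> real \<times> real \<Rightarrow> real^3" where
  "d_t f p = frechet_derivative f (at p) (0, 1)"

text \<open>Smooth embedding of the torus: smooth, doubly periodic, injective on the quotient
  R^2/Z^2, and an immersion (the two partial derivatives are linearly independent).
  Since T is compact, an injective immersion is an embedding.\<close>
definition torus_smooth_embedding :: "(real \<times> real \<Rightarrow> real^3) \<Rightarrow> bool" where
  "torus_smooth_embedding f \<longleftrightarrow>
     smooth_map f \<and> torus_periodic f \<and>
     (\<forall>s t s' t'. f (s, t) = f (s', t') \<longrightarrow> s - s' \<in> \<int> \<and> t - t' \<in> \<int>) \<and>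
     (\<forall>p. cross3 (d_s f p) (d_t f p) \<noteq> 0)"

text \<open>Unit normal n(x): (df e_s, df e_t, n) is positively oriented in R^3.\<close>
definition unit_normal :: "(real \<times> real \<Rightarrow> real^3) \<Rightarrow> real \<times> real \<Rightarrow> real^3" where
  "unit_normal f p = (1 / norm (cross3 (d_s f p) (d_t f p))) *\<^sub>R cross3 (d_s f p) (d_t f p)"

definition shift :: "(real \<times> real \<Rightarrow> real^3) \<Rightarrow> real \<Rightarrow> real \<times> real \<Rightarrow> real^3" where
  "shift f eps p = f p + eps *\<^sub>R unit_normal f p"

text \<open>Gauss linking integral of two closed C^1 curves parametrised on [0,1].\<close>
definition linking_number :: "(real \<Rightarrow> real^3) \<Rightarrow> (real \<Rightarrow> real^3) \<Rightarrow> real" where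
  "linking_number g h =
     (1 / (4 * pi)) *
     integral (cbox (0, 0) (1, 1))
       (\<lambda>(u, v). ((g u - h v) \<bullet> cross3 (vector_derivative g (at u)) (vector_derivative h (at v)))
                 / norm (g u - h v) ^ 3)"

text \<open>H_1(T;Z) = Z^2, the class (a,b) being represented by the integer 1-cycle
  u |-> (a u, b u) mod Z^2, u in [0,1].\<close>
definition torus_loop :: "int \<times> int \<Rightarrow> real \<Rightarrow> real \<times> real" where
  "torus_loop c u = (of_int (fst c) * u, of_int (snd c) * u)"

definition seifert_lk :: "(real \<times> real \<Rightarrow> real^3) \<Rightarrow> real \<Rightarrow> int \<times> int \<Rightarrow> int \<times> int \<Rightarrow> real" where
  "seifert_lk f eps b c = linking_number (f \<circ> torus_loop b) (shift f eps \<circ> torus_loop c)"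

end

theory Submission
  imports Defs
begin

text \<open>
  Away from a closed curve its Biot--Savart field is closed, and its periods are linking numbers. Pulled back to
  a collar \<open>\<real>\<^sup>2 \<times> (-\<delta>, \<delta>)\<close> of the torus, these fields have potentials; hence the linking number of a loop with
  a pushed-off loop is a real bilinear form \<open>M\<close> on \<open>\<int>\<^sup>2\<close> that does not depend on the two levels.

  \<open>M\<close> is integral: on a fine periodic grid the Gauss integral is a sum of solid angles of small triangles. Half
  the solid angle is the argument of a product of three link phases between spinors, and these phases cancel
  over the closed grid.

  The antisymmetric part of \<open>M\<close> is the intersection form up to sign, since the Gauss integral jumps by \<open>4\<pi>\<close>
  when two strands cross.

  \<open>det M = 0\<close>: let \<open>B\<^sub>1, B\<^sub>2\<close> be the fields of two generators pushed to one side of the torus, and let \<open>U\<close> vanish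
  near these loops and have its gradient supported in the collar on the other side of them. Then
  \<open>div (U B\<^sub>1 \<times> B\<^sub>2) = \<nabla>U \<cdot> (B\<^sub>1 \<times> B\<^sub>2)\<close> integrates to 0 by decay, while in collar coordinates the integral is the
  determinant of the periods by the Riemann bilinear relation.

  An integral matrix of rank one with \<open>M\<^sub>2\<^sub>1 - M\<^sub>1\<^sub>2 = 1\<close> is the product of a column and a row that together form
  a basis of \<open>\<int>\<^sup>2\<close>.
\<close>

section \<open>Functions of class C^k\<close>

abbreviation dir_deriv ::
  "('a::real_normed_vector \<Rightarrow> 'b::real_normed_vector) \<Rightarrow> 'a \<Rightarrow> 'a \<Rightarrow> 'b" where
  "dir_deriv f v x \<equiv> frechet_derivative f (at x) v"

primrec Ck_differentiable ::
  "nat \<Rightarrow> ('a::real_normed_vector \<Rightarrow> 'b::real_normed_vector) \<Rightarrow> bool" where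
  "Ck_differentiable 0 f \<longleftrightarrow> continuous_on UNIV f"
| "Ck_differentiable (Suc k) f \<longleftrightarrow>
    (\<forall>x. f differentiable (at x)) \<and> (\<forall>v. Ck_differentiable k (dir_deriv f v))"

lemma smooth_map_imp_Ck_differentiable: "smooth_map f \<Longrightarrow> Ck_differentiable k f"
proof (induction k arbitrary: f)
  case 0
  then show ?case
    by (auto elim!: smooth_map.cases simp: continuous_on_eq_continuous_at
        differentiable_imp_continuous_within)
next
  case (Suc k)
  from Suc.prems show ?case
    by (cases rule: smooth_map.cases) (auto intro: Suc.IH)
qed

lemma Ck_differentiable_SucI:
  assumes "\<And>x. (f has_derivative f' x) (at x)" "\<And>v. Ck_differentiable k (\<lambda>x. f' x v)"
  shows "Ck_differentiable (Suc k) f"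
proof -
  have "frechet_derivative f (at x) = f' x" for x
    using assms(1) frechet_derivative_at by metis
  then show ?thesis
    using assms by (auto simp: differentiable_def)
qed

lemma Ck_differentiable_has_derivative:
  "Ck_differentiable (Suc k) f \<Longrightarrow> (f has_derivative frechet_derivative f (at x)) (at x)"
  by (simp add: frechet_derivative_works)

lemma Ck_differentiable_dir_deriv:
  "Ck_differentiable (Suc k) f \<Longrightarrow> Ck_differentiable k (dir_deriv f v)"
  by simp

lemma Ck_differentiable_imp_continuous_on: "Ck_differentiable k f \<Longrightarrow> continuous_on S f"
  by (cases k) (auto simp: continuous_at_imp_continuous_on differentiable_imp_continuous_within
      intro: continuous_on_subset)

lemma Ck_differentiable_SucD: "Ck_differentiable (Suc k) f \<Longrightarrow> Ck_differentiable k f"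
proof (induction k arbitrary: f)
  case 0
  then show ?case using Ck_differentiable_imp_continuous_on[OF 0] by simp
next
  case (Suc k)
  then show ?case by (metis Ck_differentiable.simps(2))
qed

lemma Ck_differentiable_const: "Ck_differentiable k (\<lambda>x. c)"
proof (induction k arbitrary: c)
  case (Suc k)
  show ?case by (rule Ck_differentiable_SucI[where f'="\<lambda>_ _. 0"]) (auto intro: Suc)
qed simp

lemma Ck_differentiable_ident: "Ck_differentiable k (\<lambda>x. x)"
proof (cases k)
  case (Suc j)
  show ?thesis
    unfolding Suc
    by (rule Ck_differentiable_SucI[where f'="\<lambda>_ v. v"]) (auto intro: Ck_differentiable_const)
qed simp

lemma Ck_differentiable_add:
  "Ck_differentiable k f \<Longrightarrow> Ck_differentiable k g \<Longrightarrow> Ck_differentiable k (\<lambda>x. f x + g x)"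
proof (induction k arbitrary: f g)
  case (Suc k)
  show ?case
    by (rule Ck_differentiable_SucI[where f'="\<lambda>x v. dir_deriv f v x + dir_deriv g v x"])
      (use Suc in \<open>auto intro!: has_derivative_add simp: frechet_derivative_works\<close>)
qed (auto intro: continuous_intros)

lemma (in bounded_linear) Ck_differentiable:
  "Ck_differentiable k g \<Longrightarrow> Ck_differentiable k (\<lambda>x. f (g x))"
proof (induction k arbitrary: g)
  case 0
  then show ?case by (auto intro: continuous_on)
next
  case (Suc k)
  show ?case
    by (rule Ck_differentiable_SucI[where f'="\<lambda>x v. f (dir_deriv g v x)"])
      (use Suc in \<open>auto intro!: has_derivative simp: frechet_derivative_works\<close>)
qed

lemma Ck_differentiable_compose_affine:
  assumes "bounded_linear A"
  shows "Ck_differentiable k f \<Longrightarrow> Ck_differentiable k (\<lambda>x. f (A x + c))"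
proof (induction k arbitrary: f)
  case 0
  have "continuous_on UNIV (\<lambda>x. A x + c)"
    by (intro continuous_intros linear_continuous_on assms)
  with 0 show ?case
    using continuous_on_compose2[of UNIV f UNIV "\<lambda>x. A x + c"] by auto
next
  case (Suc k)
  show ?case
  proof (rule Ck_differentiable_SucI[where f'="\<lambda>x v. dir_deriv f (A v) (A x + c)"])
    fix x
    have "((\<lambda>x. A x + c) has_derivative A) (at x)"
      using has_derivative_add_const[OF bounded_linear_imp_has_derivative[OF assms]] .
    from has_derivative_compose[OF this Ck_differentiable_has_derivative[OF Suc.prems]]
    show "((\<lambda>x. f (A x + c)) has_derivative (\<lambda>v. dir_deriv f (A v) (A x + c))) (at x)" .
  next
    fix v
    show "Ck_differentiable k (\<lambda>x. dir_deriv f (A v) (A x + c))"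
      using Suc.IH[OF Ck_differentiable_dir_deriv[OF Suc.prems, of "A v"]] .
  qed
qed

lemma (in bounded_bilinear) Ck_differentiable:
  "Ck_differentiable k f \<Longrightarrow> Ck_differentiable k g \<Longrightarrow> Ck_differentiable k (\<lambda>x. prod (f x) (g x))"
proof (induction k arbitrary: f g)
  case 0
  then show ?case by (auto intro: continuous_on)
next
  case (Suc k)
  note prems = Suc.prems Ck_differentiable_SucD[OF Suc.prems(1)] Ck_differentiable_SucD[OF Suc.prems(2)]
  show ?case
    by (rule Ck_differentiable_SucI
        [where f'="\<lambda>x v. prod (f x) (dir_deriv g v x) + prod (dir_deriv f v x) (g x)"])
      (use Suc.IH prems in \<open>auto intro!: FDERIV Ck_differentiable_add simp: frechet_derivative_works\<close>)
qed

lemma Ck_differentiable_inverse: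
  fixes g :: "'a::real_normed_vector \<Rightarrow> real"
  assumes "\<And>x. g x \<noteq> 0"
  shows "Ck_differentiable k g \<Longrightarrow> Ck_differentiable k (\<lambda>x. inverse (g x))"
proof (induction k)
  case 0
  then show ?case using assms by (auto intro: continuous_intros)
next
  case (Suc k)
  note IH = Suc.IH[OF Ck_differentiable_SucD[OF Suc.prems]]
  let ?g' = "\<lambda>x v. - (inverse (g x) * dir_deriv g v x * inverse (g x))"
  show ?case
  proof (rule Ck_differentiable_SucI)
    show "((\<lambda>x. inverse (g x)) has_derivative ?g' x) (at x)" for x
      using Deriv.has_derivative_inverse[OF assms Ck_differentiable_has_derivative[OF Suc.prems]] .
    show "Ck_differentiable k (\<lambda>x. ?g' x v)" for v
      by (intro bounded_linear.Ck_differentiable[OF bounded_linear_minus[OF bounded_linear_ident]]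
          bounded_bilinear.Ck_differentiable[OF bounded_bilinear_mult] IH
          Ck_differentiable_dir_deriv Suc.prems)
  qed
qed

lemma Ck_differentiable_norm:
  fixes g :: "'a::real_normed_vector \<Rightarrow> 'b::real_inner"
  assumes "\<And>x. g x \<noteq> 0"
  shows "Ck_differentiable k g \<Longrightarrow> Ck_differentiable k (\<lambda>x. norm (g x))"
proof (induction k)
  case 0
  then show ?case by (auto intro: continuous_intros)
next
  case (Suc k)
  note IH = Suc.IH[OF Ck_differentiable_SucD[OF Suc.prems]]
  let ?g' = "\<lambda>x v. (g x \<bullet> dir_deriv g v x) * inverse (norm (g x))"
  show ?case
  proof (rule Ck_differentiable_SucI)
    fix x
    have "((\<lambda>x. norm (g x)) has_derivative (\<lambda>v. dir_deriv g v x \<bullet> sgn (g x))) (at x)"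
      using has_derivative_compose[OF Ck_differentiable_has_derivative[OF Suc.prems]
          has_derivative_norm[OF assms]] .
    then show "((\<lambda>x. norm (g x)) has_derivative ?g' x) (at x)"
      by (simp add: sgn_div_norm inner_commute mult.commute)
  next
    fix v
    show "Ck_differentiable k (\<lambda>x. ?g' x v)"
      by (intro bounded_bilinear.Ck_differentiable[OF bounded_bilinear_mult]
          bounded_bilinear.Ck_differentiable[OF bounded_bilinear_inner] Ck_differentiable_inverse IH
          Ck_differentiable_SucD[OF Suc.prems] Ck_differentiable_dir_deriv Suc.prems)
        (use assms in auto)
  qed
qed

lemma has_vector_derivative_compose:
  assumes "(c has_vector_derivative c') (at u within S)" "(f has_derivative f') (at (c u))"
  shows "((\<lambda>u. f (c u)) has_vector_derivative f' c') (at u within S)"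
proof -
  have "((\<lambda>u. f (c u)) has_derivative (\<lambda>h. f' (h *\<^sub>R c'))) (at u within S)"
    using has_derivative_compose[OF assms(1)[unfolded has_vector_derivative_def] assms(2)] .
  then show ?thesis
    by (simp add: has_vector_derivative_def linear_cmul[OF has_derivative_linear[OF assms(2)]])
qed

lemma has_vector_derivative_line:
  "((\<lambda>u. x + u *\<^sub>R b) has_vector_derivative b) (at u within S)"
  by (auto intro!: derivative_eq_intros simp: has_vector_derivative_def)

lemma Ck_differentiable_has_vector_derivative_line:
  "Ck_differentiable (Suc k) f \<Longrightarrow>
    ((\<lambda>u. f (x + u *\<^sub>R b)) has_vector_derivative dir_deriv f b (x + u *\<^sub>R b)) (at u within S)"
  by (rule has_vector_derivative_compose
      [OF has_vector_derivative_line Ck_differentiable_has_derivative])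

lemma Ck_differentiable_continuous_on_compose:
  "Ck_differentiable k f \<Longrightarrow> continuous_on S g \<Longrightarrow> continuous_on S (\<lambda>x. f (g x))"
  by (rule continuous_on_compose2[OF Ck_differentiable_imp_continuous_on[of _ _ UNIV]]) auto

lemma integral_dir_deriv_line:
  fixes f :: "'a::real_normed_vector \<Rightarrow> 'b::banach"
  assumes "Ck_differentiable (Suc k) f" "0 \<le> s"
  shows "integral {0..s} (\<lambda>\<sigma>. dir_deriv f a (x + \<sigma> *\<^sub>R a)) = f (x + s *\<^sub>R a) - f x"
  using fundamental_theorem_of_calculus
    [OF assms(2) Ck_differentiable_has_vector_derivative_line[OF assms(1)]]
  by (auto intro: integral_unique)

lemma integral_mixed_dir_deriv_line:
  fixes f :: "'a::real_normed_vector \<Rightarrow> 'b::euclidean_space"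
  assumes f: "Ck_differentiable (Suc (Suc k)) f" and s: "0 \<le> s"
  shows "integral {0..s} (\<lambda>\<sigma>. dir_deriv (dir_deriv f a) b (x + \<sigma> *\<^sub>R a))
    = dir_deriv f b (x + s *\<^sub>R a) - dir_deriv f b x"
proof -
  note Cf = Ck_differentiable_SucD[OF f]
  note Da = Ck_differentiable_dir_deriv[OF f, of a]
  let ?I = "\<lambda>t. integral (cbox 0 s) (\<lambda>\<sigma>. dir_deriv f a (x + t *\<^sub>R b + \<sigma> *\<^sub>R a))"
  have "(?I has_vector_derivative
      integral (cbox 0 s) (\<lambda>\<sigma>. dir_deriv (dir_deriv f a) b (x + 0 *\<^sub>R b + \<sigma> *\<^sub>R a))) (at 0 within UNIV)"
  proof (rule leibniz_rule_vector_derivative)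
    fix t \<sigma> :: real
    show "((\<lambda>t. dir_deriv f a (x + t *\<^sub>R b + \<sigma> *\<^sub>R a)) has_vector_derivative
        dir_deriv (dir_deriv f a) b (x + t *\<^sub>R b + \<sigma> *\<^sub>R a)) (at t within UNIV)"
      using Ck_differentiable_has_vector_derivative_line[OF Da, of "x + \<sigma> *\<^sub>R a" b t UNIV]
      by (simp add: algebra_simps)
  next
    fix t :: real
    show "(\<lambda>\<sigma>. dir_deriv f a (x + t *\<^sub>R b + \<sigma> *\<^sub>R a)) integrable_on cbox 0 s"
      by (intro integrable_continuous Ck_differentiable_continuous_on_compose[OF Da] continuous_intros)
  next
    show "continuous_on (UNIV \<times> cbox 0 s)
        (\<lambda>(t, \<sigma>). dir_deriv (dir_deriv f a) b (x + t *\<^sub>R b + \<sigma> *\<^sub>R a))"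
      unfolding case_prod_beta
      by (intro Ck_differentiable_continuous_on_compose[OF Ck_differentiable_dir_deriv[OF Da]]
          continuous_intros)
  qed auto
  moreover have "?I = (\<lambda>t. f (x + s *\<^sub>R a + t *\<^sub>R b) - f (x + t *\<^sub>R b))"
    by (simp add: integral_dir_deriv_line[OF Cf s] add.assoc[symmetric] add.commute[of "s *\<^sub>R a"])
      (simp add: add.commute add.left_commute)
  moreover have "((\<lambda>t. f (x + s *\<^sub>R a + t *\<^sub>R b) - f (x + t *\<^sub>R b)) has_vector_derivative
      dir_deriv f b (x + s *\<^sub>R a) - dir_deriv f b x) (at 0 within UNIV)"
    by (rule has_vector_derivative_diff; use Ck_differentiable_has_vector_derivative_line[OF Cf, of _ b 0]
        in \<open>simp add: scaleR_zero_left\<close>)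
  ultimately show ?thesis
    by (auto dest: vector_derivative_unique_at)
qed

lemma dir_deriv_commute:
  fixes f :: "'a::real_normed_vector \<Rightarrow> 'b::euclidean_space"
  assumes f: "Ck_differentiable (Suc (Suc k)) f"
  shows "dir_deriv (dir_deriv f a) b x = dir_deriv (dir_deriv f b) a x"
proof -
  have Dab: "Ck_differentiable k (dir_deriv (dir_deriv f a) b)"
    by (intro Ck_differentiable_dir_deriv f)
  let ?\<Delta> = "\<lambda>s. dir_deriv f b (x + s *\<^sub>R a) - dir_deriv f b x"
  have "(?\<Delta> has_vector_derivative dir_deriv (dir_deriv f a) b (x + 0 *\<^sub>R a)) (at 0 within {0..1})"
  proof (rule has_vector_derivative_transform)
    show "((\<lambda>s. integral {0..s} (\<lambda>\<sigma>. dir_deriv (dir_deriv f a) b (x + \<sigma> *\<^sub>R a))) has_vector_derivative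
        dir_deriv (dir_deriv f a) b (x + 0 *\<^sub>R a)) (at 0 within {0..1})"
      by (rule integral_has_vector_derivative)
        (auto intro!: Ck_differentiable_continuous_on_compose[OF Dab] continuous_intros)
  qed (use integral_mixed_dir_deriv_line[OF f] in auto)
  moreover have "(?\<Delta> has_vector_derivative dir_deriv (dir_deriv f b) a (x + 0 *\<^sub>R a)) (at 0 within {0..1})"
    using has_vector_derivative_diff[OF Ck_differentiable_has_vector_derivative_line
        [OF Ck_differentiable_dir_deriv[OF f, of b], of x a 0] has_vector_derivative_const] by simp
  moreover have "at 0 within {0..1::real} \<noteq> bot"
    by (simp add: trivial_limit_within islimpt_Icc)
  ultimately have "dir_deriv (dir_deriv f a) b (x + 0 *\<^sub>R a) = dir_deriv (dir_deriv f b) a (x + 0 *\<^sub>R a)"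
    by (intro vector_derivative_unique_within)
  then show ?thesis by simp
qed

section \<open>Irrotational fields and their potentials\<close>

definition irrotational_on ::
  "'a::euclidean_space set \<Rightarrow> ('a \<Rightarrow> 'a) \<Rightarrow> ('a \<Rightarrow> 'a \<Rightarrow>\<^sub>L 'a) \<Rightarrow> bool" where
  "irrotational_on S W W' \<longleftrightarrow>
    (\<forall>x\<in>S. (W has_derivative W' x) (at x)) \<and> continuous_on S W' \<and>
    (\<forall>x\<in>S. \<forall>a b. W' x a \<bullet> b = W' x b \<bullet> a)"

lemma irrotational_on_has_derivative:
  "irrotational_on S W W' \<Longrightarrow> x \<in> S \<Longrightarrow> (W has_derivative W' x) (at x)"
  by (simp add: irrotational_on_def)

lemma irrotational_on_symmetric:
  "irrotational_on S W W' \<Longrightarrow> x \<in> S \<Longrightarrow> W' x a \<bullet> b = W' x b \<bullet> a"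
  by (simp add: irrotational_on_def)

lemma irrotational_on_continuous_on: "irrotational_on S W W' \<Longrightarrow> continuous_on S W"
  unfolding irrotational_on_def
  by (meson continuous_at_imp_continuous_on has_derivative_continuous)

lemma irrotational_on_continuous_on_deriv: "irrotational_on S W W' \<Longrightarrow> continuous_on S W'"
  by (simp add: irrotational_on_def)

lemma irrotational_on_subset: "irrotational_on S W W' \<Longrightarrow> T \<subseteq> S \<Longrightarrow> irrotational_on T W W'"
  unfolding irrotational_on_def using continuous_on_subset by blast

definition ray_potential :: "'a::euclidean_space \<Rightarrow> ('a \<Rightarrow> 'a) \<Rightarrow> 'a \<Rightarrow> real" where
  "ray_potential a W x = integral {0..1} (\<lambda>t. W (a + t *\<^sub>R (x - a)) \<bullet> (x - a))"

definition ray_integrand_deriv ::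
  "'a::euclidean_space \<Rightarrow> ('a \<Rightarrow> 'a) \<Rightarrow> ('a \<Rightarrow> 'a \<Rightarrow>\<^sub>L 'a) \<Rightarrow> 'a \<Rightarrow> real \<Rightarrow> 'a \<Rightarrow>\<^sub>L real" where
  "ray_integrand_deriv a W W' x t =
    t *\<^sub>R (blinfun_inner_left (x - a) o\<^sub>L W' (a + t *\<^sub>R (x - a)))
    + blinfun_inner_left (W (a + t *\<^sub>R (x - a)))"

lemma ray_integrand_deriv_apply:
  "ray_integrand_deriv a W W' x t h =
    t * (W' (a + t *\<^sub>R (x - a)) h \<bullet> (x - a)) + W (a + t *\<^sub>R (x - a)) \<bullet> h"
  by (simp add: ray_integrand_deriv_def blinfun.bilinear_simps inner_commute)

lemma ray_in_convex:
  assumes "convex S" "a \<in> S" "x \<in> S" "t \<in> {0..1}"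
  shows "a + t *\<^sub>R (x - a) \<in> S"
proof -
  have "(1 - t) *\<^sub>R a + t *\<^sub>R x \<in> S"
    using assms by (auto simp: convex_alt)
  then show ?thesis by (simp add: algebra_simps)
qed

lemma continuous_on_ray_integrand_deriv:
  assumes "irrotational_on S W W'" "convex S" "a \<in> S"
  shows "continuous_on (S \<times> {0..1}) (\<lambda>(x, t). ray_integrand_deriv a W W' x t)"
  unfolding ray_integrand_deriv_def case_prod_beta
  by (intro continuous_intros
      continuous_on_compose2[OF irrotational_on_continuous_on[OF assms(1)]]
      continuous_on_compose2[OF irrotational_on_continuous_on_deriv[OF assms(1)]])
    (auto simp: ray_in_convex assms)

lemma ray_potential_has_derivative_integral:
  assumes irr: "irrotational_on S W W'" and S: "convex S" "open S" "a \<in> S" and x: "x \<in> S"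
  shows "(ray_potential a W has_derivative integral {0..1} (ray_integrand_deriv a W W' x)) (at x)"
proof -
  let ?\<gamma> = "\<lambda>y t. a + t *\<^sub>R (y - a)" and ?F' = "ray_integrand_deriv a W W'"
  have "((\<lambda>y. integral (cbox 0 1) (\<lambda>t. W (?\<gamma> y t) \<bullet> (y - a))) has_derivative
      integral (cbox 0 1) (?F' x)) (at x within S)"
  proof (rule leibniz_rule)
    fix y :: 'a and t :: real assume y: "y \<in> S" and t: "t \<in> cbox 0 1"
    have "(W has_derivative W' (?\<gamma> y t)) (at (?\<gamma> y t))"
      by (rule irrotational_on_has_derivative[OF irr]) (use ray_in_convex S y t in auto)
    then have "((\<lambda>y. W (?\<gamma> y t)) has_derivative (\<lambda>h. W' (?\<gamma> y t) (t *\<^sub>R h))) (at y within S)"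
      by (rule has_derivative_compose[where f="\<lambda>y. ?\<gamma> y t", rotated])
        (auto intro!: derivative_eq_intros)
    then have "((\<lambda>y. W (?\<gamma> y t) \<bullet> (y - a)) has_derivative
        (\<lambda>h. W (?\<gamma> y t) \<bullet> h + W' (?\<gamma> y t) (t *\<^sub>R h) \<bullet> (y - a))) (at y within S)"
      by (rule has_derivative_inner) (auto intro!: derivative_eq_intros)
    then show "((\<lambda>y. W (?\<gamma> y t) \<bullet> (y - a)) has_derivative ?F' y t) (at y within S)"
      by (simp add: ray_integrand_deriv_apply[abs_def] blinfun.scaleR_right add.commute)
  next
    fix y assume "y \<in> S"
    then show "(\<lambda>t. W (?\<gamma> y t) \<bullet> (y - a)) integrable_on cbox 0 1"
      by (intro integrable_continuous continuous_intros
          continuous_on_compose2[OF irrotational_on_continuous_on[OF irr]])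
        (auto intro!: ray_in_convex[OF S(1,3)])
  qed (use x S continuous_on_ray_integrand_deriv[OF irr S(1,3)] in auto)
  then show ?thesis
    by (simp add: ray_potential_def[abs_def] at_within_open[OF x S(2)])
qed

lemma integral_ray_integrand_deriv:
  assumes irr: "irrotational_on S W W'" and S: "convex S" "a \<in> S" and x: "x \<in> S"
  shows "((\<lambda>t. ray_integrand_deriv a W W' x t h) has_integral W x \<bullet> h) {0..1}"
proof -
  let ?\<gamma> = "\<lambda>t. a + t *\<^sub>R (x - a)"
  have "((\<lambda>t. ray_integrand_deriv a W W' x t h) has_integral
      1 *\<^sub>R (W (?\<gamma> 1) \<bullet> h) - 0 *\<^sub>R (W (?\<gamma> 0) \<bullet> h)) {0..1}"
  proof (rule fundamental_theorem_of_calculus)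
    fix t :: real assume t: "t \<in> {0..1}"
    have \<gamma>: "?\<gamma> t \<in> S" using ray_in_convex S x t by auto
    have "((\<lambda>t. W (?\<gamma> t)) has_vector_derivative W' (?\<gamma> t) (x - a)) (at t within {0..1})"
      by (rule has_vector_derivative_compose[OF has_vector_derivative_line
            irrotational_on_has_derivative[OF irr \<gamma>]])
    from has_vector_derivative_scaleR[OF DERIV_ident
        bounded_linear.has_vector_derivative[OF bounded_linear_inner_left this]]
    have "((\<lambda>t. t *\<^sub>R (W (?\<gamma> t) \<bullet> h)) has_vector_derivative
        t *\<^sub>R (W' (?\<gamma> t) (x - a) \<bullet> h) + 1 *\<^sub>R (W (?\<gamma> t) \<bullet> h)) (at t within {0..1})" .
    then show "((\<lambda>t. t *\<^sub>R (W (?\<gamma> t) \<bullet> h)) has_vector_derivative ray_integrand_deriv a W W' x t h)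
        (at t within {0..1})"
      using irrotational_on_symmetric[OF irr \<gamma>, of h "x - a"] by (simp add: ray_integrand_deriv_apply)
  qed simp
  then show ?thesis by simp
qed

lemma poincare_lemma:
  assumes irr: "irrotational_on S W W'" and S: "convex S" "open S"
  obtains p where "\<And>x. x \<in> S \<Longrightarrow> (p has_derivative (\<lambda>h. W x \<bullet> h)) (at x)"
proof (cases "S = {}")
  case False
  then obtain a where a: "a \<in> S" by auto
  have "(ray_potential a W has_derivative (\<lambda>h. W x \<bullet> h)) (at x)" if x: "x \<in> S" for x
  proof -
    have "continuous_on {0..1} (ray_integrand_deriv a W W' x)"
      using continuous_on_compose2[OF continuous_on_ray_integrand_deriv[OF irr S(1) a]
          continuous_on_Pair[OF continuous_on_const[of "{0..1}" x] continuous_on_id]] x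
      by auto
    then have "integral {0..1} (ray_integrand_deriv a W W' x) h = W x \<bullet> h" for h
      using blinfun_apply_integral integrable_continuous_interval
        integral_unique[OF integral_ray_integrand_deriv[OF irr S(1) a x]]
      by metis
    then show ?thesis
      using ray_potential_has_derivative_integral[OF irr S a x] by presburger
  qed
  then show ?thesis using that by blast
qed (use that in auto)

definition pullback_field ::
  "('a::euclidean_space \<Rightarrow> 'b::euclidean_space) \<Rightarrow> ('b \<Rightarrow> 'b) \<Rightarrow> 'a \<Rightarrow> 'a" where
  "pullback_field \<Psi> B x = adjoint (frechet_derivative \<Psi> (at x)) (B (\<Psi> x))"

lemma pullback_field_inner:
  "\<Psi> differentiable (at x) \<Longrightarrow> pullback_field \<Psi> B x \<bullet> h = B (\<Psi> x) \<bullet> dir_deriv \<Psi> h x"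
  unfolding pullback_field_def frechet_derivative_works
  by (metis adjoint_clauses(2) has_derivative_linear)

lemma sum_Basis_inner_linear:
  fixes L :: "'a::euclidean_space \<Rightarrow> 'b::euclidean_space"
  assumes "linear L"
  shows "(\<Sum>b\<in>Basis. (y \<bullet> L b) *\<^sub>R b) \<bullet> h = y \<bullet> L h"
proof -
  have "(\<Sum>b\<in>Basis. (y \<bullet> L b) *\<^sub>R b) = (\<Sum>b\<in>Basis. (adjoint L y \<bullet> b) *\<^sub>R b)"
    by (simp add: adjoint_clauses(2)[OF assms])
  also have "\<dots> = adjoint L y" by (rule euclidean_representation)
  finally show ?thesis by (simp add: adjoint_clauses(2)[OF assms])
qed

definition pullback_field_deriv ::
  "('a::euclidean_space \<Rightarrow> 'b::euclidean_space) \<Rightarrow> ('b \<Rightarrow> 'b) \<Rightarrow> ('b \<Rightarrow> 'b \<Rightarrow>\<^sub>L 'b) \<Rightarrow> 'a \<Rightarrow> 'a \<Rightarrow> 'a" where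
  "pullback_field_deriv \<Psi> B B' x a =
    (\<Sum>b\<in>Basis. (B (\<Psi> x) \<bullet> dir_deriv (dir_deriv \<Psi> a) b x + B' (\<Psi> x) (dir_deriv \<Psi> a x) \<bullet> dir_deriv \<Psi> b x) *\<^sub>R b)"

lemma pullback_field_deriv_inner:
  assumes \<Psi>: "Ck_differentiable (Suc (Suc 0)) \<Psi>"
  shows "pullback_field_deriv \<Psi> B B' x a \<bullet> h =
    B (\<Psi> x) \<bullet> dir_deriv (dir_deriv \<Psi> a) h x + B' (\<Psi> x) (dir_deriv \<Psi> a x) \<bullet> dir_deriv \<Psi> h x"
proof -
  have "linear (frechet_derivative \<Psi> (at x))" "linear (frechet_derivative (dir_deriv \<Psi> a) (at x))"
    using Ck_differentiable_has_derivative[OF \<Psi>]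
      Ck_differentiable_has_derivative[OF Ck_differentiable_dir_deriv[OF \<Psi>]]
    by (auto intro: has_derivative_linear)
  then show ?thesis
    unfolding pullback_field_deriv_def scaleR_add_left sum.distrib inner_add_left
    by (simp add: sum_Basis_inner_linear)
qed

lemma pullback_field_has_derivative:
  assumes B: "(B has_derivative blinfun_apply (B' (\<Psi> x))) (at (\<Psi> x))"
      and \<Psi>: "Ck_differentiable (Suc (Suc 0)) \<Psi>"
  shows "(pullback_field \<Psi> B has_derivative pullback_field_deriv \<Psi> B B' x) (at x)"
proof -
  have D: "(\<Psi> has_derivative frechet_derivative \<Psi> (at x)) (at x)" for x
    using Ck_differentiable_has_derivative[OF \<Psi>] .
  have DD: "(dir_deriv \<Psi> b has_derivative frechet_derivative (dir_deriv \<Psi> b) (at x)) (at x)" for b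
    using Ck_differentiable_has_derivative[OF Ck_differentiable_dir_deriv[OF \<Psi>]] .
  have "((\<lambda>x. \<Sum>b\<in>Basis. (B (\<Psi> x) \<bullet> dir_deriv \<Psi> b x) *\<^sub>R b) has_derivative
      (\<lambda>a. \<Sum>b\<in>Basis. (B (\<Psi> x) \<bullet> dir_deriv (dir_deriv \<Psi> b) a x
        + B' (\<Psi> x) (dir_deriv \<Psi> a x) \<bullet> dir_deriv \<Psi> b x) *\<^sub>R b)) (at x)"
    by (intro has_derivative_sum has_derivative_scaleR_left has_derivative_inner DD
        has_derivative_compose[OF D B])
  then have "((\<lambda>x. \<Sum>b\<in>Basis. (B (\<Psi> x) \<bullet> dir_deriv \<Psi> b x) *\<^sub>R b) has_derivative
      pullback_field_deriv \<Psi> B B' x) (at x)"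
    by (subst (asm) dir_deriv_commute[OF \<Psi>]) (simp add: pullback_field_deriv_def[abs_def])
  moreover have "(\<Sum>b\<in>Basis. (B (\<Psi> x) \<bullet> dir_deriv \<Psi> b x) *\<^sub>R b) = pullback_field \<Psi> B x" for x
  proof (rule euclidean_eqI)
    fix h
    show "(\<Sum>b\<in>Basis. (B (\<Psi> x) \<bullet> dir_deriv \<Psi> b x) *\<^sub>R b) \<bullet> h = pullback_field \<Psi> B x \<bullet> h"
      using D[of x] by (subst pullback_field_inner)
        (auto simp: differentiable_def intro!: sum_Basis_inner_linear has_derivative_linear)
  qed
  ultimately show ?thesis by simp
qed

lemma irrotational_on_pullback_field:
  fixes \<Psi> :: "'a::euclidean_space \<Rightarrow> 'b::euclidean_space"
  assumes irr: "irrotational_on \<Omega> B B'" and \<Psi>: "Ck_differentiable (Suc (Suc 0)) \<Psi>"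
    and S: "\<Psi> ` S \<subseteq> \<Omega>"
  obtains W' where "irrotational_on S (pullback_field \<Psi> B) W'"
proof -
  let ?W' = "pullback_field_deriv \<Psi> B B'"
  have deriv: "(pullback_field \<Psi> B has_derivative ?W' x) (at x)" if "x \<in> S" for x
    by (intro pullback_field_has_derivative irrotational_on_has_derivative[OF irr] \<Psi>)
      (use that S in blast)
  have W'_blinfun: "blinfun_apply (Blinfun (?W' x)) = ?W' x" if "x \<in> S" for x
    using has_derivative_bounded_linear[OF deriv[OF that]] by (rule bounded_linear_Blinfun_apply)
  note D\<Psi> = Ck_differentiable_dir_deriv[OF \<Psi>]
  have "continuous_on S (\<lambda>x. ?W' x v)" for v
    unfolding pullback_field_deriv_def
    by (intro continuous_intros Ck_differentiable_imp_continuous_on[OF Ck_differentiable_dir_deriv[OF D\<Psi>]]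
        Ck_differentiable_imp_continuous_on[OF D\<Psi>]
        irrotational_on_continuous_on[OF irr, THEN continuous_on_compose2]
        irrotational_on_continuous_on_deriv[OF irr, THEN continuous_on_compose2]
        Ck_differentiable_imp_continuous_on[OF \<Psi>] S)
  then have "continuous_on S (\<lambda>x. Blinfun (?W' x))"
    by (intro continuous_on_blinfun_componentwise) (auto simp: W'_blinfun cong: continuous_on_cong)
  moreover have "?W' x a \<bullet> b = ?W' x b \<bullet> a" if "x \<in> S" for x a b
    using irrotational_on_symmetric[OF irr, of "\<Psi> x"]
      dir_deriv_commute[OF \<Psi>, where x=x and a=a and b=b] S that
    by (auto simp: pullback_field_deriv_inner[OF \<Psi>])
  ultimately show thesis
    using that[of "\<lambda>x. Blinfun (?W' x)"] deriv by (simp add: irrotational_on_def W'_blinfun)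
qed

section \<open>Iterated integrals\<close>

lemma continuous_on_compose_curried2:
  assumes "continuous_on (X \<times> Y) (\<lambda>(x, y). f x y)" "continuous_on S a" "continuous_on S b"
    "\<And>s. s \<in> S \<Longrightarrow> a s \<in> X \<and> b s \<in> Y"
  shows "continuous_on S (\<lambda>s. f (a s) (b s))"
  using continuous_on_compose2[OF assms(1) continuous_on_Pair[OF assms(2,3)]] assms(4)
  by (auto simp: image_subset_iff)

lemma continuous_on_compose_curried3:
  assumes "continuous_on (X \<times> Y \<times> Z) (\<lambda>(x, y, z). f x y z)"
    "continuous_on S a" "continuous_on S b" "continuous_on S c"
    "\<And>s. s \<in> S \<Longrightarrow> a s \<in> X \<and> b s \<in> Y \<and> c s \<in> Z"
  shows "continuous_on S (\<lambda>s. f (a s) (b s) (c s))"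
  using continuous_on_compose2
    [OF assms(1) continuous_on_Pair[OF assms(2) continuous_on_Pair[OF assms(3,4)]]] assms(5)
  by (auto simp: image_subset_iff)

lemma continuous_on_integral_Icc:
  fixes f :: "'a::topological_space \<Rightarrow> real \<Rightarrow> 'b::banach"
  assumes "continuous_on (S \<times> {a..b}) (\<lambda>(x, y). f x y)"
  shows "continuous_on S (\<lambda>x. integral {a..b} (f x))"
  using integral_continuous_on_param[of S a b f] assms by simp

lemma continuous_on_double_integral:
  fixes f :: "'a::topological_space \<Rightarrow> real \<Rightarrow> real \<Rightarrow> 'b::banach"
  assumes "continuous_on (S \<times> {a..b} \<times> {c..d}) (\<lambda>(r, x, y). f r x y)"
  shows "continuous_on S (\<lambda>r. integral {a..b} (\<lambda>x. integral {c..d} (f r x)))"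
proof (intro continuous_on_integral_Icc)
  have "continuous_on ((S \<times> {a..b}) \<times> {c..d}) (\<lambda>(p, y). f (fst p) (snd p) y)"
    unfolding case_prod_beta
    by (rule continuous_on_compose_curried3[OF assms]) (auto intro!: continuous_intros)
  from continuous_on_integral_Icc[OF this]
  show "continuous_on (S \<times> {a..b}) (\<lambda>(r, x). integral {c..d} (f r x))"
    by (simp add: case_prod_beta)
qed

lemma double_integral_eq:
  fixes f :: "real \<Rightarrow> real \<Rightarrow> 'a::euclidean_space"
  assumes "continuous_on ({a..b} \<times> {c..d}) (\<lambda>(x, y). f x y)"
  shows "integral {a..b} (\<lambda>x. integral {c..d} (f x)) = integral (cbox (a, c) (b, d)) (\<lambda>(x, y). f x y)"
  using integral_prod_continuous[of a c b d "\<lambda>(x, y). f x y"] assms by (simp add: cbox_Pair_eq)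

lemma double_integral_add:
  fixes f g :: "real \<Rightarrow> real \<Rightarrow> 'a::euclidean_space"
  assumes f: "continuous_on ({a..b} \<times> {c..d}) (\<lambda>(x, y). f x y)"
    and g: "continuous_on ({a..b} \<times> {c..d}) (\<lambda>(x, y). g x y)"
  shows "integral {a..b} (\<lambda>x. integral {c..d} (\<lambda>y. f x y + g x y))
    = integral {a..b} (\<lambda>x. integral {c..d} (f x)) + integral {a..b} (\<lambda>x. integral {c..d} (g x))"
proof -
  have integrable: "h integrable_on cbox (a, c) (b, d)" if "continuous_on ({a..b} \<times> {c..d}) h"
      for h :: "real \<times> real \<Rightarrow> 'a"
    by (rule integrable_continuous) (simp add: cbox_Pair_eq that)
  have fg: "continuous_on ({a..b} \<times> {c..d}) (\<lambda>(x, y). f x y + g x y)"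
    using continuous_on_add[OF f g] by (simp add: case_prod_unfold)
  have "(\<lambda>(x, y). f x y + g x y) = (\<lambda>p. (case p of (x, y) \<Rightarrow> f x y) + (case p of (x, y) \<Rightarrow> g x y))"
    by auto
  then show ?thesis
    unfolding double_integral_eq[OF fg] double_integral_eq[OF f] double_integral_eq[OF g]
    using integral_add[OF integrable[OF f] integrable[OF g]] by presburger
qed

lemma double_integral_diff:
  fixes f g :: "real \<Rightarrow> real \<Rightarrow> 'a::euclidean_space"
  assumes f: "continuous_on ({a..b} \<times> {c..d}) (\<lambda>(x, y). f x y)"
    and g: "continuous_on ({a..b} \<times> {c..d}) (\<lambda>(x, y). g x y)"
  shows "integral {a..b} (\<lambda>x. integral {c..d} (\<lambda>y. f x y - g x y))
    = integral {a..b} (\<lambda>x. integral {c..d} (f x)) - integral {a..b} (\<lambda>x. integral {c..d} (g x))"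
  using double_integral_add[OF f, of "\<lambda>x y. - g x y"] continuous_on_minus[OF g]
  by (simp add: case_prod_beta)

lemma double_integral_swap:
  fixes f :: "real \<Rightarrow> real \<Rightarrow> 'a::euclidean_space"
  assumes "continuous_on ({a..b} \<times> {c..d}) (\<lambda>(x, y). f x y)"
  shows "integral {a..b} (\<lambda>x. integral {c..d} (f x)) = integral {c..d} (\<lambda>y. integral {a..b} (\<lambda>x. f x y))"
  using integral_swap_continuous[of a c b d f] assms by (simp add: cbox_Pair_eq)

lemma abs_double_integral_le:
  fixes f :: "real \<Rightarrow> real \<Rightarrow> real"
  assumes le: "a \<le> b" "c \<le> d" "0 \<le> C"
    and f: "continuous_on ({a..b} \<times> {c..d}) (\<lambda>(x, y). f x y)"
    and C: "\<And>x y. x \<in> {a..b} \<Longrightarrow> y \<in> {c..d} \<Longrightarrow> \<bar>f x y\<bar> \<le> C"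
  shows "\<bar>integral {a..b} (\<lambda>x. integral {c..d} (f x))\<bar> \<le> C * ((b - a) * (d - c))"
proof -
  have "(\<lambda>(x, y). f x y) integrable_on cbox (a, c) (b, d)"
    by (rule integrable_continuous) (simp add: cbox_Pair_eq f)
  then have "norm (integral (cbox (a, c) (b, d)) (\<lambda>(x, y). f x y)) \<le> C * measure lborel (cbox (a, c) (b, d))"
    by (rule integrable_bound[OF le(3)]) (use C in auto)
  then show ?thesis
    using le by (simp add: double_integral_eq[OF f] content_Pair)
qed

lemma triple_integral_eq:
  fixes f :: "real \<Rightarrow> real \<Rightarrow> real \<Rightarrow> 'a::euclidean_space"
  assumes f: "continuous_on ({a1..b1} \<times> {a2..b2} \<times> {a3..b3}) (\<lambda>(x, y, z). f x y z)"
  shows "integral {a1..b1} (\<lambda>x. integral {a2..b2} (\<lambda>y. integral {a3..b3} (f x y)))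
    = integral (cbox (a1, a2, a3) (b1, b2, b3)) (\<lambda>(x, y, z). f x y z)"
proof -
  have "integral (cbox (a2, a3) (b2, b3)) (\<lambda>(y, z). f x y z)
      = integral {a2..b2} (\<lambda>y. integral {a3..b3} (f x y))" if "x \<in> {a1..b1}" for x
  proof (rule double_integral_eq[symmetric])
    show "continuous_on ({a2..b2} \<times> {a3..b3}) (\<lambda>(y, z). f x y z)"
      unfolding case_prod_beta
      by (rule continuous_on_compose_curried3[OF f]) (use that in \<open>auto intro!: continuous_intros\<close>)
  qed
  then have "integral {a1..b1} (\<lambda>x. integral (cbox (a2, a3) (b2, b3)) (\<lambda>(y, z). f x y z))
      = integral {a1..b1} (\<lambda>x. integral {a2..b2} (\<lambda>y. integral {a3..b3} (f x y)))"
    by (rule integral_cong)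
  moreover have "continuous_on (cbox (a1, a2, a3) (b1, b2, b3)) (\<lambda>(x, y, z). f x y z)"
    using f by (simp add: cbox_Pair_eq)
  from integral_prod_continuous[OF this]
  have "integral (cbox (a1, a2, a3) (b1, b2, b3)) (\<lambda>(x, y, z). f x y z)
      = integral {a1..b1} (\<lambda>x. integral (cbox (a2, a3) (b2, b3)) (\<lambda>(y, z). f x y z))"
    by simp
  ultimately show ?thesis by simp
qed

lemma triple_integral_add:
  fixes f g :: "real \<Rightarrow> real \<Rightarrow> real \<Rightarrow> 'a::euclidean_space"
  assumes f: "continuous_on ({a1..b1} \<times> {a2..b2} \<times> {a3..b3}) (\<lambda>(x, y, z). f x y z)"
    and g: "continuous_on ({a1..b1} \<times> {a2..b2} \<times> {a3..b3}) (\<lambda>(x, y, z). g x y z)"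
  shows "integral {a1..b1} (\<lambda>x. integral {a2..b2} (\<lambda>y. integral {a3..b3} (\<lambda>z. f x y z + g x y z)))
    = integral {a1..b1} (\<lambda>x. integral {a2..b2} (\<lambda>y. integral {a3..b3} (f x y)))
    + integral {a1..b1} (\<lambda>x. integral {a2..b2} (\<lambda>y. integral {a3..b3} (g x y)))"
proof -
  have integrable: "h integrable_on cbox (a1, a2, a3) (b1, b2, b3)"
      if "continuous_on ({a1..b1} \<times> {a2..b2} \<times> {a3..b3}) h" for h :: "real \<times> real \<times> real \<Rightarrow> 'a"
    by (rule integrable_continuous) (simp add: cbox_Pair_eq that)
  have fg: "continuous_on ({a1..b1} \<times> {a2..b2} \<times> {a3..b3}) (\<lambda>(x, y, z). f x y z + g x y z)"
    using continuous_on_add[OF f g] by (simp add: case_prod_unfold)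
  have "(\<lambda>(x, y, z). f x y z + g x y z) = (\<lambda>p. (case p of (x, y, z) \<Rightarrow> f x y z)
      + (case p of (x, y, z) \<Rightarrow> g x y z))"
    by auto
  then show ?thesis
    unfolding triple_integral_eq[OF fg] triple_integral_eq[OF f] triple_integral_eq[OF g]
    using integral_add[OF integrable[OF f] integrable[OF g]] by presburger
qed

lemma triple_integral_swap_inner:
  fixes f :: "real \<Rightarrow> real \<Rightarrow> real \<Rightarrow> 'a::euclidean_space"
  assumes f: "continuous_on ({a1..b1} \<times> {a2..b2} \<times> {a3..b3}) (\<lambda>(x, y, z). f x y z)"
  shows "integral {a1..b1} (\<lambda>x. integral {a2..b2} (\<lambda>y. integral {a3..b3} (f x y)))
    = integral {a1..b1} (\<lambda>x. integral {a3..b3} (\<lambda>z. integral {a2..b2} (\<lambda>y. f x y z)))"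
proof (rule integral_cong, rule double_integral_swap)
  fix x assume "x \<in> {a1..b1}"
  then show "continuous_on ({a2..b2} \<times> {a3..b3}) (\<lambda>(y, z). f x y z)"
    unfolding case_prod_beta
    by (intro continuous_on_compose_curried3[OF f]) (auto intro!: continuous_intros)
qed

lemma triple_integral_rotate:
  fixes f :: "real \<Rightarrow> real \<Rightarrow> real \<Rightarrow> 'a::euclidean_space"
  assumes f: "continuous_on ({a1..b1} \<times> {a2..b2} \<times> {a3..b3}) (\<lambda>(x, y, z). f x y z)"
  shows "integral {a1..b1} (\<lambda>x. integral {a2..b2} (\<lambda>y. integral {a3..b3} (f x y)))
    = integral {a2..b2} (\<lambda>y. integral {a3..b3} (\<lambda>z. integral {a1..b1} (\<lambda>x. f x y z)))"
proof -
  have "continuous_on (({a1..b1} \<times> {a2..b2}) \<times> {a3..b3}) (\<lambda>(p, z). f (fst p) (snd p) z)"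
    unfolding case_prod_beta
    by (rule continuous_on_compose_curried3[OF f]) (auto intro!: continuous_intros)
  from continuous_on_integral_Icc[OF this]
  have "integral {a1..b1} (\<lambda>x. integral {a2..b2} (\<lambda>y. integral {a3..b3} (f x y)))
      = integral {a2..b2} (\<lambda>y. integral {a1..b1} (\<lambda>x. integral {a3..b3} (f x y)))"
    by (intro double_integral_swap) (simp add: case_prod_beta)
  also have "\<dots> = integral {a2..b2} (\<lambda>y. integral {a3..b3} (\<lambda>z. integral {a1..b1} (\<lambda>x. f x y z)))"
  proof (rule triple_integral_swap_inner)
    show "continuous_on ({a2..b2} \<times> {a1..b1} \<times> {a3..b3}) (\<lambda>(y, x, z). f x y z)"
      unfolding case_prod_beta
      by (rule continuous_on_compose_curried3[OF f]) (auto intro!: continuous_intros)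
  qed
  finally show ?thesis .
qed

lemma integral_real_derivative:
  fixes f :: "real \<Rightarrow> real"
  assumes "a \<le> b" "\<And>x. x \<in> {a..b} \<Longrightarrow> (f has_real_derivative f' x) (at x within {a..b})"
  shows "integral {a..b} f' = f b - f a"
  using fundamental_theorem_of_calculus[OF assms(1)] assms(2)
  by (intro integral_unique) (auto simp: has_real_derivative_iff_has_vector_derivative)

lemma green_rectangle:
  fixes P Q P1 Q2 :: "real \<Rightarrow> real \<Rightarrow> real"
  assumes le: "a1 \<le> b1" "a2 \<le> b2"
    and P: "\<And>x y. x \<in> {a1..b1} \<Longrightarrow> y \<in> {a2..b2} \<Longrightarrow>
      ((\<lambda>x. P x y) has_real_derivative P1 x y) (at x within {a1..b1})"
    and Q: "\<And>x y. x \<in> {a1..b1} \<Longrightarrow> y \<in> {a2..b2} \<Longrightarrow>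
      ((\<lambda>y. Q x y) has_real_derivative Q2 x y) (at y within {a2..b2})"
    and cont: "continuous_on ({a1..b1} \<times> {a2..b2}) (\<lambda>(x, y). P1 x y)"
      "continuous_on ({a1..b1} \<times> {a2..b2}) (\<lambda>(x, y). Q2 x y)"
  shows "integral {a1..b1} (\<lambda>x. integral {a2..b2} (\<lambda>y. P1 x y + Q2 x y))
    = integral {a2..b2} (\<lambda>y. P b1 y - P a1 y) + integral {a1..b1} (\<lambda>x. Q x b2 - Q x a2)"
proof -
  have "integral {a1..b1} (\<lambda>x. integral {a2..b2} (\<lambda>y. P1 x y)) = integral {a2..b2} (\<lambda>y. P b1 y - P a1 y)"
    unfolding double_integral_swap[OF cont(1)] by (intro integral_cong integral_real_derivative le P)
  moreover have "integral {a1..b1} (\<lambda>x. integral {a2..b2} (\<lambda>y. Q2 x y))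
      = integral {a1..b1} (\<lambda>x. Q x b2 - Q x a2)"
    by (intro integral_cong integral_real_derivative le Q)
  ultimately show ?thesis by (simp add: double_integral_add[OF cont])
qed

lemma divergence_box:
  fixes P Q R P1 Q2 R3 :: "real \<Rightarrow> real \<Rightarrow> real \<Rightarrow> real"
  assumes le: "a1 \<le> b1" "a2 \<le> b2" "a3 \<le> b3"
    and P: "\<And>x y z. x \<in> {a1..b1} \<Longrightarrow> y \<in> {a2..b2} \<Longrightarrow> z \<in> {a3..b3} \<Longrightarrow>
      ((\<lambda>x. P x y z) has_real_derivative P1 x y z) (at x within {a1..b1})"
    and Q: "\<And>x y z. x \<in> {a1..b1} \<Longrightarrow> y \<in> {a2..b2} \<Longrightarrow> z \<in> {a3..b3} \<Longrightarrow>
      ((\<lambda>y. Q x y z) has_real_derivative Q2 x y z) (at y within {a2..b2})"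
    and R: "\<And>x y z. x \<in> {a1..b1} \<Longrightarrow> y \<in> {a2..b2} \<Longrightarrow> z \<in> {a3..b3} \<Longrightarrow>
      ((\<lambda>z. R x y z) has_real_derivative R3 x y z) (at z within {a3..b3})"
    and cont: "continuous_on ({a1..b1} \<times> {a2..b2} \<times> {a3..b3}) (\<lambda>(x, y, z). P1 x y z)"
      "continuous_on ({a1..b1} \<times> {a2..b2} \<times> {a3..b3}) (\<lambda>(x, y, z). Q2 x y z)"
      "continuous_on ({a1..b1} \<times> {a2..b2} \<times> {a3..b3}) (\<lambda>(x, y, z). R3 x y z)"
  shows "integral {a1..b1} (\<lambda>x. integral {a2..b2}
      (\<lambda>y. integral {a3..b3} (\<lambda>z. P1 x y z + Q2 x y z + R3 x y z)))
    = integral {a2..b2} (\<lambda>y. integral {a3..b3} (\<lambda>z. P b1 y z - P a1 y z))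
    + integral {a1..b1} (\<lambda>x. integral {a3..b3} (\<lambda>z. Q x b2 z - Q x a2 z))
    + integral {a1..b1} (\<lambda>x. integral {a2..b2} (\<lambda>y. R x y b3 - R x y a3))"
proof -
  have "integral {a1..b1} (\<lambda>x. integral {a2..b2} (\<lambda>y. integral {a3..b3} (\<lambda>z. P1 x y z)))
      = integral {a2..b2} (\<lambda>y. integral {a3..b3} (\<lambda>z. P b1 y z - P a1 y z))"
    unfolding triple_integral_rotate[OF cont(1)] by (intro integral_cong integral_real_derivative le P)
  moreover have "integral {a1..b1} (\<lambda>x. integral {a2..b2} (\<lambda>y. integral {a3..b3} (\<lambda>z. Q2 x y z)))
      = integral {a1..b1} (\<lambda>x. integral {a3..b3} (\<lambda>z. Q x b2 z - Q x a2 z))"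
    unfolding triple_integral_swap_inner[OF cont(2)] by (intro integral_cong integral_real_derivative le Q)
  moreover have "integral {a1..b1} (\<lambda>x. integral {a2..b2} (\<lambda>y. integral {a3..b3} (\<lambda>z. R3 x y z)))
      = integral {a1..b1} (\<lambda>x. integral {a2..b2} (\<lambda>y. R x y b3 - R x y a3))"
    by (intro integral_cong integral_real_derivative le R)
  moreover have "continuous_on ({a1..b1} \<times> {a2..b2} \<times> {a3..b3}) (\<lambda>(x, y, z). P1 x y z + Q2 x y z)"
    using continuous_on_add[OF cont(1,2)] by (simp add: case_prod_beta)
  ultimately show ?thesis
    by (simp add: triple_integral_add[OF _ cont(3)] triple_integral_add[OF cont(1,2)])
qed

section \<open>Integrals over three-dimensional space\<close>

definition vec3 :: "real \<times> real \<times> real \<Rightarrow> real^3" where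
  "vec3 q = fst q *\<^sub>R axis 1 1 + fst (snd q) *\<^sub>R axis 2 1 + snd (snd q) *\<^sub>R axis 3 1"

lemma vec3_nth [simp]: "vec3 (x, y, z) $ 1 = x" "vec3 (x, y, z) $ 2 = y" "vec3 (x, y, z) $ 3 = z"
  by (simp_all add: vec3_def axis_def)

lemma vec3_components [simp]: "vec3 (p $ 1, p $ 2, p $ 3) = p"
  by (simp add: vec_eq_iff forall_3)

lemma continuous_on_vec3: "continuous_on S q \<Longrightarrow> continuous_on S (\<lambda>x. vec3 (q x))"
  unfolding vec3_def by (intro continuous_intros)

lemma mem_cbox_real3: "p \<in> cbox a b \<longleftrightarrow> p$1 \<in> {a$1..b$1} \<and> p$2 \<in> {a$2..b$2} \<and> p$3 \<in> {a$3..b$3}"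
  for p :: "real^3"
  by (auto simp: mem_box_cart forall_3)

lemma vec3_image_cbox: "vec3 ` cbox u w = cbox (vec3 u) (vec3 w)"
proof -
  obtain u1 u2 u3 w1 w2 w3 where u: "u = (u1, u2, u3)" and w: "w = (w1, w2, w3)"
    by (metis surj_pair)
  show ?thesis
  proof (intro subset_antisym subsetI)
    fix p assume "p \<in> cbox (vec3 u) (vec3 w)"
    then have "(p$1, p$2, p$3) \<in> cbox u w"
      by (auto simp: u w mem_cbox_real3 cbox_Pair_eq)
    then show "p \<in> vec3 ` cbox u w" by (metis imageI vec3_components)
  qed (auto simp: mem_cbox_real3 cbox_Pair_eq u w)
qed

lemma content_vec3_image: "measure lborel (vec3 ` cbox u w) = measure lborel (cbox u w)"
proof -
  obtain u1 u2 u3 w1 w2 w3 where u: "u = (u1, u2, u3)" and w: "w = (w1, w2, w3)"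
    by (metis surj_pair)
  show ?thesis
  proof (cases "u1 \<le> w1 \<and> u2 \<le> w2 \<and> u3 \<le> w3")
    case True
    then have "vec3 u \<in> cbox (vec3 u) (vec3 w)" by (simp add: mem_cbox_real3 u w)
    then have "cbox (vec3 u) (vec3 w) \<noteq> {}" by blast
    then have "measure lborel (cbox (vec3 u) (vec3 w)) = (\<Prod>i\<in>UNIV. vec3 w $ i - vec3 u $ i)"
      by (rule content_cbox_cart)
    also have "\<dots> = (w1 - u1) * ((w2 - u2) * (w3 - u3))"
      unfolding UNIV_3 by (simp add: u w)
    finally show ?thesis
      using True by (simp only: vec3_image_cbox) (simp add: u w content_Pair)
  next
    case False
    then have "cbox (vec3 u) (vec3 w) = {}"
      by (auto simp: mem_cbox_real3 u w)
    then show ?thesis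
      using False by (simp only: vec3_image_cbox) (auto simp: u w content_Pair)
  qed
qed

lemma integral_cbox_vec3:
  fixes f :: "real^3 \<Rightarrow> 'a::euclidean_space"
  assumes f: "continuous_on (cbox a b) f"
  shows "integral (cbox a b) f
    = integral {a$1..b$1} (\<lambda>x. integral {a$2..b$2} (\<lambda>y. integral {a$3..b$3} (\<lambda>z. f (vec3 (x, y, z)))))"
proof -
  define h :: "real^3 \<Rightarrow> real \<times> real \<times> real" where "h p = (p$1, p$2, p$3)" for p
  have inv: "h (vec3 q) = q" "vec3 (h p) = p" for p q by (cases q, simp_all add: h_def)
  have h_cbox: "h ` cbox u w = cbox (h u) (h w)" for u w
  proof -
    have "cbox u w = vec3 ` cbox (h u) (h w)" by (simp add: vec3_image_cbox inv)
    then show ?thesis by (simp add: image_image inv)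
  qed
  have "((\<lambda>q. f (vec3 q)) has_integral (1 / 1) *\<^sub>R integral (cbox a b) f) (h ` cbox a b)"
  proof (rule has_integral_twiddle[where g=vec3])
    show "continuous (at q) vec3" for q
      using continuous_on_vec3[OF continuous_on_id[of UNIV]] continuous_on_eq_continuous_at open_UNIV by blast
    show "(f has_integral integral (cbox a b) f) (cbox a b)"
      using integrable_continuous[OF f] by (rule integrable_integral)
    show "\<exists>v z. vec3 ` cbox u w = cbox v z" for u w by (intro exI) (rule vec3_image_cbox)
    show "\<exists>v z. h ` cbox u w = cbox v z" for u w by (intro exI) (rule h_cbox)
    show "measure lborel (vec3 ` cbox u w) = 1 * measure lborel (cbox u w)" for u w
      by (simp only: content_vec3_image mult_1)
  qed (use inv in \<open>simp_all\<close>)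
  then have "integral (cbox a b) f = integral (cbox (h a) (h b)) (\<lambda>q. f (vec3 q))"
    by (simp add: h_cbox integral_unique)
  moreover have "continuous_on (cbox (h a) (h b)) (\<lambda>q. f (vec3 q))"
    by (rule continuous_on_compose2[OF f continuous_on_vec3]) (simp_all add: vec3_image_cbox inv)
  then have "continuous_on ({a$1..b$1} \<times> {a$2..b$2} \<times> {a$3..b$3}) (\<lambda>(x, y, z). f (vec3 (x, y, z)))"
    by (simp add: h_def cbox_Pair_eq)
  moreover have "(\<lambda>(x, y, z). f (vec3 (x, y, z))) = (\<lambda>q. f (vec3 q))" by auto
  ultimately show ?thesis
    by (simp add: triple_integral_eq h_def)
qed

lemma integral_cube_divergence:
  fixes Y :: "real^3 \<Rightarrow> real^3"
  assumes dY: "\<And>p. (Y has_derivative Y' p) (at p)" and cY: "\<And>h. continuous_on UNIV (\<lambda>p. Y' p h)"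
    and R: "0 \<le> R"
  shows "integral (cbox (vec3 (-R, -R, -R)) (vec3 (R, R, R))) (\<lambda>p. trace (matrix (Y' p)))
    = integral {-R..R} (\<lambda>y. integral {-R..R} (\<lambda>z. Y (vec3 (R, y, z)) $ 1 - Y (vec3 (-R, y, z)) $ 1))
    + integral {-R..R} (\<lambda>x. integral {-R..R} (\<lambda>z. Y (vec3 (x, R, z)) $ 2 - Y (vec3 (x, -R, z)) $ 2))
    + integral {-R..R} (\<lambda>x. integral {-R..R} (\<lambda>y. Y (vec3 (x, y, R)) $ 3 - Y (vec3 (x, y, -R)) $ 3))"
proof -
  have tr: "trace (matrix (Y' p)) = Y' p (axis 1 1) $ 1 + Y' p (axis 2 1) $ 2 + Y' p (axis 3 1) $ 3" for p
    by (simp add: trace_def matrix_def sum_3)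
  have line: "((\<lambda>u. Y (c u) $ i) has_real_derivative Y' (c u) e $ i) (at u within T)"
    if "\<And>u. (c has_vector_derivative e) (at u within T)" for c e u i T
    using bounded_linear.has_vector_derivative[OF bounded_linear_vec_nth
        has_vector_derivative_compose[OF that dY]]
    by (simp add: has_real_derivative_iff_has_vector_derivative)
  have edge: "((\<lambda>x. vec3 (x, y, z)) has_vector_derivative axis 1 1) (at u within T)"
    "((\<lambda>y. vec3 (x, y, z)) has_vector_derivative axis 2 1) (at u within T)"
    "((\<lambda>z. vec3 (x, y, z)) has_vector_derivative axis 3 1) (at u within T)" for x y z u T
    unfolding vec3_def by (auto intro!: derivative_eq_intros simp: has_vector_derivative_def)
  have cont: "continuous_on T (\<lambda>(x, y, z). Y' (vec3 (x, y, z)) h $ i)" for T h i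
    unfolding case_prod_beta
    by (intro bounded_linear.continuous_on[OF bounded_linear_vec_nth] continuous_on_compose2[OF cY]
        continuous_on_vec3 continuous_intros) auto
  have "integral (cbox (vec3 (-R, -R, -R)) (vec3 (R, R, R))) (\<lambda>p. trace (matrix (Y' p)))
    = integral {-R..R} (\<lambda>x. integral {-R..R} (\<lambda>y. integral {-R..R}
        (\<lambda>z. trace (matrix (Y' (vec3 (x, y, z)))))))"
    by (subst integral_cbox_vec3)
      (auto simp: tr intro!: continuous_intros continuous_on_subset[OF cY])
  also have "\<dots> = integral {-R..R} (\<lambda>y. integral {-R..R} (\<lambda>z. Y (vec3 (R, y, z)) $ 1
      - Y (vec3 (-R, y, z)) $ 1))
    + integral {-R..R} (\<lambda>x. integral {-R..R} (\<lambda>z. Y (vec3 (x, R, z)) $ 2 - Y (vec3 (x, -R, z)) $ 2))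
    + integral {-R..R} (\<lambda>x. integral {-R..R} (\<lambda>y. Y (vec3 (x, y, R)) $ 3 - Y (vec3 (x, y, -R)) $ 3))"
    unfolding tr by (rule divergence_box; (rule line edge cont)?) (use R edge in auto)
  finally show ?thesis .
qed

lemma abs_integral_face_difference_le:
  fixes Y :: "real^3 \<Rightarrow> real^3" and c d :: "real \<Rightarrow> real \<Rightarrow> real^3"
  assumes Y: "continuous_on UNIV Y" and R: "0 < R" and e: "\<And>p. norm p \<ge> R \<Longrightarrow> norm p ^ 2 * norm (Y p) \<le> e"
    and cont: "continuous_on ({-R..R} \<times> {-R..R}) (\<lambda>(y, z). c y z)"
      "continuous_on ({-R..R} \<times> {-R..R}) (\<lambda>(y, z). d y z)"
    and faces: "\<And>y z. \<bar>c y z $ j\<bar> = R" "\<And>y z. \<bar>d y z $ j\<bar> = R"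
  shows "\<bar>integral {-R..R} (\<lambda>y. integral {-R..R} (\<lambda>z. Y (c y z) $ i - Y (d y z) $ i))\<bar> \<le> 8 * e"
proof -
  have bound: "\<bar>Y p $ i\<bar> \<le> e / R^2" if "\<bar>p $ j\<bar> = R" for p
  proof -
    have "norm p \<ge> R" using that component_le_norm_cart[of p j] by simp
    then have "R^2 * norm (Y p) \<le> norm p ^ 2 * norm (Y p)" using R by (intro mult_right_mono power_mono) auto
    also have "\<dots> \<le> e" using e[OF \<open>norm p \<ge> R\<close>] .
    finally have "norm (Y p) \<le> e / R^2" using R by (simp add: field_simps)
    then show ?thesis using component_le_norm_cart[of "Y p" i] by linarith
  qed
  have "0 \<le> e / R^2" using bound[OF faces(1)] order_trans[OF abs_ge_zero] by blast
  have "\<bar>integral {-R..R} (\<lambda>y. integral {-R..R} (\<lambda>z. Y (c y z) $ i - Y (d y z) $ i))\<bar>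
      \<le> 2 * (e / R^2) * ((R - - R) * (R - - R))"
  proof (rule abs_double_integral_le)
    show "continuous_on ({-R..R} \<times> {-R..R}) (\<lambda>(y, z). Y (c y z) $ i - Y (d y z) $ i)"
      unfolding case_prod_beta
      by (intro continuous_on_diff bounded_linear.continuous_on[OF bounded_linear_vec_nth]
          continuous_on_compose2[OF Y] cont[unfolded case_prod_beta]) simp_all
    show "\<bar>Y (c y z) $ i - Y (d y z) $ i\<bar> \<le> 2 * (e / R^2)" for y z
      using bound[OF faces(1)[of y z]] bound[OF faces(2)[of y z]] by (simp add: abs_le_iff)
  qed (use R \<open>0 \<le> e / R^2\<close> in auto)
  moreover have "2 * (e / R^2) * ((R - - R) * (R - - R)) = 8 * e"
    using R by (simp add: power2_eq_square)
  ultimately show ?thesis by simp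
qed

lemma abs_integral_cube_divergence_le:
  fixes Y :: "real^3 \<Rightarrow> real^3"
  assumes dY: "\<And>p. (Y has_derivative Y' p) (at p)" and cY: "\<And>h. continuous_on UNIV (\<lambda>p. Y' p h)"
    and R: "0 < R" and e: "\<And>p. norm p \<ge> R \<Longrightarrow> norm p ^ 2 * norm (Y p) \<le> e"
  shows "\<bar>integral (cbox (vec3 (-R, -R, -R)) (vec3 (R, R, R))) (\<lambda>p. trace (matrix (Y' p)))\<bar> \<le> 24 * e"
proof -
  have "continuous_on UNIV Y"
    by (meson continuous_at_imp_continuous_on dY has_derivative_continuous)
  note face = abs_integral_face_difference_le[OF this R e]
  have vec3: "continuous_on T (\<lambda>(y, z). vec3 (r, y, z))" "continuous_on T (\<lambda>(y, z). vec3 (y, r, z))"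
    "continuous_on T (\<lambda>(y, z). vec3 (y, z, r))" for r T
    unfolding case_prod_beta by (intro continuous_on_vec3 continuous_intros)+
  let ?F = "\<lambda>c d i. integral {-R..R} (\<lambda>y. integral {-R..R} (\<lambda>z. Y (c y z) $ i - Y (d y z) $ i))"
  have "\<bar>?F (\<lambda>y z. vec3 (R, y, z)) (\<lambda>y z. vec3 (-R, y, z)) 1\<bar> \<le> 8 * e"
    by (rule face[where j=1, OF _ vec3(1) vec3(1)]) (simp_all add: R less_imp_le)
  moreover have "\<bar>?F (\<lambda>x z. vec3 (x, R, z)) (\<lambda>x z. vec3 (x, -R, z)) 2\<bar> \<le> 8 * e"
    by (rule face[where j=2, OF _ vec3(2) vec3(2)]) (simp_all add: R less_imp_le)
  moreover have "\<bar>?F (\<lambda>x y. vec3 (x, y, R)) (\<lambda>x y. vec3 (x, y, -R)) 3\<bar> \<le> 8 * e"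
    by (rule face[where j=3, OF _ vec3(3) vec3(3)]) (simp_all add: R less_imp_le)
  ultimately show ?thesis
    unfolding integral_cube_divergence[OF dY cY less_imp_le[OF R]] by linarith
qed

lemma divergence_integral_zero:
  fixes Y :: "real^3 \<Rightarrow> real^3"
  assumes dY: "\<And>p. (Y has_derivative Y' p) (at p)" and cY: "\<And>h. continuous_on UNIV (\<lambda>p. Y' p h)"
    and decay: "((\<lambda>p. norm p ^ 2 * norm (Y p)) \<longlongrightarrow> 0) at_infinity"
    and supp: "\<forall>\<^sub>F p in at_infinity. trace (matrix (Y' p)) = 0"
  shows "((\<lambda>p. trace (matrix (Y' p))) has_integral 0) UNIV"
proof -
  let ?S = "\<lambda>p. trace (matrix (Y' p))" and ?Q = "\<lambda>R. cbox (vec3 (-R, -R, -R)) (vec3 (R, R, R))"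
  have cont: "continuous_on T ?S" for T
    unfolding trace_def matrix_def by (auto intro!: continuous_intros continuous_on_subset[OF cY])
  obtain R0 where R0: "\<And>p. norm p \<ge> R0 \<Longrightarrow> ?S p = 0"
    using supp by (auto simp: eventually_at_infinity)
  have cube: "(?S has_integral integral (?Q R) ?S) UNIV" if R: "R \<ge> R0" for R
  proof (rule has_integral_on_superset)
    show "(?S has_integral integral (?Q R) ?S) (?Q R)"
      by (rule integrable_integral[OF integrable_continuous[OF cont]])
    fix p assume "p \<notin> ?Q R"
    moreover have "p \<in> ?Q R" if "\<And>j. \<bar>p $ j\<bar> \<le> R"
      using that by (simp add: mem_cbox_real3 abs_le_iff minus_le_iff)
    ultimately obtain j where "\<bar>p $ j\<bar> \<ge> R" using linear by blast
    then show "?S p = 0" using R0 component_le_norm_cart[of p j] R by auto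
  qed auto
  have "\<bar>integral (?Q R0) ?S\<bar> \<le> e" if "e > 0" for e
  proof -
    have "\<forall>\<^sub>F p in at_infinity. norm p ^ 2 * norm (Y p) < e / 24"
      using order_tendstoD(2)[OF decay, of "e / 24"] that by simp
    then obtain R1 where "\<forall>p. norm p \<ge> R1 \<longrightarrow> norm p ^ 2 * norm (Y p) < e / 24"
      unfolding eventually_at_infinity by blast
    then have R1: "norm p ^ 2 * norm (Y p) \<le> e / 24" if "norm p \<ge> R1" for p
      using that less_imp_le by blast
    define R where "R = max R0 (max R1 1)"
    have "norm p ^ 2 * norm (Y p) \<le> e / 24" if "norm p \<ge> R" for p
      by (rule R1) (use that in \<open>simp add: R_def\<close>)
    then have "\<bar>integral (?Q R) ?S\<bar> \<le> 24 * (e / 24)"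
      by (intro abs_integral_cube_divergence_le[OF dY cY]) (simp_all add: R_def)
    moreover have "integral (?Q R) ?S = integral (?Q R0) ?S"
      using has_integral_unique[OF cube cube] by (simp add: R_def)
    ultimately show ?thesis by simp
  qed
  from this[of "\<bar>integral (?Q R0) ?S\<bar> / 2"] have "integral (?Q R0) ?S = 0" by auto
  then show ?thesis using cube[OF order.refl] by simp
qed

section \<open>Doubly periodic functions and their potentials\<close>

lemma has_derivative_shift:
  "((\<lambda>x. f (x + e)) has_derivative D) (at x) \<longleftrightarrow> (f has_derivative D) (at (x + e))"
proof
  have shift: "((\<lambda>y. y + c) has_derivative (\<lambda>h. h)) (at z)" for c z :: 'a
    by (auto intro!: derivative_eq_intros)
  show "((\<lambda>x. f (x + e)) has_derivative D) (at x)" if "(f has_derivative D) (at (x + e))"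
    using has_derivative_compose[OF shift that] .
  show "(f has_derivative D) (at (x + e))" if "((\<lambda>x. f (x + e)) has_derivative D) (at x)"
    using has_derivative_compose[OF shift[of "- e" "x + e"], of "\<lambda>x. f (x + e)" D] that by simp
qed

lemma frechet_derivative_periodic:
  "(\<And>x. f (x + e) = f x) \<Longrightarrow> frechet_derivative f (at (x + e)) = frechet_derivative f (at x)"
  using has_derivative_shift[of f e] by (simp add: frechet_derivative_def)

lemma additive_shift_int:
  fixes q :: "real \<Rightarrow> 'a::real_vector"
  assumes "\<And>s. q (s + 1) = q s + a"
  shows "q (s + of_int n) = q s + of_int n *\<^sub>R a"
proof -
  have shift_nat: "q (s + of_nat m) = q s + of_nat m *\<^sub>R a" for s m
  proof (induction m)
    case (Suc m)
    then show ?case using assms[of "s + of_nat m"] by (simp add: algebra_simps)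
  qed simp
  show ?thesis
  proof (cases "n \<ge> 0")
    case True
    then show ?thesis using shift_nat[of s "nat n"] by simp
  next
    case False
    then show ?thesis using shift_nat[of "s + of_int n" "nat (- n)"] by (simp add: algebra_simps)
  qed
qed

lemma periodic_frac:
  fixes g :: "real \<Rightarrow> 'a::real_vector"
  assumes "\<And>u. g (u + 1) = g u"
  shows "g (frac u) = g u"
  using additive_shift_int[of g 0 "frac u" "\<lfloor>u\<rfloor>"] assms by (simp add: frac_def)

definition quasi_periodic :: "(real \<times> real \<Rightarrow> 'a::real_vector) \<Rightarrow> 'a \<Rightarrow> 'a \<Rightarrow> bool" where
  "quasi_periodic p a b \<longleftrightarrow> (\<forall>x. p (x + (1, 0)) = p x + a) \<and> (\<forall>x. p (x + (0, 1)) = p x + b)"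

lemma quasi_periodicD:
  assumes "quasi_periodic p a b"
  shows "p (x + (1, 0)) = p x + a" "p (x + (0, 1)) = p x + b"
  using assms unfolding quasi_periodic_def by blast+

lemma quasi_periodic_int:
  assumes "quasi_periodic p a b"
  shows "p (x + (of_int m, of_int n)) = p x + of_int m *\<^sub>R a + of_int n *\<^sub>R b"
proof -
  obtain s t where x: "x = (s, t)" by (cases x)
  have "p (s + 1, t) = p (s, t) + a" "p (s, t + 1) = p (s, t) + b" for s t
    using quasi_periodicD[OF assms, of "(s, t)"] by simp_all
  then show ?thesis
    using additive_shift_int[of "\<lambda>s. p (s, t + of_int n)" a s m]
      additive_shift_int[of "\<lambda>t. p (s, t)" b t n] by (simp add: x)
qed

lemma torus_periodic_int:
  fixes f :: "real \<times> real \<Rightarrow> 'a::real_vector"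
  assumes "torus_periodic f"
  shows "f (x + (of_int m, of_int n)) = f x"
  using quasi_periodic_int[of f 0 0 x m n] assms
  by (auto simp: quasi_periodic_def torus_periodic_def)

lemma gradient_periodic:
  assumes p: "\<And>x. (p has_derivative (\<lambda>h. W x \<bullet> h)) (at x)" and per: "\<And>x. p (x + e) = p x + c"
  shows "W (x + e) = W x"
proof -
  have "((\<lambda>x. p x + c) has_derivative (\<lambda>h. W (x + e) \<bullet> h)) (at x)"
    using p[of "x + e"] has_derivative_shift[of p e] per by simp
  then have "(p has_derivative (\<lambda>h. W (x + e) \<bullet> h)) (at x)"
    using has_derivative_add_const[of "\<lambda>x. p x + c" _ _ "- c"] by simp
  then have "(\<lambda>h. W (x + e) \<bullet> h) = (\<lambda>h. W x \<bullet> h)"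
    using p has_derivative_unique by blast
  then show ?thesis by (metis vector_eq_rdot)
qed

lemma has_vector_derivative_coordinate_lines:
  "((\<lambda>s. (s, t)) has_vector_derivative (1, 0)) (at s within S)"
  "((\<lambda>t. (s, t)) has_vector_derivative (0, 1)) (at t within S)" for s t :: real
  using has_vector_derivative_Pair[OF has_vector_derivative_id has_vector_derivative_const]
    has_vector_derivative_Pair[OF has_vector_derivative_const has_vector_derivative_id] by auto

lemma integral_gradient_coordinate_line:
  fixes p :: "real \<times> real \<Rightarrow> real"
  assumes p: "\<And>x. (p has_derivative (\<lambda>h. W x \<bullet> h)) (at x)" and per: "quasi_periodic p a b"
  shows "integral {0..1} (\<lambda>s. W (s, 0) \<bullet> (1, 0)) = a" "integral {0..1} (\<lambda>t. W (0, t) \<bullet> (0, 1)) = b"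
proof -
  have "((\<lambda>s. p (s, 0)) has_real_derivative W (s, 0) \<bullet> (1, 0)) (at s within {0..1})"
    "((\<lambda>t. p (0, t)) has_real_derivative W (0, t) \<bullet> (0, 1)) (at t within {0..1})" for s t
    using has_vector_derivative_compose[OF has_vector_derivative_coordinate_lines(1) p]
      has_vector_derivative_compose[OF has_vector_derivative_coordinate_lines(2) p]
    by (simp_all add: has_real_derivative_iff_has_vector_derivative)
  from integral_real_derivative[OF zero_le_one this(1)] integral_real_derivative[OF zero_le_one this(2)]
  show "integral {0..1} (\<lambda>s. W (s, 0) \<bullet> (1, 0)) = a" "integral {0..1} (\<lambda>t. W (0, t) \<bullet> (0, 1)) = b"
    using quasi_periodicD[OF per, of "(0, 0)"] by simp_all
qed

(* W1 \<and> W2 = d (p1 W2), so Green's theorem on the unit square leaves only the increments of p1 on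
    the boundary. *)
lemma riemann_bilinear_relation:
  fixes p1 p2 :: "real \<times> real \<Rightarrow> real"
  assumes p1: "\<And>x. (p1 has_derivative (\<lambda>h. W1 x \<bullet> h)) (at x)" and per1: "quasi_periodic p1 a1 b1"
    and p2: "\<And>x. (p2 has_derivative (\<lambda>h. W2 x \<bullet> h)) (at x)" and per2: "quasi_periodic p2 a2 b2"
    and cont: "continuous_on UNIV W1" and irr: "irrotational_on UNIV W2 W2'"
  shows "integral {0..1} (\<lambda>s. integral {0..1} (\<lambda>t. (W1 (s, t) \<bullet> (1, 0)) * (W2 (s, t) \<bullet> (0, 1))
      - (W1 (s, t) \<bullet> (0, 1)) * (W2 (s, t) \<bullet> (1, 0)))) = a1 * b2 - b1 * a2"
proof -
  let ?P1 = "\<lambda>s t. p1 (s, t) * (W2' (s, t) (1, 0) \<bullet> (0, 1)) + (W1 (s, t) \<bullet> (1, 0)) * (W2 (s, t) \<bullet> (0, 1))"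
  let ?Q2 = "\<lambda>s t. - (p1 (s, t) * (W2' (s, t) (0, 1) \<bullet> (1, 0)) + (W1 (s, t) \<bullet> (0, 1)) * (W2 (s, t) \<bullet> (1, 0)))"
  note deriv = bounded_bilinear.has_vector_derivative[OF bounded_bilinear_mult
      has_vector_derivative_compose[OF _ p1] bounded_linear.has_vector_derivative[OF bounded_linear_inner_left
        has_vector_derivative_compose[OF _ irrotational_on_has_derivative[OF irr UNIV_I]]]]
  have cont_p1: "continuous_on UNIV p1"
    using p1 by (auto intro!: continuous_at_imp_continuous_on has_derivative_continuous)
  note cont = cont cont_p1 irrotational_on_continuous_on[OF irr] irrotational_on_continuous_on_deriv[OF irr]
  have "integral {0..1} (\<lambda>s. integral {0..1} (\<lambda>t. ?P1 s t + ?Q2 s t))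
    = integral {0..1} (\<lambda>t. p1 (1, t) * (W2 (1, t) \<bullet> (0, 1)) - p1 (0, t) * (W2 (0, t) \<bullet> (0, 1)))
    + integral {0..1} (\<lambda>s. - (p1 (s, 1) * (W2 (s, 1) \<bullet> (1, 0))) - - (p1 (s, 0) * (W2 (s, 0) \<bullet> (1, 0))))"
  proof (rule green_rectangle)
    show "((\<lambda>s. p1 (s, t) * (W2 (s, t) \<bullet> (0, 1))) has_real_derivative ?P1 s t) (at s within {0..1})" for s t
      using deriv[OF has_vector_derivative_coordinate_lines(1,1)]
      by (simp add: has_real_derivative_iff_has_vector_derivative)
    show "((\<lambda>t. - (p1 (s, t) * (W2 (s, t) \<bullet> (1, 0)))) has_real_derivative ?Q2 s t) (at t within {0..1})"
        for s t
      using has_vector_derivative_minus[OF deriv[OF has_vector_derivative_coordinate_lines(2,2)]]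
      by (simp add: has_real_derivative_iff_has_vector_derivative)
  qed (auto simp: case_prod_unfold intro!: continuous_intros cont[THEN continuous_on_subset])
  moreover have "?P1 s t + ?Q2 s t = (W1 (s, t) \<bullet> (1, 0)) * (W2 (s, t) \<bullet> (0, 1))
      - (W1 (s, t) \<bullet> (0, 1)) * (W2 (s, t) \<bullet> (1, 0))" for s t
    using irrotational_on_symmetric[OF irr UNIV_I] by simp
  moreover have "p1 (1, t) * (W2 (1, t) \<bullet> (0, 1)) - p1 (0, t) * (W2 (0, t) \<bullet> (0, 1))
      = a1 * (W2 (0, t) \<bullet> (0, 1))" for t
    using quasi_periodicD(1)[OF per1, of "(0, t)"]
      gradient_periodic[OF p2 quasi_periodicD(1)[OF per2], of "(0, t)"] by (simp add: algebra_simps)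
  moreover have "- (p1 (s, 1) * (W2 (s, 1) \<bullet> (1, 0))) - - (p1 (s, 0) * (W2 (s, 0) \<bullet> (1, 0)))
      = - (b1 * (W2 (s, 0) \<bullet> (1, 0)))" for s
    using quasi_periodicD(2)[OF per1, of "(s, 0)"]
      gradient_periodic[OF p2 quasi_periodicD(2)[OF per2], of "(s, 0)"] by (simp add: algebra_simps)
  ultimately show ?thesis
    by (simp only: integral_mult_right integral_neg integral_gradient_coordinate_line[OF p2 per2])
qed

definition torus_potential ::
  "('a::euclidean_space \<Rightarrow> 'a) \<Rightarrow> ((real \<times> real) \<times> real \<Rightarrow> 'a) \<Rightarrow> real set \<Rightarrow> real \<Rightarrow> real
    \<Rightarrow> ((real \<times> real) \<times> real \<Rightarrow> real) \<Rightarrow> bool" where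
  "torus_potential B \<Psi> I a b p \<longleftrightarrow>
    (\<forall>x. \<forall>r\<in>I. (p has_derivative (\<lambda>h. B (\<Psi> (x, r)) \<bullet> dir_deriv \<Psi> h (x, r))) (at (x, r))) \<and>
    (\<forall>r\<in>I. quasi_periodic (\<lambda>x. p (x, r)) a b)"

lemma potential_increment_constant:
  assumes S: "convex S" and e: "\<And>x. x \<in> S \<Longrightarrow> x + e \<in> S" and W: "\<And>x. W (x + e) = W x"
    and p: "\<And>x. x \<in> S \<Longrightarrow> (p has_derivative (\<lambda>h. W x \<bullet> h)) (at x)"
  obtains c where "\<And>x. x \<in> S \<Longrightarrow> p (x + e) = p x + c"
proof -
  have "\<exists>c. \<forall>x\<in>S. p (x + e) - p x = c"
  proof (rule has_derivative_zero_constant[OF S])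
    fix x assume x: "x \<in> S"
    have "((\<lambda>x. p (x + e)) has_derivative (\<lambda>h. W x \<bullet> h)) (at x)"
      using p[OF e[OF x]] by (simp add: has_derivative_shift W)
    from has_derivative_diff[OF this p[OF x]]
    show "((\<lambda>x. p (x + e) - p x) has_derivative (\<lambda>h. 0)) (at x within S)"
      by (auto intro: has_derivative_at_withinI)
  qed
  then show thesis using that by (metis diff_eq_eq add.commute)
qed

lemma torus_potential_exists:
  fixes \<Psi> :: "(real \<times> real) \<times> real \<Rightarrow> 'a::euclidean_space"
  assumes irr: "irrotational_on \<Omega> B B'" and \<Psi>: "Ck_differentiable (Suc (Suc 0)) \<Psi>"
    and per: "\<And>r. torus_periodic (\<lambda>x. \<Psi> (x, r))"
    and I: "open I" "convex I" "\<And>x r. r \<in> I \<Longrightarrow> \<Psi> (x, r) \<in> \<Omega>"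
  obtains a b p where "torus_potential B \<Psi> I a b p"
proof -
  let ?S = "(UNIV :: (real \<times> real) set) \<times> I" and ?W = "pullback_field \<Psi> B"
  have S: "open ?S" "convex ?S" using I by (auto intro: open_Times convex_Times)
  have W_inner: "?W x \<bullet> h = B (\<Psi> x) \<bullet> dir_deriv \<Psi> h x" for x h
    using Ck_differentiable_has_derivative[OF \<Psi>] by (intro pullback_field_inner differentiableI)
  have \<Psi>_shift: "\<Psi> (x + ((1, 0), 0)) = \<Psi> x" "\<Psi> (x + ((0, 1), 0)) = \<Psi> x" for x
    using per[of "snd x"] unfolding torus_periodic_def by (cases x; cases "fst x"; simp)+
  have W_shift: "?W (x + ((1, 0), 0)) = ?W x" "?W (x + ((0, 1), 0)) = ?W x" for x
    by (simp_all add: pullback_field_def \<Psi>_shift frechet_derivative_periodic)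
  obtain W' where "irrotational_on ?S ?W W'"
    using irrotational_on_pullback_field[OF irr \<Psi>, of ?S] I(3) by blast
  from poincare_lemma[OF this S(2,1)] obtain p
    where p: "\<And>x. x \<in> ?S \<Longrightarrow> (p has_derivative (\<lambda>h. ?W x \<bullet> h)) (at x)" by blast
  obtain a where "\<And>x. x \<in> ?S \<Longrightarrow> p (x + ((1, 0), 0)) = p x + a"
    by (rule potential_increment_constant[OF S(2) _ W_shift(1) p]) (auto simp: mem_Times_iff)
  moreover obtain b where "\<And>x. x \<in> ?S \<Longrightarrow> p (x + ((0, 1), 0)) = p x + b"
    by (rule potential_increment_constant[OF S(2) _ W_shift(2) p]) (auto simp: mem_Times_iff)
  ultimately have "torus_potential B \<Psi> I a b p"
    using p unfolding torus_potential_def quasi_periodic_def W_inner by fastforce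
  then show thesis by (rule that)
qed

lemma torus_potential_level:
  assumes p: "torus_potential B \<Psi> I a b p" and r: "r \<in> I"
  shows "((\<lambda>x. p (x, r)) has_derivative (\<lambda>h. B (\<Psi> (x, r)) \<bullet> dir_deriv \<Psi> (h, 0) (x, r))) (at x)"
    "quasi_periodic (\<lambda>x. p (x, r)) a b"
proof -
  have "((\<lambda>x. (x, r)) has_derivative (\<lambda>h. (h, 0))) (at x)"
    by (intro has_derivative_Pair) auto
  from has_derivative_compose[OF this, of p] p r
  show "((\<lambda>x. p (x, r)) has_derivative (\<lambda>h. B (\<Psi> (x, r)) \<bullet> dir_deriv \<Psi> (h, 0) (x, r))) (at x)"
    unfolding torus_potential_def by blast
  show "quasi_periodic (\<lambda>x. p (x, r)) a b" using p r by (simp add: torus_potential_def)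
qed

lemma torus_potential_period:
  assumes p: "torus_potential B \<Psi> I a b p" and r: "r \<in> I"
  shows "((\<lambda>u. B (\<Psi> (x + u *\<^sub>R (of_int m, of_int n), r)) \<bullet>
      dir_deriv \<Psi> ((of_int m, of_int n), 0) (x + u *\<^sub>R (of_int m, of_int n), r))
    has_integral (of_int m * a + of_int n * b)) {0..1}"
proof -
  let ?\<gamma> = "\<lambda>u. x + u *\<^sub>R (real_of_int m, real_of_int n)"
  note level = torus_potential_level[OF p r]
  have "((\<lambda>u. B (\<Psi> (?\<gamma> u, r)) \<bullet> dir_deriv \<Psi> ((of_int m, of_int n), 0) (?\<gamma> u, r))
      has_integral p (?\<gamma> 1, r) - p (?\<gamma> 0, r)) {0..1}"
    by (rule fundamental_theorem_of_calculus)
      (rule zero_le_one, rule has_vector_derivative_compose[OF has_vector_derivative_line level(1)])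
  moreover have "p (?\<gamma> 1, r) - p (?\<gamma> 0, r) = of_int m * a + of_int n * b"
    using quasi_periodic_int[OF level(2), of x m n] by (simp flip: zero_prod_def)
  ultimately show ?thesis by simp
qed

section \<open>The Gauss linking integral\<close>

definition gauss_kernel :: "real^3 \<Rightarrow> real^3" where
  "gauss_kernel x = (1 / norm x ^ 3) *\<^sub>R x"

definition gauss_kernel_deriv :: "real^3 \<Rightarrow> real^3 \<Rightarrow> real^3" where
  "gauss_kernel_deriv x v = (1 / norm x ^ 3) *\<^sub>R v - (3 * (x \<bullet> v) / norm x ^ 5) *\<^sub>R x"

lemma gauss_kernel_has_derivative:
  assumes "x \<noteq> 0"
  shows "(gauss_kernel has_derivative gauss_kernel_deriv x) (at x)"
proof -
  have norm: "(norm has_derivative (\<lambda>v. (x \<bullet> v) / norm x)) (at x)"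
    using has_derivative_norm[OF assms] by (simp add: sgn_div_norm inner_commute divide_inverse mult.commute)
  have "((\<lambda>y. 1 / norm y ^ 3) has_derivative (\<lambda>v. - (3 * (x \<bullet> v) / norm x ^ 5))) (at x)"
    using assms
    by (auto intro!: derivative_eq_intros norm simp: field_simps power_numeral_reduce)
  then have "((\<lambda>y. (1 / norm y ^ 3) *\<^sub>R y) has_derivative
      (\<lambda>v. (1 / norm x ^ 3) *\<^sub>R v + (- (3 * (x \<bullet> v) / norm x ^ 5)) *\<^sub>R x)) (at x)"
    by (rule has_derivative_scaleR) (rule has_derivative_ident)
  then show ?thesis
    by (simp add: gauss_kernel_def[abs_def] gauss_kernel_deriv_def[abs_def])
qed

lemma continuous_on_gauss_kernel:
  "continuous_on S f \<Longrightarrow> (\<And>x. x \<in> S \<Longrightarrow> f x \<noteq> 0) \<Longrightarrow> continuous_on S (\<lambda>x. gauss_kernel (f x))"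
  unfolding gauss_kernel_def by (auto intro!: continuous_intros)

lemma continuous_on_gauss_kernel_deriv:
  "continuous_on S f \<Longrightarrow> continuous_on S v \<Longrightarrow> (\<And>x. x \<in> S \<Longrightarrow> f x \<noteq> 0) \<Longrightarrow>
    continuous_on S (\<lambda>x. gauss_kernel_deriv (f x) (v x))"
  unfolding gauss_kernel_deriv_def by (auto intro!: continuous_intros)

lemma linear_gauss_kernel_deriv: "linear (gauss_kernel_deriv x)"
  by (rule linearI) (auto simp: gauss_kernel_deriv_def algebra_simps inner_simps add_divide_distrib)

lemma gauss_kernel_has_vector_derivative:
  "(F has_vector_derivative F') (at t within S) \<Longrightarrow> F t \<noteq> 0 \<Longrightarrow>
    ((\<lambda>t. gauss_kernel (F t)) has_vector_derivative gauss_kernel_deriv (F t) F') (at t within S)"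
  by (rule has_vector_derivative_compose[OF _ gauss_kernel_has_derivative])

lemma inner_cross3_rotate:
  fixes a b c :: "real^3"
  shows "b \<bullet> cross3 c a = a \<bullet> cross3 b c" "c \<bullet> cross3 a b = a \<bullet> cross3 b c"
  by (simp_all add: cross3_def inner_vec_def sum_3 vector_3) algebra+

lemma inner_cross3_Cramer:
  fixes x a b c :: "real^3"
  shows "(x \<bullet> a) * (x \<bullet> cross3 b c) + (x \<bullet> b) * (x \<bullet> cross3 c a) + (x \<bullet> c) * (x \<bullet> cross3 a b)
    = (x \<bullet> x) * (a \<bullet> cross3 b c)"
  by (simp add: cross3_def inner_vec_def sum_3 vector_3) algebra

(* The left-hand side is the triple product of a, b, c times the divergence of the Gauss kernel. *)
lemma gauss_kernel_deriv_trace: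
  assumes "x \<noteq> 0"
  shows "gauss_kernel_deriv x a \<bullet> cross3 b c + gauss_kernel_deriv x b \<bullet> cross3 c a
    + gauss_kernel_deriv x c \<bullet> cross3 a b = 0"
proof -
  have "gauss_kernel_deriv x a \<bullet> cross3 b c + gauss_kernel_deriv x b \<bullet> cross3 c a
      + gauss_kernel_deriv x c \<bullet> cross3 a b
    = 3 * (a \<bullet> cross3 b c) / norm x ^ 3 - 3 / norm x ^ 5 *
      ((x \<bullet> a) * (x \<bullet> cross3 b c) + (x \<bullet> b) * (x \<bullet> cross3 c a) + (x \<bullet> c) * (x \<bullet> cross3 a b))"
    using inner_cross3_rotate[where a=a and b=b and c=c]
    by (simp add: gauss_kernel_deriv_def inner_diff_left algebra_simps)
  also have "\<dots> = 0"
    unfolding inner_cross3_Cramer using assms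
    by (simp add: power2_norm_eq_inner[symmetric] field_simps power_numeral_reduce)
  finally show ?thesis .
qed

definition closed_curve :: "(real \<Rightarrow> real^3) \<Rightarrow> (real \<Rightarrow> real^3) \<Rightarrow> bool" where
  "closed_curve g g' \<longleftrightarrow>
    (\<forall>u. (g has_vector_derivative g' u) (at u)) \<and> continuous_on UNIV g' \<and> (\<forall>u. g (u + 1) = g u)"

lemma closed_curve_has_vector_derivative:
  "closed_curve g g' \<Longrightarrow> (g has_vector_derivative g' u) (at u within S)"
  by (simp add: closed_curve_def has_vector_derivative_at_within)

lemma closed_curve_periodic: "closed_curve g g' \<Longrightarrow> g (u + 1) = g u"
  by (simp add: closed_curve_def)

lemma closed_curve_continuous_on: "closed_curve g g' \<Longrightarrow> continuous_on S g"
  unfolding closed_curve_def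
  by (meson continuous_at_imp_continuous_on has_vector_derivative_continuous)

lemma closed_curve_continuous_on_deriv: "closed_curve g g' \<Longrightarrow> continuous_on S g'"
  unfolding closed_curve_def using continuous_on_subset by blast

lemma closed_curve_continuous_on_compose:
  assumes "closed_curve g g'" "continuous_on S f"
  shows "continuous_on S (\<lambda>x. g (f x))" "continuous_on S (\<lambda>x. g' (f x))"
  using continuous_on_compose2[OF closed_curve_continuous_on[OF assms(1), of UNIV] assms(2)]
    continuous_on_compose2[OF closed_curve_continuous_on_deriv[OF assms(1), of UNIV] assms(2)] by auto

lemma closed_curve_range:
  assumes "closed_curve g g'"
  shows "range g = g ` {0..1}"
proof -
  have "g u \<in> g ` {0..1}" for u
    using periodic_frac[of g u, OF closed_curve_periodic[OF assms]] frac_lt_1[of u]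
    by (intro image_eqI[of _ _ "frac u"]) auto
  then show ?thesis by auto
qed

lemma compact_range_closed_curve: "closed_curve g g' \<Longrightarrow> compact (range g)"
  using closed_curve_range closed_curve_continuous_on compact_continuous_image compact_Icc by metis

(* 4 pi times the Biot-Savart field of a unit current along g *)
definition biot_savart :: "(real \<Rightarrow> real^3) \<Rightarrow> (real \<Rightarrow> real^3) \<Rightarrow> real^3 \<Rightarrow> real^3" where
  "biot_savart g g' y = integral {0..1} (\<lambda>u. cross3 (gauss_kernel (g u - y)) (g' u))"

definition biot_savart_integrand_deriv ::
  "(real \<Rightarrow> real^3) \<Rightarrow> (real \<Rightarrow> real^3) \<Rightarrow> real^3 \<Rightarrow> real \<Rightarrow> (real^3) \<Rightarrow>\<^sub>L (real^3)" where
  "biot_savart_integrand_deriv g g' y u =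
    Blinfun (\<lambda>h. cross3 (gauss_kernel_deriv (g u - y) (- h)) (g' u))"

definition biot_savart_deriv ::
  "(real \<Rightarrow> real^3) \<Rightarrow> (real \<Rightarrow> real^3) \<Rightarrow> real^3 \<Rightarrow> (real^3) \<Rightarrow>\<^sub>L (real^3)" where
  "biot_savart_deriv g g' y = integral {0..1} (biot_savart_integrand_deriv g g' y)"

lemma bounded_bilinear_cross3: "bounded_bilinear cross3"
  by (simp add: bilinear_conv_bounded_bilinear[symmetric] bilinear_cross)

lemma biot_savart_integrand_deriv_apply:
  "biot_savart_integrand_deriv g g' y u h = cross3 (gauss_kernel_deriv (g u - y) (- h)) (g' u)"
proof -
  have "linear (\<lambda>h. cross3 (gauss_kernel_deriv (g u - y) (- h)) (g' u))"
    using linear_gauss_kernel_deriv[of "g u - y"]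
    by (intro linearI) (auto simp: linear_add linear_diff linear_neg linear_cmul cross3_simps)
  then show ?thesis
    by (simp add: biot_savart_integrand_deriv_def bounded_linear_Blinfun_apply linear_conv_bounded_linear)
qed

lemma continuous_on_biot_savart_integrand:
  assumes g: "closed_curve g g'" and y: "y \<notin> range g"
  shows "continuous_on {0..1} (\<lambda>u. cross3 (gauss_kernel (g u - y)) (g' u))"
  by (intro continuous_on_cross continuous_on_gauss_kernel continuous_intros
      closed_curve_continuous_on[OF g] closed_curve_continuous_on_deriv[OF g]) (use y in auto)

lemma continuous_on_biot_savart_integrand_deriv:
  assumes g: "closed_curve g g'"
  shows "continuous_on ((- range g) \<times> {0..1}) (\<lambda>(y, u). biot_savart_integrand_deriv g g' y u)"
  unfolding case_prod_beta
  by (intro continuous_on_blinfun_componentwise, unfold biot_savart_integrand_deriv_apply)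
    (auto intro!: continuous_on_cross continuous_on_gauss_kernel_deriv continuous_intros
      closed_curve_continuous_on_compose[OF g])

lemma biot_savart_has_derivative:
  assumes g: "closed_curve g g'" and y: "y \<notin> range g"
  shows "(biot_savart g g' has_derivative biot_savart_deriv g g' y) (at y)"
proof -
  have "open (- range g)"
    using compact_range_closed_curve[OF g] compact_imp_closed by blast
  then obtain e where e: "e > 0" "ball y e \<subseteq> - range g"
    using y by (meson ComplI openE)
  have "((\<lambda>z. integral (cbox 0 1) (\<lambda>u. cross3 (gauss_kernel (g u - z)) (g' u))) has_derivative
      integral (cbox 0 1) (biot_savart_integrand_deriv g g' y)) (at y within ball y e)"
  proof (rule leibniz_rule)
    fix z u assume "z \<in> ball y e"
    then have "g u - z \<noteq> 0" using e by auto
    moreover have "((\<lambda>z. g u - z) has_derivative uminus) (at z within ball y e)"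
      by (auto intro!: derivative_eq_intros)
    ultimately have "((\<lambda>z. gauss_kernel (g u - z)) has_derivative (\<lambda>h. gauss_kernel_deriv (g u - z) (- h)))
        (at z within ball y e)"
      by (intro has_derivative_compose[OF _ gauss_kernel_has_derivative])
    then show "((\<lambda>z. cross3 (gauss_kernel (g u - z)) (g' u)) has_derivative
        biot_savart_integrand_deriv g g' z u) (at z within ball y e)"
      unfolding biot_savart_integrand_deriv_apply[abs_def]
      by (rule bounded_linear.has_derivative[OF
          bounded_bilinear.bounded_linear_left[OF bounded_bilinear_cross3]])
  next
    fix z assume "z \<in> ball y e"
    then show "(\<lambda>u. cross3 (gauss_kernel (g u - z)) (g' u)) integrable_on cbox 0 1"
      using continuous_on_biot_savart_integrand[OF g, of z] e
      by (auto intro!: integrable_continuous_interval)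
  next
    show "continuous_on (ball y e \<times> cbox 0 1) (\<lambda>(z, u). biot_savart_integrand_deriv g g' z u)"
      using e by (auto intro: continuous_on_subset[OF continuous_on_biot_savart_integrand_deriv[OF g]])
  qed (use e in auto)
  then show ?thesis
    using e by (simp add: biot_savart_def[abs_def] biot_savart_deriv_def at_within_open[of y "ball y e"])
qed

lemma integral_gauss_kernel_deriv_closed_curve:
  assumes g: "closed_curve g g'" and y: "y \<notin> range g"
  shows "((\<lambda>u. gauss_kernel_deriv (g u - y) (g' u)) has_integral 0) {0..1}"
proof -
  have "((\<lambda>u. gauss_kernel_deriv (g u - y) (g' u)) has_integral
      gauss_kernel (g 1 - y) - gauss_kernel (g 0 - y)) {0..1}"
  proof (rule fundamental_theorem_of_calculus)
    fix u :: real
    have "((\<lambda>u. g u - y) has_vector_derivative g' u) (at u within {0..1})"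
      using has_vector_derivative_diff[OF closed_curve_has_vector_derivative[OF g]
          has_vector_derivative_const]
      by simp
    then show "((\<lambda>u. gauss_kernel (g u - y)) has_vector_derivative gauss_kernel_deriv (g u - y) (g' u))
        (at u within {0..1})"
      by (rule gauss_kernel_has_vector_derivative) (use y in auto)
  qed simp
  then show ?thesis using closed_curve_periodic[OF g, of 0] by simp
qed

(* The antisymmetric part of the derivative of the integrand is exact along the curve. *)
lemma biot_savart_deriv_symmetric:
  assumes g: "closed_curve g g'" and y: "y \<notin> range g"
  shows "biot_savart_deriv g g' y a \<bullet> b = biot_savart_deriv g g' y b \<bullet> a"
proof -
  let ?F = "biot_savart_integrand_deriv g g' y"
  have "continuous_on {0..1} ?F"
    by (rule continuous_on_compose_curried2[OF continuous_on_biot_savart_integrand_deriv[OF g]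
          continuous_on_const continuous_on_id]) (use y in auto)
  then have F: "(?F has_integral biot_savart_deriv g g' y) {0..1}"
    unfolding biot_savart_deriv_def by (intro integrable_integral integrable_continuous_interval)
  have "((\<lambda>u. ?F u a \<bullet> b) has_integral biot_savart_deriv g g' y a \<bullet> b) {0..1}" for a b
    using has_integral_linear[OF F bounded_linear_compose[OF bounded_linear_inner_left
        blinfun.bounded_linear_left]]
    by (simp add: o_def)
  from has_integral_diff[OF this[of a b] this[of b a]]
  have diff: "((\<lambda>u. ?F u a \<bullet> b - ?F u b \<bullet> a) has_integral
      biot_savart_deriv g g' y a \<bullet> b - biot_savart_deriv g g' y b \<bullet> a) {0..1}" .
  have exact: "?F u a \<bullet> b - ?F u b \<bullet> a = - (gauss_kernel_deriv (g u - y) (g' u) \<bullet> cross3 a b)" for u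
  proof -
    have "gauss_kernel_deriv (g u - y) a \<bullet> cross3 (g' u) b + gauss_kernel_deriv (g u - y) (g' u) \<bullet> cross3 b a
        + gauss_kernel_deriv (g u - y) b \<bullet> cross3 a (g' u) = 0"
      by (rule gauss_kernel_deriv_trace) (use y in auto)
    moreover have "?F u a \<bullet> b = - (gauss_kernel_deriv (g u - y) a \<bullet> cross3 (g' u) b)" for a b
      by (simp add: biot_savart_integrand_deriv_apply linear_neg[OF linear_gauss_kernel_deriv])
        (simp add: cross3_def inner_vec_def sum_3 vector_3 algebra_simps)
    ultimately show ?thesis
      by (simp add: cross_skew[of b a] cross_skew[of "g' u" a])
  qed
  have "((\<lambda>u. - (gauss_kernel_deriv (g u - y) (g' u) \<bullet> cross3 a b)) has_integral 0) {0..1}"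
    using has_integral_neg[OF has_integral_linear[OF integral_gauss_kernel_deriv_closed_curve[OF g y]
          bounded_linear_inner_left[of "cross3 a b"]]] by (simp add: o_def)
  from has_integral_unique[OF diff[unfolded exact] this] show ?thesis by simp
qed

lemma irrotational_on_biot_savart:
  assumes g: "closed_curve g g'"
  shows "irrotational_on (- range g) (biot_savart g g') (biot_savart_deriv g g')"
proof -
  have "continuous_on (- range g) (biot_savart_deriv g g')"
    unfolding biot_savart_deriv_def[abs_def]
    by (rule continuous_on_integral_Icc[OF continuous_on_biot_savart_integrand_deriv[OF g]])
  then show ?thesis
    unfolding irrotational_on_def
    using biot_savart_has_derivative[OF g] biot_savart_deriv_symmetric[OF g] by blast
qed

lemma norm_cross3_le: "norm (cross3 x y) \<le> norm x * norm y"
  by (rule power2_le_imp_le) (auto simp: power_mult_distrib norm_cross)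

lemma norm_gauss_kernel: "norm (gauss_kernel x) = 1 / norm x ^ 2"
  by (cases "x = 0") (simp_all add: gauss_kernel_def power_numeral_reduce)

lemma biot_savart_decay:
  assumes g: "closed_curve g g'"
  obtains C where "C \<ge> 0" "\<forall>\<^sub>F y in at_infinity. norm (biot_savart g g' y) \<le> C / norm y ^ 2"
proof -
  obtain G where G: "G > 0" "\<And>u. u \<in> {0..1} \<Longrightarrow> norm (g' u) \<le> G"
    using compact_imp_bounded[OF compact_continuous_image[OF closed_curve_continuous_on_deriv[OF g]
        compact_Icc[of 0 1]]]
    by (auto simp: bounded_pos)
  obtain R where R: "R > 0" "\<And>u. norm (g u) \<le> R"
    using compact_imp_bounded[OF compact_range_closed_curve[OF g]] by (auto simp: bounded_pos)
  have "norm (biot_savart g g' y) \<le> 4 * G / norm y ^ 2" if y: "norm y \<ge> 2 * R" for y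
  proof -
    have far: "norm (g u - y) \<ge> norm y / 2" for u
      using norm_triangle_ineq3[of y "g u"] R(2)[of u] y norm_minus_commute[of y "g u"] by linarith
    have y0: "norm y > 0" using y R(1) by linarith
    have "norm (cross3 (gauss_kernel (g u - y)) (g' u)) \<le> 4 * G / norm y ^ 2" if "u \<in> {0..1}" for u
    proof -
      have "norm (gauss_kernel (g u - y)) \<le> 1 / (norm y / 2) ^ 2"
        unfolding norm_gauss_kernel using far[of u] y0
        by (intro divide_left_mono power_mono mult_pos_pos zero_less_power) auto
      then have "norm (gauss_kernel (g u - y)) * norm (g' u) \<le> 4 / norm y ^ 2 * G"
        using G that by (intro mult_mono) (auto simp: power_divide)
      then show ?thesis
        using norm_cross3_le[of "gauss_kernel (g u - y)" "g' u"] by simp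
    qed
    moreover have "g u \<noteq> y" for u using far[of u] y0 by auto
    then have "y \<notin> range g" by auto
    then have "(\<lambda>u. cross3 (gauss_kernel (g u - y)) (g' u)) integrable_on cbox 0 1"
      using integrable_continuous_interval[OF continuous_on_biot_savart_integrand[OF g]] by simp
    ultimately have "norm (integral (cbox 0 1) (\<lambda>u. cross3 (gauss_kernel (g u - y)) (g' u)))
        \<le> 4 * G / norm y ^ 2 * measure lborel (cbox (0::real) 1)"
      by (intro integrable_bound) (use G in auto)
    then show ?thesis by (simp add: biot_savart_def)
  qed
  then show thesis
    using that[of "4 * G"] G(1) unfolding eventually_at_infinity by auto
qed

definition gauss_integrand ::
  "(real \<Rightarrow> real^3) \<Rightarrow> (real \<Rightarrow> real^3) \<Rightarrow> (real \<Rightarrow> real^3) \<Rightarrow> (real \<Rightarrow> real^3) \<Rightarrow> real \<Rightarrow> real \<Rightarrow> real" where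
  "gauss_integrand g g' h h' u v = gauss_kernel (g u - h v) \<bullet> cross3 (g' u) (h' v)"

locale disjoint_closed_curves =
  fixes g g' h h' :: "real \<Rightarrow> real^3"
  assumes closed_curves: "closed_curve g g'" "closed_curve h h'" and disjoint: "range g \<inter> range h = {}"
begin

lemma curves_neq: "g u \<noteq> h v"
  using disjoint by auto

lemma continuous_on_gauss_integrand: "continuous_on S (\<lambda>(u, v). gauss_integrand g g' h h' u v)"
  unfolding gauss_integrand_def case_prod_beta
  by (auto intro!: continuous_intros continuous_on_gauss_kernel continuous_on_cross
      closed_curve_continuous_on_compose[OF closed_curves(1)]
      closed_curve_continuous_on_compose[OF closed_curves(2)] simp: curves_neq)

lemma linking_number_eq_iterated:
  "linking_number g h = 1 / (4 * pi) * integral {0..1} (\<lambda>u. integral {0..1} (gauss_integrand g g' h h' u))"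
proof -
  have "vector_derivative g (at u) = g' u" "vector_derivative h (at u) = h' u" for u
    using closed_curves by (auto intro: vector_derivative_at closed_curve_has_vector_derivative)
  then show ?thesis
    unfolding double_integral_eq[OF continuous_on_gauss_integrand]
    by (simp add: linking_number_def gauss_integrand_def[abs_def] gauss_kernel_def)
qed

lemma linking_number_biot_savart:
  "linking_number g h = 1 / (4 * pi) * integral {0..1} (\<lambda>v. biot_savart g g' (h v) \<bullet> h' v)"
proof -
  have "integral {0..1} (\<lambda>u. gauss_integrand g g' h h' u v) = biot_savart g g' (h v) \<bullet> h' v" for v
  proof -
    have "(\<lambda>u. cross3 (gauss_kernel (g u - h v)) (g' u)) integrable_on {0..1}"
      using disjoint
      by (intro integrable_continuous_interval continuous_on_biot_savart_integrand[OF closed_curves(1)]) auto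
    moreover have "gauss_integrand g g' h h' u v = cross3 (gauss_kernel (g u - h v)) (g' u) \<bullet> h' v" for u
      by (simp add: gauss_integrand_def cross3_def inner_vec_def sum_3 vector_3 algebra_simps)
    ultimately show ?thesis
      using integral_linear[OF _ bounded_linear_inner_left[of "h' v"]] by (simp add: o_def biot_savart_def)
  qed
  then show ?thesis
    by (simp add: linking_number_eq_iterated double_integral_swap[OF continuous_on_gauss_integrand])
qed

end

lemma linking_number_commute:
  assumes "disjoint_closed_curves g g' h h'"
  shows "linking_number g h = linking_number h g"
proof -
  interpret gh: disjoint_closed_curves g g' h h' by (rule assms)
  interpret hg: disjoint_closed_curves h h' g g'
    using gh.closed_curves gh.disjoint by unfold_locales auto
  have "gauss_integrand g g' h h' u v = gauss_integrand h h' g g' v u" for u v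
    by (simp add: gauss_integrand_def gauss_kernel_def norm_minus_commute[of "g u"])
      (simp add: cross3_def inner_vec_def sum_3 vector_3 algebra_simps)
  then show ?thesis
    unfolding gh.linking_number_eq_iterated hg.linking_number_eq_iterated
    by (subst double_integral_swap[OF gh.continuous_on_gauss_integrand]) simp
qed

section \<open>Integrality of the linking number\<close>

(* The spinor s = (p, q) represents x if s s^* = k (|x| + x . \<sigma>) with the Pauli matrices \<sigma>. *)
definition represents :: "complex \<times> complex \<Rightarrow> real \<Rightarrow> real^3 \<Rightarrow> bool" where
  "represents s k x \<longleftrightarrow>
    fst s * cnj (fst s) = of_real (k * (norm x + x$3)) \<and>
    snd s * cnj (snd s) = of_real (k * (norm x - x$3)) \<and>
    fst s * cnj (snd s) = of_real k * Complex (x$1) (- x$2)"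

lemma spinor_exists:
  fixes x :: "real^3"
  assumes "x \<noteq> 0"
  shows "\<exists>s k. k > 0 \<and> represents s k x"
proof -
  have norm_x: "norm x ^ 2 = (x$1)^2 + (x$2)^2 + (x$3)^2"
    using dot_square_norm[of x] by (simp add: inner_vec_def sum_3 power2_eq_square)
  show ?thesis
  proof (cases "norm x + x$3 = 0")
    case True
    then have "x$3 = - norm x" by simp
    with norm_x have "(x$1)^2 + (x$2)^2 = 0" by simp
    then have "x$1 = 0" "x$2 = 0" by (simp_all add: sum_power2_eq_zero_iff)
    with True assms have "represents (0, 1) (1 / (2 * norm x)) x"
      by (auto simp: represents_def complex_eq_iff field_simps)
    then show ?thesis using assms by (intro exI conjI) auto
  next
    case False
    then have "norm x + x$3 > 0"
      using component_le_norm_cart[of x 3] by linarith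
    moreover have "(norm x + x$3) * (norm x - x$3) = (x$1)^2 + (x$2)^2"
      using norm_x by (simp add: algebra_simps power2_eq_square)
    then have "represents (of_real (norm x + x$3), Complex (x$1) (x$2)) (norm x + x$3) x"
      by (auto simp: represents_def complex_eq_iff power2_eq_square)
    ultimately show ?thesis by blast
  qed
qed

(* The argument of this number is half the solid angle of the triangle a, b, c seen from the origin. *)
definition triangle_phase :: "real^3 \<Rightarrow> real^3 \<Rightarrow> real^3 \<Rightarrow> complex" where
  "triangle_phase a b c =
    Complex (norm a * norm b * norm c + (a \<bullet> b) * norm c + (b \<bullet> c) * norm a + (c \<bullet> a) * norm b)
      (a \<bullet> cross3 b c)"

definition half_solid_angle :: "real^3 \<Rightarrow> real^3 \<Rightarrow> real^3 \<Rightarrow> real" where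
  "half_solid_angle a b c = Arg (triangle_phase a b c)"

definition spinor_product :: "complex \<times> complex \<Rightarrow> complex \<times> complex \<Rightarrow> complex" where
  "spinor_product s t = cnj (fst s) * fst t + cnj (snd s) * snd t"

lemma spinor_product_commute: "spinor_product t s = cnj (spinor_product s t)"
  by (simp add: spinor_product_def)

lemma spinor_product_triangle:
  assumes "represents s k a" "represents t l b" "represents u m c"
  shows "spinor_product s t * spinor_product t u * spinor_product u s
    = of_real (2 * k * l * m) * triangle_phase a b c"
proof -
  have density: "fst s * cnj (fst s) = of_real (k * (norm x + x$3))"
    "snd s * cnj (snd s) = of_real (k * (norm x - x$3))"
    "fst s * cnj (snd s) = of_real k * Complex (x$1) (- x$2)"
    "snd s * cnj (fst s) = of_real k * Complex (x$1) (x$2)" if "represents s k x" for s k x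
  proof -
    have "snd s * cnj (fst s) = cnj (fst s * cnj (snd s))" by simp
    also have "\<dots> = of_real k * Complex (x$1) (x$2)"
      using that by (simp only: represents_def) (simp add: complex_eq_iff)
    finally show "snd s * cnj (fst s) = of_real k * Complex (x$1) (x$2)" .
  qed (use that in \<open>simp_all add: represents_def\<close>)
  have "spinor_product s t * spinor_product t u * spinor_product u s =
      (fst s * cnj (fst s)) * (fst t * cnj (fst t)) * (fst u * cnj (fst u))
    + (snd s * cnj (fst s)) * (fst t * cnj (fst t)) * (fst u * cnj (snd u))
    + (fst s * cnj (fst s)) * (fst t * cnj (snd t)) * (snd u * cnj (fst u))
    + (snd s * cnj (fst s)) * (fst t * cnj (snd t)) * (snd u * cnj (snd u))
    + (fst s * cnj (snd s)) * (snd t * cnj (fst t)) * (fst u * cnj (fst u))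
    + (snd s * cnj (snd s)) * (snd t * cnj (fst t)) * (fst u * cnj (snd u))
    + (fst s * cnj (snd s)) * (snd t * cnj (snd t)) * (snd u * cnj (fst u))
    + (snd s * cnj (snd s)) * (snd t * cnj (snd t)) * (snd u * cnj (snd u))"
    unfolding spinor_product_def by (simp add: algebra_simps)
  also have "\<dots> = of_real (2 * k * l * m) * triangle_phase a b c"
    unfolding density[OF assms(1)] density[OF assms(2)] density[OF assms(3)]
    by (simp add: triangle_phase_def complex_eq_iff inner_vec_def sum_3 cross3_def vector_3)
        (intro conjI; algebra)
  finally show ?thesis .
qed

lemma half_solid_angle_holonomy:
  obtains m :: "real^3 \<Rightarrow> real^3 \<Rightarrow> complex" where
    "\<And>a b. m b a = cnj (m a b)"
    "\<And>a b c. \<lbrakk>a \<noteq> 0; b \<noteq> 0; c \<noteq> 0; Re (triangle_phase a b c) > 0\<rbrakk> \<Longrightarrow>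
      m a b * m b c * m c a = cis (half_solid_angle a b c) \<and> norm (m a b) = 1 \<and> norm (m b c) = 1
          \<and> norm (m c a) = 1"
proof -
  obtain s k where s: "\<And>x::real^3. x \<noteq> 0 \<Longrightarrow> k x > 0 \<and> represents (s x) (k x) x"
    using spinor_exists by metis
  define l where "l a b = spinor_product (s a) (s b)" for a b
  show thesis
  proof (rule that[of "\<lambda>a b. sgn (l a b)"])
    show "sgn (l b a) = cnj (sgn (l a b))" for a b
      using spinor_product_commute[of "s a" "s b"] by (simp add: l_def sgn_eq)
    fix a b c :: "real^3" assume nz: "a \<noteq> 0" "b \<noteq> 0" "c \<noteq> 0" and pos: "Re (triangle_phase a b c) > 0"
    have phase: "triangle_phase a b c \<noteq> 0" using pos by auto
    define K where "K = 2 * k a * k b * k c"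
    have K: "K > 0" using s nz by (simp add: K_def)
    have prod: "l a b * l b c * l c a = of_real K * triangle_phase a b c"
      unfolding l_def K_def by (rule spinor_product_triangle) (use s nz in auto)
    have "sgn (l a b) * sgn (l b c) * sgn (l c a) = sgn (l a b * l b c * l c a)"
      by (simp add: sgn_mult)
    also have "\<dots> = sgn (triangle_phase a b c)"
      unfolding prod using K by (simp add: sgn_mult sgn_of_real)
    also have "\<dots> = cis (half_solid_angle a b c)"
      using phase by (simp add: half_solid_angle_def cis_Arg)
    moreover have "l a b * l b c * l c a \<noteq> 0"
      unfolding prod using K phase by simp
    ultimately show "sgn (l a b) * sgn (l b c) * sgn (l c a) = cis (half_solid_angle a b c) \<and>
        norm (sgn (l a b)) = 1 \<and> norm (sgn (l b c)) = 1 \<and> norm (sgn (l c a)) = 1"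
      by (simp add: norm_sgn)
  qed
qed

lemma prod_unit_telescope:
  fixes h :: "nat \<Rightarrow> complex"
  assumes "\<And>j. norm (h j) = 1"
  shows "(\<Prod>j<N. h j * cnj (h (Suc j))) = h 0 * cnj (h N)"
proof -
  have "h j * cnj (h j) = 1" for j
    using complex_norm_square[of "h j"] assms[of j] by simp
  then show ?thesis
    by (induction N) (simp_all add: mult.assoc mult.left_commute)
qed

(* Each edge of the periodic grid is traversed once in either direction, so that the link phases cancel. *)
lemma grid_half_solid_angle_integer:
  fixes x :: "nat \<Rightarrow> nat \<Rightarrow> real^3"
  assumes per: "\<And>j. x N j = x 0 j" "\<And>i. x i N = x i 0" and nz: "\<And>i j. x i j \<noteq> 0"
    and pos: "\<And>i j. Re (triangle_phase (x i j) (x (Suc i) j) (x (Suc i) (Suc j))) > 0"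
      "\<And>i j. Re (triangle_phase (x i j) (x (Suc i) (Suc j)) (x i (Suc j))) > 0"
  shows "(\<Sum>i<N. \<Sum>j<N. half_solid_angle (x i j) (x (Suc i) j) (x (Suc i) (Suc j))
      + half_solid_angle (x i j) (x (Suc i) (Suc j)) (x i (Suc j))) / (2 * pi) \<in> \<int>"
    (is "(\<Sum>i<N. \<Sum>j<N. ?\<theta> i j) / _ \<in> _")
proof -
  obtain m where m: "\<And>a b. m b a = cnj (m a b)" and holonomy:
    "\<And>a b c. \<lbrakk>a \<noteq> 0; b \<noteq> 0; c \<noteq> 0; Re (triangle_phase a b c) > 0\<rbrakk> \<Longrightarrow>
      m a b * m b c * m c a = cis (half_solid_angle a b c) \<and> norm (m a b) = 1 \<and> norm (m b c) = 1
          \<and> norm (m c a) = 1"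
    using half_solid_angle_holonomy by blast
  define h where "h i j = m (x i j) (x (Suc i) j)" for i j
  define v where "v j i = m (x i j) (x i (Suc j))" for i j
  define w where "w i j = m (x i j) (x (Suc i) (Suc j))" for i j
  note lower = holonomy[OF nz nz nz pos(1)] and upper = holonomy[OF nz nz nz pos(2)]
  have unit: "norm (h i j) = 1" "norm (v j i) = 1" "norm (w i j) = 1" for i j
    using lower[of i j] upper[of i j] m[of "x i j" "x i (Suc j)"] by (simp_all add: h_def v_def w_def)
  have "cis (?\<theta> i j) = (h i j * cnj (h i (Suc j))) * cnj (v j i * cnj (v j (Suc i)))" for i j
  proof -
    have "cis (?\<theta> i j) = (h i j * v j (Suc i) * cnj (w i j)) * (w i j * cnj (h i (Suc j)) * cnj (v j i))"
      using lower[of i j] upper[of i j] m[of "x i j" "x (Suc i) (Suc j)"]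
        m[of "x i (Suc j)" "x (Suc i) (Suc j)"] m[of "x i j" "x i (Suc j)"]
      by (simp add: h_def v_def w_def flip: cis_mult)
    moreover have "w i j * cnj (w i j) = 1"
      using complex_norm_square[of "w i j"] unit(3)[of i j] by simp
    ultimately show ?thesis by (simp add: algebra_simps)
  qed
  then have "cis (\<Sum>i<N. \<Sum>j<N. ?\<theta> i j)
    = (\<Prod>i<N. \<Prod>j<N. h i j * cnj (h i (Suc j))) * (\<Prod>i<N. \<Prod>j<N. cnj (v j i * cnj (v j (Suc i))))"
    by (simp add: cis_conv_exp exp_sum sum_distrib_left flip: prod.distrib)
  also have "(\<Prod>i<N. \<Prod>j<N. h i j * cnj (h i (Suc j))) = 1"
    using unit(1) per(2) complex_norm_square[of "h _ 0"]
    by (simp add: prod_unit_telescope) (simp add: h_def)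
  also have "(\<Prod>i<N. \<Prod>j<N. cnj (v j i * cnj (v j (Suc i)))) = cnj (\<Prod>j<N. \<Prod>i<N. v j i * cnj (v j (Suc i)))"
    by (subst prod.swap) simp
  also have "(\<Prod>j<N. \<Prod>i<N. v j i * cnj (v j (Suc i))) = 1"
    using unit(2) per(1) complex_norm_square[of "v _ 0"]
    by (simp add: prod_unit_telescope) (simp add: v_def)
  finally have "cis (\<Sum>i<N. \<Sum>j<N. ?\<theta> i j) = 1" by simp
  then obtain n :: int where "(\<Sum>i<N. \<Sum>j<N. ?\<theta> i j) = of_int n * 2 * pi"
    unfolding cis_conv_exp by (auto simp: exp_eq_1)
  then show ?thesis by simp
qed

lemma abs_integral_minus_riemann_sum_le:
  fixes \<phi> :: "real \<Rightarrow> real"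
  assumes N: "N > 0" and \<phi>: "continuous_on {0..1} \<phi>"
    and close: "\<And>i t. i < N \<Longrightarrow> t \<in> {real i / N..real (Suc i) / N} \<Longrightarrow> \<bar>\<phi> t - c i\<bar> \<le> e"
  shows "\<bar>integral {0..1} \<phi> - (\<Sum>i<N. c i) / N\<bar> \<le> e"
proof -
  have "k \<le> N \<Longrightarrow> \<bar>integral {0..real k / N} \<phi> - (\<Sum>i<k. c i) / N\<bar> \<le> e * k / N" for k
  proof (induction k)
    case (Suc k)
    let ?a = "real k / N" and ?b = "real (Suc k) / N"
    have ab: "0 \<le> ?a" "?a \<le> ?b" "?b \<le> 1" "?b - ?a = 1 / N"
      using Suc.prems N by (simp_all add: field_simps)
    have int: "\<phi> integrable_on {0..?b}" "\<phi> integrable_on {?a..?b}"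
      by (rule integrable_continuous_interval, rule continuous_on_subset[OF \<phi>],
          simp only: atLeastatMost_subset_iff, use ab in linarith)+
    have "norm (integral (cbox ?a ?b) (\<lambda>t. \<phi> t - c k)) \<le> e * measure lborel (cbox ?a ?b)"
    proof (rule integrable_bound)
      show "0 \<le> e" using close[of k ?a] Suc.prems ab by auto
      show "norm (\<phi> t - c k) \<le> e" if "t \<in> cbox ?a ?b" for t using close[of k t] Suc.prems that by auto
    qed (use int(2) in \<open>auto intro: integrable_diff\<close>)
    moreover have "integral (cbox ?a ?b) (\<lambda>t. \<phi> t - c k) = integral {?a..?b} \<phi> - c k / N"
      using integral_diff[OF int(2) integrable_const_ivl, of "c k"] ab by simp
    ultimately have "\<bar>integral {?a..?b} \<phi> - c k / N\<bar> \<le> e / N"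
      using ab by simp
    moreover have "integral {0..?b} \<phi> = integral {0..?a} \<phi> + integral {?a..?b} \<phi>"
      using Henstock_Kurzweil_Integration.integral_combine[OF ab(1,2) int(1)] by simp
    moreover have "\<bar>integral {0..?a} \<phi> - (\<Sum>i<k. c i) / N\<bar> \<le> e * k / N" using Suc by simp
    moreover have "(\<Sum>i<Suc k. c i) / N = (\<Sum>i<k. c i) / N + c k / N" by (simp add: add_divide_distrib)
    moreover have "e * real (Suc k) / N = e * k / N + e / N" by (simp add: distrib_left add_divide_distrib)
    ultimately show ?case by linarith
  qed simp
  from this[of N] N show ?thesis by simp
qed

lemma abs_double_integral_minus_riemann_sum_le:
  fixes \<phi> :: "real \<Rightarrow> real \<Rightarrow> real"
  assumes N: "N > 0" and \<phi>: "continuous_on ({0..1} \<times> {0..1}) (\<lambda>(u, v). \<phi> u v)"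
    and close: "\<And>i j u v. \<lbrakk>i < N; j < N; u \<in> {real i / N..real (Suc i) / N}; v \<in>
        {real j / N..real (Suc j) / N}\<rbrakk>
      \<Longrightarrow> \<bar>\<phi> u v - c i j\<bar> \<le> e"
  shows "\<bar>integral {0..1} (\<lambda>u. integral {0..1} (\<phi> u)) - (\<Sum>i<N. \<Sum>j<N. c i j) / real N ^ 2\<bar> \<le> e"
proof -
  have "\<bar>integral {0..1} (\<lambda>u. integral {0..1} (\<phi> u)) - (\<Sum>i<N. (\<Sum>j<N. c i j) / N) / N\<bar> \<le> e"
  proof (rule abs_integral_minus_riemann_sum_le[OF N continuous_on_integral_Icc[OF \<phi>]])
    fix i u assume i: "i < N" "u \<in> {real i / N..real (Suc i) / N}"
    have "0 \<le> real i / N" "real (Suc i) / N \<le> 1" using i(1) by (auto simp: field_simps)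
    then have "u \<in> {0..1}" using i(2) unfolding atLeastAtMost_iff by linarith
    then have "continuous_on {0..1} (\<phi> u)"
      by (intro continuous_on_compose_curried2[OF \<phi>]) (auto intro!: continuous_intros)
    then show "\<bar>integral {0..1} (\<phi> u) - (\<Sum>j<N. c i j) / N\<bar> \<le> e"
      using close i by (intro abs_integral_minus_riemann_sum_le[OF N])
  qed
  then show ?thesis by (simp add: sum_divide_distrib[symmetric] power2_eq_square)
qed

lemma eventually_close_to_grid_sample:
  fixes F :: "real \<Rightarrow> real \<Rightarrow> real \<Rightarrow> real"
  assumes d0: "d0 > 0" and F: "continuous_on ({0..1} \<times> {0..1} \<times> {0..d0}) (\<lambda>(u, v, d). F u v d)"
    and e: "e > 0"
  shows "\<forall>\<^sub>F N in sequentially. \<forall>i<N. \<forall>j<N. \<forall>u\<in>{real i / N..real (Suc i) / N}.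
      \<forall>v\<in>{real j / N..real (Suc j) / N}.
    \<bar>F u v 0 - F (real i / N) (real j / N) (1 / N)\<bar> \<le> e"
proof -
  let ?K = "{0..1::real} \<times> {0..1::real} \<times> {0..d0}"
  have "uniformly_continuous_on ?K (\<lambda>(u, v, d). F u v d)"
    by (rule compact_uniformly_continuous[OF F]) (intro compact_Times compact_Icc)
  then obtain \<eta> where \<eta>: "\<eta> > 0"
    "\<And>u v d u' v' d'. \<lbrakk>(u, v, d) \<in> ?K; (u', v', d') \<in> ?K; dist (u', v', d') (u, v, d) < \<eta>\<rbrakk>
      \<Longrightarrow> \<bar>F u' v' d' - F u v d\<bar> < e"
    using e unfolding uniformly_continuous_on_def dist_real_def by fastforce
  have "\<forall>\<^sub>F N in sequentially. 1 / real N < min d0 (\<eta> / 3)"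
    using order_tendstoD(2)[OF lim_1_over_n, of "min d0 (\<eta> / 3)"] d0 \<eta>(1) by simp
  then show ?thesis
  proof (eventually_elim, intro allI impI ballI)
    fix N i j :: nat and u v
    assume N: "1 / real N < min d0 (\<eta> / 3)" and ij: "i < N" "j < N"
      and u: "u \<in> {real i / N..real (Suc i) / N}" and v: "v \<in> {real j / N..real (Suc j) / N}"
    have Suc_N: "real (Suc k) / N = real k / N + 1 / N" for k by (simp add: add_divide_distrib)
    have unit: "0 \<le> real k / N" "real k / N + 1 / N \<le> 1" if "k < N" for k
      using that by (auto simp: field_simps)
    have "dist (u, v, 0) (real i / N, real j / N, 1 / N)
        \<le> dist u (real i / N) + (dist v (real j / N) + dist 0 (1 / real N))"
      unfolding dist_Pair_Pair
      by (rule order_trans[OF sqrt_sum_squares_le_sum]) (auto intro!: sqrt_sum_squares_le_sum)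
    also have "\<dots> \<le> 3 * (1 / real N)"
      using u v unfolding Suc_N by (auto simp: dist_real_def)
    also have "\<dots> < \<eta>" using N by simp
    finally have "dist (u, v, 0) (real i / N, real j / N, 1 / N) < \<eta>" .
    moreover have "(u, v, 0) \<in> ?K" "(real i / N, real j / N, 1 / N) \<in> ?K"
      unfolding mem_Times_iff fst_conv snd_conv atLeastAtMost_iff
      using u v N unit[OF ij(1)] unit[OF ij(2)] d0 zero_le_divide_1_iff[of "real N"]
      unfolding Suc_N atLeastAtMost_iff min_less_iff_conj by (intro conjI; linarith)+
    ultimately have "\<bar>F u v 0 - F (real i / N) (real j / N) (1 / N)\<bar> < e"
      by (intro \<eta>(2)) auto
    then show "\<bar>F u v 0 - F (real i / N) (real j / N) (1 / N)\<bar> \<le> e" by simp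
  qed
qed

lemma riemann_sum_grid_tendsto:
  fixes F :: "real \<Rightarrow> real \<Rightarrow> real \<Rightarrow> real"
  assumes d0: "d0 > 0" and F: "continuous_on ({0..1} \<times> {0..1} \<times> {0..d0}) (\<lambda>(u, v, d). F u v d)"
  shows "(\<lambda>N. (\<Sum>i<N. \<Sum>j<N. F (real i / N) (real j / N) (1 / N)) / real N ^ 2)
    \<longlonglongrightarrow> integral {0..1} (\<lambda>u. integral {0..1} (\<lambda>v. F u v 0))" (is "?X \<longlonglongrightarrow> ?L")
proof (rule tendstoI)
  fix e :: real assume "e > 0"
  then have "e / 2 > 0" by simp
  from eventually_close_to_grid_sample[OF d0 F this] eventually_gt_at_top[of 0]
  show "\<forall>\<^sub>F N in sequentially. dist (?X N) ?L < e"
  proof eventually_elim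
    case (elim N)
    have "continuous_on ({0..1} \<times> {0..1}) (\<lambda>(u, v). F u v 0)"
      unfolding case_prod_beta
      by (rule continuous_on_compose_curried3[OF F]) (use d0 in \<open>auto intro!: continuous_intros\<close>)
    then have "\<bar>?L - ?X N\<bar> \<le> e / 2"
      using elim by (intro abs_double_integral_minus_riemann_sum_le) auto
    then show ?case using \<open>e > 0\<close> by (simp add: dist_real_def abs_minus_commute)
  qed
qed

definition arctan_quotient :: "real \<Rightarrow> real" where
  "arctan_quotient y = (if y = 0 then 1 else arctan y / y)"

lemma arctan_eq_times_arctan_quotient: "arctan y = y * arctan_quotient y"
  by (simp add: arctan_quotient_def)

lemma isCont_arctan_quotient: "isCont arctan_quotient y"
proof (cases "y = 0")
  case True
  have "(arctan has_field_derivative 1) (at 0)"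
    using DERIV_arctan[of 0] by simp
  then have "((\<lambda>y. arctan y / y) \<longlongrightarrow> 1) (at 0)"
    by (simp add: has_field_derivative_iff)
  then have "(arctan_quotient \<longlongrightarrow> 1) (at 0)"
    by (rule Lim_transform_eventually) (auto simp: eventually_at_filter arctan_quotient_def)
  then show ?thesis using True by (simp add: isCont_def arctan_quotient_def)
next
  case False
  have "\<forall>\<^sub>F x in nhds y. arctan_quotient x = arctan x / x"
    using t1_space_nhds[OF False] by eventually_elim (simp add: arctan_quotient_def)
  from isCont_cong[OF this] show ?thesis
    using False by (auto intro!: continuous_intros)
qed

lemma continuous_on_arctan_quotient:
  "continuous_on S f \<Longrightarrow> continuous_on S (\<lambda>x. arctan_quotient (f x))"
  by (rule continuous_on_compose2[of UNIV])
    (auto simp: continuous_on_eq_continuous_at isCont_arctan_quotient)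

lemma continuous_on_Re_triangle_phase:
  "continuous_on S a \<Longrightarrow> continuous_on S b \<Longrightarrow> continuous_on S c \<Longrightarrow>
    continuous_on S (\<lambda>x. Re (triangle_phase (a x) (b x) (c x)))"
  unfolding triangle_phase_def by (auto intro!: continuous_intros)

lemma Im_triangle_phase_shift:
  "Im (triangle_phase a (a + d *\<^sub>R b) (a + d *\<^sub>R b + d *\<^sub>R c)) = d^2 * (a \<bullet> cross3 b c)"
  "Im (triangle_phase a (a + d *\<^sub>R b + d *\<^sub>R c) (a + d *\<^sub>R c)) = d^2 * (a \<bullet> cross3 b c)"
  by (simp_all add: triangle_phase_def cross3_def inner_vec_def sum_3 vector_3; algebra)+

lemma Re_triangle_phase_same: "Re (triangle_phase a a a) = 4 * norm a ^ 3"
  by (simp add: triangle_phase_def dot_square_norm power_numeral_reduce)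

definition mean_velocity :: "(real \<Rightarrow> real^3) \<Rightarrow> real \<Rightarrow> real \<Rightarrow> real^3" where
  "mean_velocity g' u d = integral {0..1} (\<lambda>l. g' (u + l * d))"

lemma mean_velocity_0: "mean_velocity g' u 0 = g' u"
  by (simp add: mean_velocity_def)

lemma continuous_on_mean_velocity:
  assumes "closed_curve g g'" "continuous_on S a" "continuous_on S b"
  shows "continuous_on S (\<lambda>x. mean_velocity g' (a x) (b x))"
proof -
  have "continuous_on (UNIV \<times> {0..1}) (\<lambda>(p, l). g' (fst p + l * snd p))"
    unfolding case_prod_beta
    by (intro closed_curve_continuous_on_compose[OF assms(1)] continuous_intros)
  from continuous_on_compose2[OF continuous_on_integral_Icc[OF this] continuous_on_Pair[OF assms(2,3)]]
  show ?thesis by (simp add: mean_velocity_def)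
qed

lemma closed_curve_mean_velocity:
  assumes g: "closed_curve g g'"
  shows "g (u + d) = g u + d *\<^sub>R mean_velocity g' u d"
proof -
  have "((\<lambda>l. d *\<^sub>R g' (u + l * d)) has_integral g (u + 1 * d) - g (u + 0 * d)) {0..1}"
  proof (rule fundamental_theorem_of_calculus)
    fix l :: real
    have "((\<lambda>l. u + l * d) has_vector_derivative d) (at l within {0..1})"
      by (auto intro!: derivative_eq_intros simp: has_vector_derivative_def)
    from vector_diff_chain_within[OF this closed_curve_has_vector_derivative[OF g]]
    show "((\<lambda>l. g (u + l * d)) has_vector_derivative d *\<^sub>R g' (u + l * d)) (at l within {0..1})"
      by (simp add: o_def)
  qed simp
  from integral_unique[OF this] show ?thesis by (simp add: mean_velocity_def)
qed

context disjoint_closed_curves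
begin

definition lower_phase :: "real \<Rightarrow> real \<Rightarrow> real \<Rightarrow> complex" where
  "lower_phase u v d = triangle_phase (g u - h v) (g (u + d) - h v) (g (u + d) - h (v + d))"

definition upper_phase :: "real \<Rightarrow> real \<Rightarrow> real \<Rightarrow> complex" where
  "upper_phase u v d = triangle_phase (g u - h v) (g (u + d) - h (v + d)) (g u - h (v + d))"

definition mean_volume :: "real \<Rightarrow> real \<Rightarrow> real \<Rightarrow> real" where
  "mean_volume u v d = (g u - h v) \<bullet> cross3 (mean_velocity g' u d) (- mean_velocity h' v d)"

definition angle_density :: "real \<Rightarrow> real \<Rightarrow> real \<Rightarrow> real" where
  "angle_density u v d =
    mean_volume u v d / Re (lower_phase u v d)
      * arctan_quotient (d^2 * (mean_volume u v d / Re (lower_phase u v d)))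
    + mean_volume u v d / Re (upper_phase u v d)
      * arctan_quotient (d^2 * (mean_volume u v d / Re (upper_phase u v d)))"

lemma Im_grid_phase:
  "Im (lower_phase u v d) = d^2 * mean_volume u v d"
  "Im (upper_phase u v d) = d^2 * mean_volume u v d"
proof -
  let ?b = "mean_velocity g' u d" and ?c = "- mean_velocity h' v d"
  have corner: "g (u + d) - h v = (g u - h v) + d *\<^sub>R ?b" "g u - h (v + d) = (g u - h v) + d *\<^sub>R ?c"
    "g (u + d) - h (v + d) = (g u - h v) + d *\<^sub>R ?b + d *\<^sub>R ?c"
    using closed_curve_mean_velocity[OF closed_curves(1)] closed_curve_mean_velocity[OF closed_curves(2)]
        by simp_all
  show "Im (lower_phase u v d) = d^2 * mean_volume u v d" "Im (upper_phase u v d) = d^2 * mean_volume u v d"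
    unfolding lower_phase_def upper_phase_def mean_volume_def corner Im_triangle_phase_shift by simp_all
qed

lemma square_times_angle_density:
  assumes "Re (lower_phase u v d) > 0" "Re (upper_phase u v d) > 0"
  shows "d^2 * angle_density u v d = Arg (lower_phase u v d) + Arg (upper_phase u v d)"
  using assms
  by (simp add: arg_conv_arctan Im_grid_phase arctan_eq_times_arctan_quotient angle_density_def distrib_left)

lemma angle_density_0: "angle_density u v 0 = - (1 / 2) * gauss_integrand g g' h h' u v"
  by (simp add: angle_density_def lower_phase_def upper_phase_def mean_volume_def gauss_integrand_def
      Re_triangle_phase_same arctan_quotient_def mean_velocity_0 gauss_kernel_def)

lemma continuous_on_grid_phase:
  "continuous_on S (\<lambda>(u, v, d). Re (lower_phase u v d))"
      "continuous_on S (\<lambda>(u, v, d). Re (upper_phase u v d))"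
  unfolding lower_phase_def upper_phase_def case_prod_beta
  by (intro continuous_on_Re_triangle_phase continuous_intros
      closed_curve_continuous_on_compose[OF closed_curves(1)]
          closed_curve_continuous_on_compose[OF closed_curves(2)])+

lemma grid_phase_frac:
  "lower_phase (frac u) (frac v) d = lower_phase u v d" "upper_phase (frac u) (frac v) d = upper_phase u v d"
proof -
  have "g (frac u + d) = g (u + d)" "h (frac u + d) = h (u + d)" for u d
    using additive_shift_int[of g 0 "frac u + d" "\<lfloor>u\<rfloor>"] additive_shift_int[of h 0 "frac u + d" "\<lfloor>u\<rfloor>"]
      closed_curve_periodic[OF closed_curves(1)] closed_curve_periodic[OF closed_curves(2)]
    by (simp_all add: frac_def algebra_simps)
  from this this[of _ 0] show "lower_phase (frac u) (frac v) d = lower_phase u v d"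
    "upper_phase (frac u) (frac v) d = upper_phase u v d"
    by (simp_all add: lower_phase_def upper_phase_def)
qed

lemma Re_grid_phase_pos:
  obtains d0 where "d0 > 0"
    "\<And>u v d. d \<in> {0..d0} \<Longrightarrow> Re (lower_phase u v d) > 0 \<and> Re (upper_phase u v d) > 0"
proof -
  let ?K = "{0..1::real} \<times> {0..1::real} \<times> {0::real}"
  let ?U = "{p. (\<lambda>(u, v, d). Re (lower_phase u v d)) p > 0} \<inter> {p. (\<lambda>(u, v, d). Re (upper_phase u v d)) p > 0}"
  have "open ?U"
    by (intro open_Int open_Collect_less continuous_on_const continuous_on_grid_phase)
  moreover have "compact ?K" by (intro compact_Times) auto
  moreover have "?K \<noteq> {}" by auto
  moreover have "?K \<subseteq> ?U"
    by (auto simp: lower_phase_def upper_phase_def Re_triangle_phase_same curves_neq)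
  ultimately obtain d0 where d0: "d0 > 0" "{p. infdist p ?K \<le> d0} \<subseteq> ?U"
    using compact_in_open_separated[of ?K ?U] by blast
  have "Re (lower_phase u v d) > 0 \<and> Re (upper_phase u v d) > 0" if d: "d \<in> {0..d0}" for u v d
  proof -
    have "infdist (frac u, frac v, d) ?K \<le> dist (frac u, frac v, d) (frac u, frac v, 0)"
      by (rule infdist_le) (auto simp: frac_lt_1 less_imp_le)
    also have "\<dots> \<le> d0" using d by (simp add: dist_Pair_Pair)
    finally show ?thesis
      using d0(2) by (auto simp: grid_phase_frac)
  qed
  with d0(1) show thesis by (rule that)
qed

lemma continuous_on_angle_density:
  assumes pos: "\<And>u v d. d \<in> {0..d0} \<Longrightarrow> Re (lower_phase u v d) > 0 \<and> Re (upper_phase u v d) > 0"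
  shows "continuous_on ({0..1} \<times> {0..1} \<times> {0..d0}) (\<lambda>(u, v, d). angle_density u v d)"
  unfolding angle_density_def mean_volume_def case_prod_beta
  by (intro continuous_intros continuous_on_arctan_quotient continuous_on_cross
      continuous_on_grid_phase[unfolded case_prod_beta]
      continuous_on_mean_velocity[OF closed_curves(1)] continuous_on_mean_velocity[OF closed_curves(2)]
      closed_curve_continuous_on_compose[OF closed_curves(1)]
          closed_curve_continuous_on_compose[OF closed_curves(2)])
    (use pos in \<open>auto simp: less_imp_neq[symmetric]\<close>)

lemma angle_density_riemann_sum_integer:
  assumes pos: "\<And>u v. Re (lower_phase u v (1 / N)) > 0 \<and> Re (upper_phase u v (1 / N)) > 0" and N: "N > 0"
  shows "(\<Sum>i<N. \<Sum>j<N. angle_density (real i / N) (real j / N) (1 / N)) / real N ^ 2 / (2 * pi) \<in> \<int>"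
proof -
  define x where "x i j = g (real i / N) - h (real j / N)" for i j
  have phase: "lower_phase (real i / N) (real j / N) (1 / N)
      = triangle_phase (x i j) (x (Suc i) j) (x (Suc i) (Suc j))"
    "upper_phase (real i / N) (real j / N) (1 / N)
        = triangle_phase (x i j) (x (Suc i) (Suc j)) (x i (Suc j))" for i j
    by (simp_all add: lower_phase_def upper_phase_def x_def add_divide_distrib add.commute)
  have "(\<Sum>i<N. \<Sum>j<N. angle_density (real i / N) (real j / N) (1 / N)) / real N ^ 2
      = (\<Sum>i<N. \<Sum>j<N. (1 / real N)^2 * angle_density (real i / N) (real j / N) (1 / N))"
    by (simp add: sum_divide_distrib power_divide)
  also have "\<dots> = (\<Sum>i<N. \<Sum>j<N. half_solid_angle (x i j) (x (Suc i) j) (x (Suc i) (Suc j))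
      + half_solid_angle (x i j) (x (Suc i) (Suc j)) (x i (Suc j)))"
    using square_times_angle_density[OF pos[THEN conjunct1] pos[THEN conjunct2]]
    by (simp only: half_solid_angle_def phase)
  also have "\<dots> / (2 * pi) \<in> \<int>"
  proof (rule grid_half_solid_angle_integer)
    show "x N j = x 0 j" "x i N = x i 0" for i j
      using closed_curve_periodic[OF closed_curves(1), of 0]
          closed_curve_periodic[OF closed_curves(2), of 0] N
      by (simp_all add: x_def)
    show "x i j \<noteq> 0" for i j by (simp add: x_def curves_neq)
  qed (use pos in \<open>simp_all flip: phase\<close>)
  finally show ?thesis .
qed

theorem linking_number_integer: "linking_number g h \<in> \<int>"
proof -
  obtain d0 where d0: "d0 > 0"
    and pos: "\<And>u v d. d \<in> {0..d0} \<Longrightarrow> Re (lower_phase u v d) > 0 \<and> Re (upper_phase u v d) > 0"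
    using Re_grid_phase_pos by blast
  let ?S = "\<lambda>N. (\<Sum>i<N. \<Sum>j<N. angle_density (real i / N) (real j / N) (1 / N)) / real N ^ 2 / (2 * pi)"
  have "?S \<longlonglongrightarrow> integral {0..1} (\<lambda>u. integral {0..1} (\<lambda>v. angle_density u v 0)) / (2 * pi)"
    by (intro tendsto_divide riemann_sum_grid_tendsto[OF d0] continuous_on_angle_density pos
        tendsto_const) auto
  moreover have "\<forall>\<^sub>F N in sequentially. ?S N \<in> \<int>"
    using order_tendstoD(2)[OF lim_1_over_n d0] eventually_gt_at_top[of 0]
    by eventually_elim (intro angle_density_riemann_sum_integer pos; simp)
  ultimately have "integral {0..1} (\<lambda>u. integral {0..1} (\<lambda>v. angle_density u v 0)) / (2 * pi) \<in> \<int>"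
    by (intro Lim_in_closed_set[OF closed_Ints]) auto
  then have "- linking_number g h \<in> \<int>"
    by (simp add: angle_density_0 linking_number_eq_iterated)
  then show ?thesis by simp
qed

end

section \<open>The jump of the Gauss integral at a crossing\<close>

lemma gauss_kernel_inner_has_real_derivative:
  assumes "(F has_vector_derivative F') (at t within S)" "F t \<noteq> 0"
      "(w has_vector_derivative w') (at t within S)"
  shows "((\<lambda>t. gauss_kernel (F t) \<bullet> w t) has_real_derivative
    gauss_kernel_deriv (F t) F' \<bullet> w t + gauss_kernel (F t) \<bullet> w') (at t within S)"
  using bounded_bilinear.has_vector_derivative[OF bounded_bilinear_inner
      gauss_kernel_has_vector_derivative[OF assms(1,2)] assms(3)]
  by (simp add: has_real_derivative_iff_has_vector_derivative add.commute)

(* The pull-back of the solid angle form is closed; a, b, c and ab, ac, bc stand for the first and mixed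
  second derivatives of a map with value x. *)
lemma gauss_kernel_pullback_closed:
  assumes "x \<noteq> 0"
  shows "gauss_kernel_deriv x a \<bullet> cross3 b c + gauss_kernel x \<bullet> (cross3 b ac + cross3 ab c)
    + (gauss_kernel_deriv x b \<bullet> cross3 c a + gauss_kernel x \<bullet> (cross3 c ab + cross3 bc a))
    + (gauss_kernel_deriv x c \<bullet> cross3 a b + gauss_kernel x \<bullet> (cross3 a bc + cross3 ac b)) = 0"
proof -
  have "cross3 b ac + cross3 ab c + (cross3 c ab + cross3 bc a) + (cross3 a bc + cross3 ac b) = 0"
    using cross_skew[of b ac] cross_skew[of c ab] cross_skew[of a bc] by simp
  then have "gauss_kernel x \<bullet> (cross3 b ac + cross3 ab c) + gauss_kernel x \<bullet> (cross3 c ab + cross3 bc a)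
      + gauss_kernel x \<bullet> (cross3 a bc + cross3 ac b) = 0"
    by (simp only: inner_add_right[symmetric]) simp
  then show ?thesis using gauss_kernel_deriv_trace[OF assms, of a b c] by linarith
qed

lemma gauss_flux_box_boundary:
  fixes F Fx Fy Fz Fxy Fxz Fyz :: "real \<Rightarrow> real \<Rightarrow> real \<Rightarrow> real^3"
  defines "P \<equiv> \<lambda>x y z. gauss_kernel (F x y z) \<bullet> cross3 (Fy x y z) (Fz x y z)"
    and "Q \<equiv> \<lambda>x y z. gauss_kernel (F x y z) \<bullet> cross3 (Fz x y z) (Fx x y z)"
    and "R \<equiv> \<lambda>x y z. gauss_kernel (F x y z) \<bullet> cross3 (Fx x y z) (Fy x y z)"
  assumes le: "a1 \<le> b1" "a2 \<le> b2" "a3 \<le> b3"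
    and dx: "\<And>x y z. ((\<lambda>x. F x y z) has_vector_derivative Fx x y z) (at x within {a1..b1})"
      "\<And>x y z. ((\<lambda>x. Fy x y z) has_vector_derivative Fxy x y z) (at x within {a1..b1})"
      "\<And>x y z. ((\<lambda>x. Fz x y z) has_vector_derivative Fxz x y z) (at x within {a1..b1})"
    and dy: "\<And>x y z. ((\<lambda>y. F x y z) has_vector_derivative Fy x y z) (at y within {a2..b2})"
      "\<And>x y z. ((\<lambda>y. Fz x y z) has_vector_derivative Fyz x y z) (at y within {a2..b2})"
      "\<And>x y z. ((\<lambda>y. Fx x y z) has_vector_derivative Fxy x y z) (at y within {a2..b2})"
    and dz: "\<And>x y z. ((\<lambda>z. F x y z) has_vector_derivative Fz x y z) (at z within {a3..b3})"
      "\<And>x y z. ((\<lambda>z. Fx x y z) has_vector_derivative Fxz x y z) (at z within {a3..b3})"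
      "\<And>x y z. ((\<lambda>z. Fy x y z) has_vector_derivative Fyz x y z) (at z within {a3..b3})"
    and cont: "\<And>G. G \<in> {F, Fx, Fy, Fz, Fxy, Fxz, Fyz} \<Longrightarrow>
      continuous_on ({a1..b1} \<times> {a2..b2} \<times> {a3..b3}) (\<lambda>(x, y, z). G x y z)"
    and nz: "\<And>x y z. \<lbrakk>x \<in> {a1..b1}; y \<in> {a2..b2}; z \<in> {a3..b3}\<rbrakk> \<Longrightarrow> F x y z \<noteq> 0"
  shows "integral {a2..b2} (\<lambda>y. integral {a3..b3} (\<lambda>z. P b1 y z - P a1 y z))
    + integral {a1..b1} (\<lambda>x. integral {a3..b3} (\<lambda>z. Q x b2 z - Q x a2 z))
    + integral {a1..b1} (\<lambda>x. integral {a2..b2} (\<lambda>y. R x y b3 - R x y a3)) = 0"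
proof -
  let ?K = "\<lambda>x y z. gauss_kernel (F x y z)" and ?K' = "\<lambda>x y z. gauss_kernel_deriv (F x y z)"
  let ?P1 = "\<lambda>x y z. ?K' x y z (Fx x y z) \<bullet> cross3 (Fy x y z) (Fz x y z)
    + ?K x y z \<bullet> (cross3 (Fy x y z) (Fxz x y z) + cross3 (Fxy x y z) (Fz x y z))"
  let ?Q2 = "\<lambda>x y z. ?K' x y z (Fy x y z) \<bullet> cross3 (Fz x y z) (Fx x y z)
    + ?K x y z \<bullet> (cross3 (Fz x y z) (Fxy x y z) + cross3 (Fyz x y z) (Fx x y z))"
  let ?R3 = "\<lambda>x y z. ?K' x y z (Fz x y z) \<bullet> cross3 (Fx x y z) (Fy x y z)
    + ?K x y z \<bullet> (cross3 (Fx x y z) (Fyz x y z) + cross3 (Fxz x y z) (Fy x y z))"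
  note cross_deriv = bounded_bilinear.has_vector_derivative[OF bounded_bilinear_cross3]
  have divergence: "?P1 x y z + ?Q2 x y z + ?R3 x y z = 0"
    if "x \<in> {a1..b1}" "y \<in> {a2..b2}" "z \<in> {a3..b3}" for x y z
    by (rule gauss_kernel_pullback_closed[OF nz[OF that]])
  have "integral {a1..b1} (\<lambda>x. integral {a2..b2}
      (\<lambda>y. integral {a3..b3} (\<lambda>z. ?P1 x y z + ?Q2 x y z + ?R3 x y z)))
    = integral {a2..b2} (\<lambda>y. integral {a3..b3} (\<lambda>z. P b1 y z - P a1 y z))
    + integral {a1..b1} (\<lambda>x. integral {a3..b3} (\<lambda>z. Q x b2 z - Q x a2 z))
    + integral {a1..b1} (\<lambda>x. integral {a2..b2} (\<lambda>y. R x y b3 - R x y a3))"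
  proof (rule divergence_box[OF le])
    fix x y z assume xyz: "x \<in> {a1..b1}" "y \<in> {a2..b2}" "z \<in> {a3..b3}"
    show "((\<lambda>x. P x y z) has_real_derivative ?P1 x y z) (at x within {a1..b1})"
      unfolding P_def by (rule gauss_kernel_inner_has_real_derivative[OF dx(1) nz[OF xyz]
          cross_deriv[OF dx(2,3)]])
    show "((\<lambda>y. Q x y z) has_real_derivative ?Q2 x y z) (at y within {a2..b2})"
      unfolding Q_def by (rule gauss_kernel_inner_has_real_derivative[OF dy(1) nz[OF xyz]
          cross_deriv[OF dy(2,3)]])
    show "((\<lambda>z. R x y z) has_real_derivative ?R3 x y z) (at z within {a3..b3})"
      unfolding R_def by (rule gauss_kernel_inner_has_real_derivative[OF dz(1) nz[OF xyz]
          cross_deriv[OF dz(2,3)]])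
  qed (unfold case_prod_beta, (intro continuous_on_add continuous_on_inner continuous_on_cross
      continuous_on_gauss_kernel continuous_on_gauss_kernel_deriv cont[unfolded case_prod_beta];
          use nz in auto)+)
  moreover have "integral {a1..b1} (\<lambda>x. integral {a2..b2}
      (\<lambda>y. integral {a3..b3} (\<lambda>z. ?P1 x y z + ?Q2 x y z + ?R3 x y z)))
      = integral {a1..b1} (\<lambda>x. integral {a2..b2} (\<lambda>y. integral {a3..b3} (\<lambda>z. 0)))"
    by (intro integral_cong divergence)
  ultimately show ?thesis by simp
qed

lemma has_real_derivative_divide_sqrt:
  fixes m z :: real
  assumes pos: "m + z^2 > 0"
  shows "((\<lambda>z. z / sqrt (m + z^2)) has_real_derivative m / sqrt (m + z^2) ^ 3) (at z within S)"
proof -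
  define s where "s = sqrt (m + z^2)"
  have s: "s > 0" "s^2 = m + z^2" using pos by (auto simp: s_def)
  have "((\<lambda>z. m + z^2) has_real_derivative 2 * z) (at z within S)"
    by (auto intro!: derivative_eq_intros)
  from DERIV_chain2[OF DERIV_real_sqrt[OF pos] this]
  have "((\<lambda>z. sqrt (m + z^2)) has_real_derivative inverse s / 2 * (2 * z)) (at z within S)"
    unfolding s_def .
  from DERIV_divide[OF DERIV_ident this] s(1)
  have "((\<lambda>z. z / sqrt (m + z^2)) has_real_derivative (1 * s - z * (inverse s / 2 * (2 * z))) / (s * s))
      (at z within S)"
    by (simp add: s_def)
  moreover have "1 * s - z * (inverse s / 2 * (2 * z)) = (s^2 - z^2) / s"
    using s(1) by (simp add: field_simps power2_eq_square)
  then have "(1 * s - z * (inverse s / 2 * (2 * z))) / (s * s) = m / s^3"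
    using s by (simp add: field_simps power_numeral_reduce)
  ultimately show ?thesis by (simp add: s_def)
qed

lemma integral_inverse_cube_distance:
  assumes m: "m > 0" and \<eta>: "\<eta> \<ge> 0"
  shows "integral {-\<eta>..\<eta>} (\<lambda>z. 1 / sqrt (m + z^2) ^ 3) = 2 * \<eta> / (m * sqrt (m + \<eta>^2))"
proof -
  have "integral {-\<eta>..\<eta>} (\<lambda>z. 1 / m * (m / sqrt (m + z^2) ^ 3))
      = 1 / m * (\<eta> / sqrt (m + \<eta>^2)) - 1 / m * (-\<eta> / sqrt (m + (-\<eta>)^2))"
  proof (rule integral_real_derivative[where f="\<lambda>z. 1 / m * (z / sqrt (m + z^2))"])
    show "((\<lambda>z. 1 / m * (z / sqrt (m + z^2))) has_real_derivative 1 / m * (m / sqrt (m + z^2) ^ 3))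
        (at z within {-\<eta>..\<eta>})" for z
      using m by (intro DERIV_cmult has_real_derivative_divide_sqrt) (simp add: add_pos_nonneg)
  qed (use \<eta> in simp)
  then show ?thesis using m by simp
qed

lemma solid_angle_arctan_has_derivative:
  fixes \<eta> r y :: real
  assumes r: "r \<noteq> 0"
  shows "((\<lambda>y. arctan (\<eta> / r * (y / sqrt (r^2 + \<eta>^2 + y^2)))) has_real_derivative
    \<eta> * r / ((r^2 + y^2) * sqrt (r^2 + \<eta>^2 + y^2))) (at y within S)"
proof -
  define k where "k = r^2 + \<eta>^2"
  have k: "k > 0" using r by (simp add: k_def add_pos_nonneg)
  define s where "s = sqrt (k + y^2)"
  have pos: "k + y^2 > 0" using k by (simp add: add_pos_nonneg)
  then have s: "s > 0" "s^2 = k + y^2" by (auto simp: s_def)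
  have ry: "r^2 + y^2 > 0" using r by (simp add: add_pos_nonneg)
  have "r^2 * s^2 + \<eta>^2 * y^2 = (r^2 + y^2) * k" unfolding s(2) k_def by algebra
  moreover have "1 + (\<eta> / r * (y / s))^2 = (r^2 * s^2 + \<eta>^2 * y^2) / (r^2 * s^2)"
    using s(1) r by (simp add: divide_simps power_mult_distrib power_divide)
  ultimately have "inverse (1 + (\<eta> / r * (y / s))^2) * (\<eta> / r * (k / s ^ 3))
      = r^2 * s^2 / ((r^2 + y^2) * k) * (\<eta> / r * (k / s ^ 3))"
    by simp
  also have "r^2 * s^2 / (q * k) * (\<eta> / r * (k / s ^ 3)) = \<eta> * r / (q * s)" if "q > 0" for q
    using that k s(1) r by (simp add: divide_simps power_numeral_reduce)
  from this[OF ry] have "r^2 * s^2 / ((r^2 + y^2) * k) * (\<eta> / r * (k / s ^ 3)) = \<eta> * r / ((r^2 + y^2) * s)" .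
  finally show ?thesis
    using DERIV_chain2[OF DERIV_arctan DERIV_cmult[OF has_real_derivative_divide_sqrt[OF pos]], of "\<eta> / r" S]
    by (simp add: s_def k_def)
qed

lemma solid_angle_square:
  fixes \<eta> r :: real
  assumes \<eta>: "\<eta> > 0" and r: "r \<noteq> 0"
  shows "integral {-\<eta>..\<eta>} (\<lambda>y. integral {-\<eta>..\<eta>} (\<lambda>z. r / sqrt (r^2 + y^2 + z^2) ^ 3))
    = 4 * arctan (\<eta> / r * (\<eta> / sqrt (r^2 + \<eta>^2 + \<eta>^2)))"
proof -
  let ?\<Theta> = "\<lambda>y. 2 * arctan (\<eta> / r * (y / sqrt (r^2 + \<eta>^2 + y^2)))"
  have "integral {-\<eta>..\<eta>} (\<lambda>z. r / sqrt (r^2 + y^2 + z^2) ^ 3)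
      = 2 * (\<eta> * r / ((r^2 + y^2) * sqrt (r^2 + \<eta>^2 + y^2)))" for y
  proof -
    have "integral {-\<eta>..\<eta>} (\<lambda>z. r * (1 / sqrt (r^2 + y^2 + z^2) ^ 3))
        = r * (2 * \<eta> / ((r^2 + y^2) * sqrt (r^2 + y^2 + \<eta>^2)))"
      using r \<eta> by (subst integral_mult_right, subst integral_inverse_cube_distance)
          (auto intro: add_pos_nonneg)
    then show ?thesis by (simp add: mult.commute add.commute add.left_commute)
  qed
  moreover have "integral {-\<eta>..\<eta>} (\<lambda>y. 2 * (\<eta> * r / ((r^2 + y^2) * sqrt (r^2 + \<eta>^2 + y^2)))) = ?\<Theta> \<eta> - ?\<Theta> (-\<eta>)"
  proof (rule integral_real_derivative)
    show "(?\<Theta> has_real_derivative 2 * (\<eta> * r / ((r^2 + y^2) * sqrt (r^2 + \<eta>^2 + y^2)))) (at y within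
        {-\<eta>..\<eta>})" for y
      by (intro DERIV_cmult solid_angle_arctan_has_derivative r)
  qed (use \<eta> in simp)
  ultimately show ?thesis by (simp add: arctan_minus)
qed

lemma double_integral_combine_outer:
  fixes f :: "real \<Rightarrow> real \<Rightarrow> real"
  assumes f: "continuous_on ({a..b} \<times> {c..d}) (\<lambda>(x, y). f x y)" and le: "a \<le> m" "m \<le> b"
  shows "integral {a..b} (\<lambda>x. integral {c..d} (f x))
    = integral {a..m} (\<lambda>x. integral {c..d} (f x)) + integral {m..b} (\<lambda>x. integral {c..d} (f x))"
  by (rule Henstock_Kurzweil_Integration.integral_combine[symmetric])
    (use le in \<open>auto intro!: integrable_continuous_interval continuous_on_integral_Icc[OF f]\<close>)

lemma double_integral_combine_inner:
  fixes f :: "real \<Rightarrow> real \<Rightarrow> real"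
  assumes f: "continuous_on ({a..b} \<times> {c..d}) (\<lambda>(x, y). f x y)" and le: "c \<le> m" "m \<le> d"
  shows "integral {a..b} (\<lambda>x. integral {c..d} (f x))
    = integral {a..b} (\<lambda>x. integral {c..m} (f x)) + integral {a..b} (\<lambda>x. integral {m..d} (f x))"
proof -
  have swapped: "continuous_on ({c..d} \<times> {a..b}) (\<lambda>(y, x). f x y)"
    unfolding case_prod_beta by (rule continuous_on_compose_curried2[OF f]) (auto intro!: continuous_intros)
  have sub: "continuous_on ({a..b} \<times> {c..m}) (\<lambda>(x, y). f x y)"
      "continuous_on ({a..b} \<times> {m..d}) (\<lambda>(x, y). f x y)"
    using le by (auto intro!: continuous_on_subset[OF f])
  show ?thesis
    using double_integral_combine_outer[OF swapped le]
    by (simp add: double_integral_swap[OF f] double_integral_swap[OF sub(1)] double_integral_swap[OF sub(2)])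
qed

lemma double_integral_split_centre:
  fixes f :: "real \<Rightarrow> real \<Rightarrow> real"
  assumes f: "continuous_on ({-a..a} \<times> {-a..a}) (\<lambda>(x, y). f x y)" and \<eta>: "0 \<le> \<eta>" "\<eta> \<le> a"
  shows "integral {-a..a} (\<lambda>x. integral {-a..a} (f x))
    = integral {-a..-\<eta>} (\<lambda>x. integral {-a..a} (f x)) + integral {\<eta>..a} (\<lambda>x. integral {-a..a} (f x))
    + integral {-\<eta>..\<eta>} (\<lambda>x. integral {-a..-\<eta>} (f x)) + integral {-\<eta>..\<eta>} (\<lambda>x. integral {\<eta>..a} (f x))
    + integral {-\<eta>..\<eta>} (\<lambda>x. integral {-\<eta>..\<eta>} (f x))"
proof -
  have sub: "continuous_on ({b..c} \<times> {d..e}) (\<lambda>(x, y). f x y)"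
      if "-a \<le> b" "c \<le> a" "-a \<le> d" "e \<le> a" for b c d e
    by (rule continuous_on_subset[OF f]) (use that in auto)
  show ?thesis
    using \<eta> double_integral_combine_outer[OF f, of "-\<eta>"]
      double_integral_combine_outer[OF sub[of "-\<eta>" a "-a" a], of \<eta>]
      double_integral_combine_inner[OF sub[of "-\<eta>" \<eta> "-a" a], of "-\<eta>"]
      double_integral_combine_inner[OF sub[of "-\<eta>" \<eta> "-\<eta>" a], of \<eta>]
    by simp
qed

(* The curves A and B r cross at parameter 0 as r passes through 0. Near the crossing they can be homotoped,
   without collisions for r \<noteq> 0, to straight lines in the directions \<alpha> and \<beta> at signed distance r along \<nu>. *)
locale curve_crossing =
  fixes A A' :: "real \<Rightarrow> real^3" and B B' :: "real \<Rightarrow> real \<Rightarrow> real^3"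
    and \<alpha> \<beta> \<nu> :: "real^3" and a \<eta> \<epsilon> :: real
  assumes deriv: "\<And>u. (A has_vector_derivative A' u) (at u)" "\<And>r v. (B r has_vector_derivative B' r v) (at v)"
    and cont: "continuous_on UNIV A'" "continuous_on UNIV (\<lambda>(r, v). B r v)"
        "continuous_on UNIV (\<lambda>(r, v). B' r v)"
    and frame: "norm \<alpha> = 1" "norm \<beta> = 1" "\<alpha> \<bullet> \<beta> = 0" "cross3 \<alpha> \<beta> = \<nu>"
    and widths: "0 < \<eta>" "\<eta> < a" "0 < \<epsilon>"
    and near: "\<And>r x y z. \<lbrakk>r \<in> {-\<epsilon>..\<epsilon>}; x \<in> {0..1}; y \<in> {-\<eta>..\<eta>}; z \<in> {-\<eta>..\<eta>}; (y, z, r) \<noteq> 0\<rbrakk> \<Longrightarrow>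
      (1 - x) *\<^sub>R (y *\<^sub>R \<alpha> - (z *\<^sub>R \<beta> + r *\<^sub>R \<nu>)) + x *\<^sub>R (A y - B r z) \<noteq> 0"
    and apart: "\<And>r u v. \<lbrakk>r \<in> {-\<epsilon>..\<epsilon>}; u \<in> {-a..a}; v \<in> {-a..a}; (u, v, r) \<noteq> 0\<rbrakk> \<Longrightarrow> A u \<noteq> B r v"
begin

definition hom :: "real \<Rightarrow> real \<Rightarrow> real \<Rightarrow> real \<Rightarrow> real^3" where
  "hom r x y z = (1 - x) *\<^sub>R (y *\<^sub>R \<alpha> - (z *\<^sub>R \<beta> + r *\<^sub>R \<nu>)) + x *\<^sub>R (A y - B r z)"

definition hom_x :: "real \<Rightarrow> real \<Rightarrow> real \<Rightarrow> real^3" where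
  "hom_x r y z = (A y - B r z) - (y *\<^sub>R \<alpha> - (z *\<^sub>R \<beta> + r *\<^sub>R \<nu>))"

definition hom_y :: "real \<Rightarrow> real \<Rightarrow> real^3" where
  "hom_y x y = (1 - x) *\<^sub>R \<alpha> + x *\<^sub>R A' y"

definition hom_z :: "real \<Rightarrow> real \<Rightarrow> real \<Rightarrow> real^3" where
  "hom_z r x z = - ((1 - x) *\<^sub>R \<beta> + x *\<^sub>R B' r z)"

definition side_flux :: "real \<Rightarrow> real" where
  "side_flux r =
    integral {0..1} (\<lambda>x. integral {-\<eta>..\<eta>} (\<lambda>z.
      gauss_kernel (hom r x \<eta> z) \<bullet> cross3 (hom_z r x z) (hom_x r \<eta> z)
      - gauss_kernel (hom r x (-\<eta>) z) \<bullet> cross3 (hom_z r x z) (hom_x r (-\<eta>) z)))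
    + integral {0..1} (\<lambda>x. integral {-\<eta>..\<eta>} (\<lambda>y.
      gauss_kernel (hom r x y \<eta>) \<bullet> cross3 (hom_x r y \<eta>) (hom_y x y)
      - gauss_kernel (hom r x y (-\<eta>)) \<bullet> cross3 (hom_x r y (-\<eta>)) (hom_y x y)))"

abbreviation Z :: "real \<Rightarrow> real \<Rightarrow> real \<Rightarrow> real" where
  "Z r \<equiv> gauss_integrand A A' (B r) (B' r)"

definition outer_integral :: "real \<Rightarrow> real" where
  "outer_integral r =
    integral {-a..-\<eta>} (\<lambda>u. integral {-a..a} (Z r u)) + integral {\<eta>..a} (\<lambda>u. integral {-a..a} (Z r u))
    + integral {-\<eta>..\<eta>} (\<lambda>u. integral {-a..-\<eta>} (Z r u)) + integral {-\<eta>..\<eta>} (\<lambda>u. integral {\<eta>..a} (Z r u))"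

lemma continuous_on_curves:
  "continuous_on S u \<Longrightarrow> continuous_on S (\<lambda>p. A (u p))"
  "continuous_on S u \<Longrightarrow> continuous_on S (\<lambda>p. A' (u p))"
  "continuous_on S r \<Longrightarrow> continuous_on S v \<Longrightarrow> continuous_on S (\<lambda>p. B (r p) (v p))"
  "continuous_on S r \<Longrightarrow> continuous_on S v \<Longrightarrow> continuous_on S (\<lambda>p. B' (r p) (v p))"
proof -
  have "continuous_on UNIV A"
    using deriv(1) by (auto intro!: continuous_at_imp_continuous_on has_vector_derivative_continuous)
  then show "continuous_on S u \<Longrightarrow> continuous_on S (\<lambda>p. A (u p))"
    "continuous_on S u \<Longrightarrow> continuous_on S (\<lambda>p. A' (u p))"
    using cont(1) by (auto intro: continuous_on_compose2)
  show "continuous_on S r \<Longrightarrow> continuous_on S v \<Longrightarrow> continuous_on S (\<lambda>p. B (r p) (v p))"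
    "continuous_on S r \<Longrightarrow> continuous_on S v \<Longrightarrow> continuous_on S (\<lambda>p. B' (r p) (v p))"
    using continuous_on_compose_curried2[of UNIV UNIV B]
        continuous_on_compose_curried2[of UNIV UNIV B'] cont(2,3)
    by simp_all
qed

lemma continuous_on_hom:
  "\<lbrakk>continuous_on S r; continuous_on S x; continuous_on S y; continuous_on S z\<rbrakk> \<Longrightarrow>
    continuous_on S (\<lambda>p. hom (r p) (x p) (y p) (z p))"
  "\<lbrakk>continuous_on S r; continuous_on S y; continuous_on S z\<rbrakk> \<Longrightarrow> continuous_on S (\<lambda>p. hom_x (r p) (y p) (z p))"
  "\<lbrakk>continuous_on S x; continuous_on S y\<rbrakk> \<Longrightarrow> continuous_on S (\<lambda>p. hom_y (x p) (y p))"
  "\<lbrakk>continuous_on S r; continuous_on S x; continuous_on S z\<rbrakk> \<Longrightarrow> continuous_on S (\<lambda>p. hom_z (r p) (x p) (z p))"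
  unfolding hom_def hom_x_def hom_y_def hom_z_def
  by (intro continuous_intros continuous_on_curves; assumption)+

lemma hom_nonzero:
  "\<lbrakk>r \<in> {-\<epsilon>..\<epsilon>}; x \<in> {0..1}; y \<in> {-\<eta>..\<eta>}; z \<in> {-\<eta>..\<eta>}; y \<noteq> 0 \<or> z \<noteq> 0 \<or> r \<noteq> 0\<rbrakk> \<Longrightarrow> hom r x y z \<noteq> 0"
  unfolding hom_def by (rule near) (auto simp: zero_prod_def)

lemma continuous_on_side_flux: "continuous_on {-\<epsilon>..\<epsilon>} side_flux"
proof -
  have "continuous_on ({-\<epsilon>..\<epsilon>} \<times> {0..1} \<times> {-\<eta>..\<eta>}) (\<lambda>(r, x, z).
      gauss_kernel (hom r x \<eta> z) \<bullet> cross3 (hom_z r x z) (hom_x r \<eta> z)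
      - gauss_kernel (hom r x (-\<eta>) z) \<bullet> cross3 (hom_z r x z) (hom_x r (-\<eta>) z))"
    unfolding case_prod_beta
    by (intro continuous_on_diff continuous_on_inner continuous_on_gauss_kernel continuous_on_cross
        continuous_on_hom continuous_intros hom_nonzero) (use widths in auto)
  moreover have "continuous_on ({-\<epsilon>..\<epsilon>} \<times> {0..1} \<times> {-\<eta>..\<eta>}) (\<lambda>(r, x, y).
      gauss_kernel (hom r x y \<eta>) \<bullet> cross3 (hom_x r y \<eta>) (hom_y x y)
      - gauss_kernel (hom r x y (-\<eta>)) \<bullet> cross3 (hom_x r y (-\<eta>)) (hom_y x y))"
    unfolding case_prod_beta
    by (intro continuous_on_diff continuous_on_inner continuous_on_gauss_kernel continuous_on_cross
        continuous_on_hom continuous_intros hom_nonzero) (use widths in auto)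
  ultimately show ?thesis
    unfolding side_flux_def[abs_def] by (intro continuous_on_add continuous_on_double_integral)
qed

lemma continuous_on_gauss_integrand_crossing:
  assumes "S \<subseteq> {-\<epsilon>..\<epsilon>}" "{b..c} \<subseteq> {-a..a}" "{d..e} \<subseteq> {-a..a}" "0 \<notin> S \<or> 0 \<notin> {b..c} \<or> 0 \<notin> {d..e}"
  shows "continuous_on (S \<times> {b..c} \<times> {d..e}) (\<lambda>(r, u, v). Z r u v)"
proof -
  have "A u \<noteq> B r v" if "r \<in> S" "u \<in> {b..c}" "v \<in> {d..e}" for r u v
    by (rule apart) (use assms that in \<open>auto simp: zero_prod_def\<close>)
  then show ?thesis
    unfolding gauss_integrand_def case_prod_beta
    by (intro continuous_on_inner continuous_on_gauss_kernel continuous_on_cross continuous_intros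
        continuous_on_curves)
      auto
qed

lemma continuous_on_outer_integral: "continuous_on {-\<epsilon>..\<epsilon>} outer_integral"
  unfolding outer_integral_def[abs_def]
  by (intro continuous_on_add continuous_on_double_integral continuous_on_gauss_integrand_crossing)
    (use widths in auto)

lemma continuous_on_gauss_integrand_off_crossing:
  assumes "r \<in> {-\<epsilon>..\<epsilon>}" "r \<noteq> 0"
  shows "continuous_on ({-a..a} \<times> {-a..a}) (\<lambda>(u, v). Z r u v)"
  unfolding case_prod_beta
  by (rule continuous_on_compose_curried3[OF continuous_on_gauss_integrand_crossing[of "{r}" "-a" a "-a" a]])
    (use assms in \<open>auto intro!: continuous_intros\<close>)

lemma homotopy_flux_balance:
  assumes r: "r \<in> {-\<epsilon>..\<epsilon>}" "r \<noteq> 0"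
  shows "integral {-\<eta>..\<eta>} (\<lambda>y. integral {-\<eta>..\<eta>} (\<lambda>z.
      gauss_kernel (hom r 1 y z) \<bullet> cross3 (hom_y 1 y) (hom_z r 1 z)
      - gauss_kernel (hom r 0 y z) \<bullet> cross3 (hom_y 0 y) (hom_z r 0 z))) + side_flux r = 0"
proof -
  note deriv_within = deriv[THEN has_vector_derivative_at_within]
  show ?thesis
    unfolding side_flux_def add.assoc[symmetric]
  proof (rule gauss_flux_box_boundary[where Fxy="\<lambda>x y z. A' y - \<alpha>" and Fxz="\<lambda>x y z. \<beta> - B' r z"
      and Fyz="\<lambda>x y z. 0"])
    fix x y z :: real
    show "((\<lambda>x. hom r x y z) has_vector_derivative hom_x r y z) (at x within {0..1})"
      "((\<lambda>x. hom_y x y) has_vector_derivative A' y - \<alpha>) (at x within {0..1})"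
      "((\<lambda>x. hom_z r x z) has_vector_derivative \<beta> - B' r z) (at x within {0..1})"
      unfolding hom_def hom_x_def hom_y_def hom_z_def
      by (auto intro!: derivative_eq_intros simp: has_vector_derivative_def algebra_simps)
    show "((\<lambda>y. hom r x y z) has_vector_derivative hom_y x y) (at y within {-\<eta>..\<eta>})"
      "((\<lambda>y. hom_x r y z) has_vector_derivative A' y - \<alpha>) (at y within {-\<eta>..\<eta>})"
      "((\<lambda>z. hom r x y z) has_vector_derivative hom_z r x z) (at z within {-\<eta>..\<eta>})"
      "((\<lambda>z. hom_x r y z) has_vector_derivative \<beta> - B' r z) (at z within {-\<eta>..\<eta>})"
      unfolding hom_def hom_x_def hom_y_def hom_z_def
      by (auto intro!: derivative_eq_intros deriv_within simp: algebra_simps)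
  next
    show "hom r x y z \<noteq> 0" if "x \<in> {0..1}" "y \<in> {-\<eta>..\<eta>}" "z \<in> {-\<eta>..\<eta>}" for x y z
      using hom_nonzero r that by blast
  next
    fix G
    assume "G \<in> {\<lambda>x y z. hom r x y z, \<lambda>x y z. hom_x r y z, \<lambda>x y z. hom_y x y, \<lambda>x y z. hom_z r x z,
        \<lambda>x y z. A' y - \<alpha>, \<lambda>x y z. \<beta> - B' r z, \<lambda>x y z. 0}"
    then show "continuous_on ({0..1} \<times> {-\<eta>..\<eta>} \<times> {-\<eta>..\<eta>}) (\<lambda>(x, y, z). G x y z)"
      unfolding case_prod_beta
      by (elim insertE emptyE; simp only:; intro continuous_on_hom continuous_on_curves continuous_intros)
  qed (use widths in auto)
qed

lemma integral_centre:
  assumes r: "r \<in> {-\<epsilon>..\<epsilon>}" "r \<noteq> 0"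
  shows "integral {-\<eta>..\<eta>} (\<lambda>y. integral {-\<eta>..\<eta>} (Z r y))
    = side_flux r - 4 * arctan (\<eta> / r * (\<eta> / sqrt (r^2 + \<eta>^2 + \<eta>^2)))"
proof -
  have curves: "gauss_kernel (hom r 1 y z) \<bullet> cross3 (hom_y 1 y) (hom_z r 1 z) = - Z r y z" for y z
    by (simp add: hom_def hom_y_def hom_z_def gauss_integrand_def)
  have lines: "gauss_kernel (hom r 0 y z) \<bullet> cross3 (hom_y 0 y) (hom_z r 0 z)
      = r / sqrt (r^2 + y^2 + z^2) ^ 3" for y z
  proof -
    let ?w = "y *\<^sub>R \<alpha> - (z *\<^sub>R \<beta> + r *\<^sub>R \<nu>)"
    have "\<alpha> \<bullet> \<alpha> = 1" "\<beta> \<bullet> \<beta> = 1" "\<nu> \<bullet> \<nu> = 1" "\<alpha> \<bullet> \<nu> = 0" "\<beta> \<bullet> \<nu> = 0"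
      using frame norm_cross[of \<alpha> \<beta>] by (auto simp: dot_cross_self dot_square_norm)
    then have "?w \<bullet> ?w = r^2 + y^2 + z^2" "?w \<bullet> \<nu> = - r"
      using frame(3)
      by (simp_all add: inner_diff_left inner_diff_right inner_add_left inner_add_right inner_commute
          power2_eq_square)
    then show ?thesis
      by (simp add: hom_def hom_y_def hom_z_def gauss_kernel_def frame(4) norm_eq_sqrt_inner)
  qed
  have pos: "0 < r^2 + y^2 + z^2" for y z using r(2) by (simp add: add_pos_nonneg)
  have "integral {-\<eta>..\<eta>} (\<lambda>y. integral {-\<eta>..\<eta>} (\<lambda>z. - Z r y z - r / sqrt (r^2 + y^2 + z^2) ^ 3))
    = integral {-\<eta>..\<eta>} (\<lambda>y. integral {-\<eta>..\<eta>} (\<lambda>z. - Z r y z))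
    - integral {-\<eta>..\<eta>} (\<lambda>y. integral {-\<eta>..\<eta>} (\<lambda>z. r / sqrt (r^2 + y^2 + z^2) ^ 3))"
  proof (rule double_integral_diff)
    show "continuous_on ({-\<eta>..\<eta>} \<times> {-\<eta>..\<eta>}) (\<lambda>(y, z). - Z r y z)"
      unfolding case_prod_beta
      by (intro continuous_on_minus continuous_on_compose_curried2[OF
          continuous_on_gauss_integrand_off_crossing[OF r]])
        (use widths in \<open>auto intro!: continuous_intros\<close>)
    show "continuous_on ({-\<eta>..\<eta>} \<times> {-\<eta>..\<eta>}) (\<lambda>(y, z). r / sqrt (r^2 + y^2 + z^2) ^ 3)"
      unfolding case_prod_beta using pos by (intro continuous_intros) (auto simp: less_imp_neq[symmetric])
  qed
  then show ?thesis
    using homotopy_flux_balance[OF r] solid_angle_square[OF widths(1) r(2)] by (simp add: curves lines)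
qed

lemma tendsto_solid_angle:
  "((\<lambda>r. arctan (\<eta> / r * (\<eta> / sqrt (r^2 + \<eta>^2 + \<eta>^2)))) \<longlongrightarrow> pi / 2) (at_right 0)"
proof (rule filterlim_compose[OF tendsto_arctan_at_top])
  show "filterlim (\<lambda>r. \<eta> / r * (\<eta> / sqrt (r^2 + \<eta>^2 + \<eta>^2))) at_top (at_right 0)"
  proof (rule filterlim_at_top_mult_tendsto_pos[where c="\<eta> / sqrt (0^2 + \<eta>^2 + \<eta>^2)"])
    show "((\<lambda>r. \<eta> / sqrt (r^2 + \<eta>^2 + \<eta>^2)) \<longlongrightarrow> \<eta> / sqrt (0^2 + \<eta>^2 + \<eta>^2)) (at_right 0)"
      using widths(1) by (intro tendsto_intros) auto
    show "filterlim (\<lambda>r. \<eta> / r) at_top (at_right 0)"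
      using filterlim_tendsto_pos_mult_at_top[OF tendsto_const widths(1) filterlim_inverse_at_top_right]
      by (simp add: divide_inverse)
  qed (use widths(1) in \<open>auto simp: divide_simps\<close>)
qed

theorem gauss_integral_jump:
  "((\<lambda>r. integral {-a..a} (\<lambda>u. integral {-a..a} (Z (- r) u))
      - integral {-a..a} (\<lambda>u. integral {-a..a} (Z r u)))
    \<longlongrightarrow> 4 * pi) (at_right 0)"
proof -
  define K where "K r = outer_integral r + side_flux r" for r
  let ?\<Theta> = "\<lambda>r. arctan (\<eta> / r * (\<eta> / sqrt (r^2 + \<eta>^2 + \<eta>^2)))"
  have total: "integral {-a..a} (\<lambda>u. integral {-a..a} (Z r u)) = K r - 4 * ?\<Theta> r"
    if "r \<in> {-\<epsilon>..\<epsilon>}" "r \<noteq> 0" for r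
    using double_integral_split_centre[OF continuous_on_gauss_integrand_off_crossing[OF that], of \<eta>]
      integral_centre[OF that] widths by (simp add: K_def outer_integral_def)
  have "isCont K 0"
    using continuous_on_add[OF continuous_on_outer_integral continuous_on_side_flux] widths(3)
    by (intro continuous_on_interior[of "{-\<epsilon>..\<epsilon>}"]) (auto simp: K_def[abs_def])
  then have "(K \<longlongrightarrow> K 0) (at_right 0)" "((\<lambda>r. K (- r)) \<longlongrightarrow> K 0) (at_right 0)"
    by (auto intro!: tendsto_eq_intros isCont_tendsto_compose[where g=K])
  then have "((\<lambda>r. K (- r) - K r + 8 * ?\<Theta> r) \<longlongrightarrow> K 0 - K 0 + 8 * (pi / 2)) (at_right 0)"
    by (intro tendsto_intros tendsto_solid_angle)
  moreover have "\<forall>\<^sub>F r in at_right 0. K (- r) - K r + 8 * ?\<Theta> r =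
      integral {-a..a} (\<lambda>u. integral {-a..a} (Z (- r) u)) - integral {-a..a} (\<lambda>u. integral {-a..a} (Z r u))"
    unfolding eventually_at_right_field
  proof (intro exI[of _ \<epsilon>] conjI allI impI widths)
    show "K (- r) - K r + 8 * ?\<Theta> r =
      integral {-a..a} (\<lambda>u. integral {-a..a} (Z (- r) u)) - integral {-a..a} (\<lambda>u. integral {-a..a} (Z r u))"
      if "0 < r" "r < \<epsilon>" for r
      using total[of r] total[of "- r"] that by (simp add: arctan_minus)
  qed
  ultimately have "((\<lambda>r. integral {-a..a} (\<lambda>u. integral {-a..a} (Z (- r) u))
      - integral {-a..a} (\<lambda>u. integral {-a..a} (Z r u))) \<longlongrightarrow> K 0 - K 0 + 8 * (pi / 2)) (at_right 0)"
    by (rule Lim_transform_eventually)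
  then show ?thesis by simp
qed

end

lemma linear_homotopy_bounded_below:
  fixes L0 L :: "'a::euclidean_space \<Rightarrow> 'b::real_normed_vector"
  assumes lin: "linear L0" "linear L"
    and nz: "\<And>x q. \<lbrakk>x \<in> {0..1}; q \<noteq> 0\<rbrakk> \<Longrightarrow> (1 - x) *\<^sub>R L0 q + x *\<^sub>R L q \<noteq> 0"
  obtains c where "c > 0" "\<And>x q. x \<in> {0..1} \<Longrightarrow> c * norm q \<le> norm ((1 - x) *\<^sub>R L0 q + x *\<^sub>R L q)"
proof -
  let ?M = "\<lambda>x q. (1 - x) *\<^sub>R L0 q + x *\<^sub>R L q" and ?S = "{0..1::real} \<times> sphere (0::'a) 1"
  have "continuous_on ?S (\<lambda>p. norm (?M (fst p) (snd p)))"
    by (intro continuous_intros linear_continuous_on_compose lin)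
  moreover have "compact ?S" by (intro compact_Times compact_Icc compact_sphere)
  moreover have "?S \<noteq> {}" by simp
  ultimately have "\<exists>p\<in>?S. \<forall>p'\<in>?S. norm (?M (fst p) (snd p)) \<le> norm (?M (fst p') (snd p'))"
    by (intro continuous_attains_inf)
  then obtain p where p: "p \<in> ?S" "\<And>p'. p' \<in> ?S \<Longrightarrow> norm (?M (fst p) (snd p)) \<le> norm (?M (fst p') (snd p'))"
    by blast
  let ?c = "norm (?M (fst p) (snd p))"
  have "snd p \<noteq> 0" using p(1) by (auto simp: mem_Times_iff)
  then have "?c > 0" using nz[of "fst p" "snd p"] p(1) by (auto simp: mem_Times_iff)
  moreover have "?c * norm q \<le> norm (?M x q)" if x: "x \<in> {0..1}" for x q
  proof (cases "q = 0")
    case False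
    have "?M x ((1 / norm q) *\<^sub>R q) = (1 / norm q) *\<^sub>R ?M x q"
      by (simp add: linear_cmul[OF lin(1)] linear_cmul[OF lin(2)] scaleR_add_right mult.commute)
    then have "?c \<le> norm (?M x q) / norm q"
      using p(2)[of "(x, (1 / norm q) *\<^sub>R q)"] x False by simp
    then show ?thesis using False by (simp add: field_simps)
  qed simp
  ultimately show thesis by (rule that)
qed

lemma differentiable_homotopy_nonzero:
  fixes L0 L W :: "'a::euclidean_space \<Rightarrow> 'b::real_normed_vector"
  assumes L0: "linear L0" and W: "(W has_derivative L) (at 0)" "W 0 = 0"
    and nz: "\<And>x q. \<lbrakk>x \<in> {0..1}; q \<noteq> 0\<rbrakk> \<Longrightarrow> (1 - x) *\<^sub>R L0 q + x *\<^sub>R L q \<noteq> 0"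
  obtains d where "d > 0"
    "\<And>x q. \<lbrakk>x \<in> {0..1}; q \<noteq> 0; norm q < d\<rbrakk> \<Longrightarrow> (1 - x) *\<^sub>R L0 q + x *\<^sub>R W q \<noteq> 0"
proof -
  obtain c where c: "c > 0" "\<And>x q. x \<in> {0..1} \<Longrightarrow> c * norm q \<le> norm ((1 - x) *\<^sub>R L0 q + x *\<^sub>R L q)"
    using linear_homotopy_bounded_below[OF L0 has_derivative_linear[OF W(1)] nz] by blast
  have "\<forall>e>0. \<exists>d>0. \<forall>q. norm (q - 0) < d \<longrightarrow> norm (W q - W 0 - L (q - 0)) \<le> e * norm (q - 0)"
    using W(1) unfolding has_derivative_at_alt by blast
  then obtain d where d: "d > 0" "\<And>q. norm q < d \<Longrightarrow> norm (W q - L q) \<le> c / 2 * norm q"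
    using half_gt_zero[OF c(1)] unfolding W(2) diff_zero by blast
  have "(1 - x) *\<^sub>R L0 q + x *\<^sub>R W q \<noteq> 0" if x: "x \<in> {0..1}" and q: "q \<noteq> 0" "norm q < d" for x q
  proof
    assume zero: "(1 - x) *\<^sub>R L0 q + x *\<^sub>R W q = 0"
    have "c * norm q \<le> norm ((1 - x) *\<^sub>R L0 q + x *\<^sub>R L q)" by (rule c(2)[OF x])
    also have "(1 - x) *\<^sub>R L0 q + x *\<^sub>R L q = - (x *\<^sub>R (W q - L q))"
      using zero by (simp add: algebra_simps add_eq_0_iff)
    also have "norm (- (x *\<^sub>R (W q - L q))) \<le> 1 * (c / 2 * norm q)"
      unfolding norm_minus_cancel norm_scaleR using x d(2)[OF q(2)] by (intro mult_mono) auto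
    also have "\<dots> < c * norm q" using c(1) q by simp
    finally show False by simp
  qed
  with d(1) show thesis by (rule that)
qed

lemma adapted_orthonormal_frame:
  fixes a b \<nu> :: "real^3"
  assumes \<nu>: "norm \<nu> = 1" "a \<bullet> \<nu> = 0" and orient: "cross3 a b \<bullet> \<nu> > 0"
  obtains \<alpha> \<beta> where "norm \<alpha> = 1" "norm \<beta> = 1" "\<alpha> \<bullet> \<beta> = 0" "cross3 \<alpha> \<beta> = \<nu>" "a = norm a *\<^sub>R \<alpha>" "b \<bullet> \<beta> > 0"
proof -
  have a: "norm a > 0" using orient by auto
  define \<alpha> where "\<alpha> = (1 / norm a) *\<^sub>R a"
  define \<beta> where "\<beta> = cross3 \<nu> \<alpha>"
  have \<alpha>: "norm \<alpha> = 1" "\<alpha> \<bullet> \<nu> = 0" "a = norm a *\<^sub>R \<alpha>"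
    using a \<nu>(2) by (simp_all add: \<alpha>_def)
  have "norm \<beta> ^ 2 = 1"
    using norm_cross[of \<nu> \<alpha>] \<alpha> \<nu>(1) by (simp add: \<beta>_def inner_commute)
  then have "norm \<beta> = 1" using power2_eq_iff_nonneg[of "norm \<beta>" 1] by simp
  moreover have "\<alpha> \<bullet> \<beta> = 0" by (simp add: \<beta>_def dot_cross_self)
  moreover have "cross3 \<alpha> \<beta> = \<nu>"
    unfolding \<beta>_def Lagrange using \<alpha>(1,2) by (simp add: dot_square_norm inner_commute)
  moreover have "b \<bullet> \<beta> = (1 / norm a) * (cross3 a b \<bullet> \<nu>)"
    using inner_cross3_rotate[of a b \<nu>] by (simp add: \<beta>_def \<alpha>_def cross_mult_right inner_commute)
  then have "b \<bullet> \<beta> > 0" using orient a by simp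
  ultimately show thesis using that \<alpha>(1,3) by blast
qed

(* In the frame (\<alpha>, \<beta>, \<nu>) the matrix of the homotopy is triangular with nonzero diagonal. *)
lemma orthonormal_frame_homotopy_nonzero:
  fixes a b \<nu> :: "real^3"
  assumes frame: "norm \<alpha> = 1" "norm \<beta> = 1" "\<alpha> \<bullet> \<beta> = 0" "cross3 \<alpha> \<beta> = \<nu>"
    and a: "a = norm a *\<^sub>R \<alpha>" "a \<noteq> 0" and b: "b \<bullet> \<beta> > 0" "b \<bullet> \<nu> = 0"
    and x: "x \<in> {0..1}" and yzr: "(y, z, r) \<noteq> 0"
  shows "(1 - x) *\<^sub>R (y *\<^sub>R \<alpha> - (z *\<^sub>R \<beta> + r *\<^sub>R \<nu>)) + x *\<^sub>R (y *\<^sub>R a - (z *\<^sub>R b + r *\<^sub>R \<nu>)) \<noteq> 0"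
    (is "?M \<noteq> 0")
proof
  assume zero: "?M = 0"
  have "norm \<nu> ^ 2 = 1" using norm_cross[of \<alpha> \<beta>] frame by simp
  then have unit: "\<alpha> \<bullet> \<alpha> = 1" "\<beta> \<bullet> \<beta> = 1" "\<nu> \<bullet> \<nu> = 1"
    using frame(1,2) by (simp_all add: dot_square_norm)
  have orth: "\<alpha> \<bullet> \<nu> = 0" "\<beta> \<bullet> \<nu> = 0" by (simp_all add: dot_cross_self flip: frame(4))
  have a_inner: "a \<bullet> \<alpha> = norm a" "a \<bullet> \<beta> = 0" "a \<bullet> \<nu> = 0"
    using unit(1) frame(3) orth(1) by (subst a(1), simp)+
  have scale: "(1 - x) + x * t > 0" if "t > 0" for t
    using that x by (cases "x = 0") (auto intro!: add_nonneg_pos)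
  note inner_simps = inner_add_left inner_diff_left algebra_simps
  have "?M \<bullet> \<nu> = - r"
    using a_inner(3) b(2) unit(3) orth by (simp add: inner_simps)
  then have r: "r = 0" using zero by simp
  have "?M \<bullet> \<beta> = - z * ((1 - x) + x * (b \<bullet> \<beta>))"
    using unit(2) frame(3) a_inner(2) r by (simp add: inner_simps)
  then have z: "z = 0" using zero scale[OF b(1)] by simp
  have "?M \<bullet> \<alpha> = y * ((1 - x) + x * norm a)"
    using unit(1) a_inner(1) r z by (simp add: inner_simps)
  then have "y = 0" using zero scale[of "norm a"] a(2) by simp
  then show False using yzr r z by (simp add: zero_prod_def)
qed

section \<open>Step functions and integer-valued functions\<close>

lemma has_real_derivative_max_0_squared:
  "((\<lambda>x::real. (max 0 x)^2) has_real_derivative 2 * max 0 x) (at x)"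
proof (cases x "0::real" rule: linorder_cases)
  case less
  have "((\<lambda>x. 0) has_real_derivative 2 * max 0 x) (at x)" using less by simp
  then show ?thesis
    by (rule has_field_derivative_transform_within_open[where S="{..<0}"]) (use less in auto)
next
  case equal
  have "((\<lambda>h. (max 0 h)^2 / h) \<longlongrightarrow> 0) (at (0::real))"
  proof (rule tendsto_rabs_zero_cancel, rule tendsto_sandwich[where f="\<lambda>_. 0" and h="\<lambda>h. \<bar>h\<bar>"])
    show "\<forall>\<^sub>F h in at (0::real). \<bar>(max 0 h)^2 / h\<bar> \<le> \<bar>h\<bar>"
      by (intro always_eventually allI) (auto simp: max_def power2_eq_square)
  qed (auto intro!: tendsto_eq_intros)
  then show ?thesis using equal by (simp add: has_field_derivative_iff)
next
  case greater
  have "((\<lambda>x. x^2) has_real_derivative 2 * max 0 x) (at x)"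
    using greater by (auto intro!: derivative_eq_intros)
  then show ?thesis
    by (rule has_field_derivative_transform_within_open[where S="{0<..}"]) (use greater in auto)
qed

(* A quadratic spline with knots 0, 1/2 and 1. *)
definition C1_step :: "real \<Rightarrow> real" where
  "C1_step x = 2 * (max 0 x)^2 - 4 * (max 0 (x - 1/2))^2 + 2 * (max 0 (x - 1))^2"

definition C1_step_deriv :: "real \<Rightarrow> real" where
  "C1_step_deriv x = 4 * max 0 x - 8 * max 0 (x - 1/2) + 4 * max 0 (x - 1)"

lemma C1_step_has_real_derivative: "(C1_step has_real_derivative C1_step_deriv x) (at x)"
proof -
  have "((\<lambda>x. a * (max 0 (x - c))^2) has_real_derivative a * (2 * max 0 (x - c))) (at x)" for a c
    using DERIV_chain2[OF has_real_derivative_max_0_squared DERIV_diff[OF DERIV_ident DERIV_const]]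
    by (intro DERIV_cmult) simp
  from DERIV_add[OF DERIV_diff[OF this[of 2 0] this[of 4 "1/2"]] this[of 2 1]] show ?thesis
    unfolding C1_step_def[abs_def] C1_step_deriv_def by simp
qed

lemma continuous_on_C1_step_deriv: "continuous_on S C1_step_deriv"
  unfolding C1_step_deriv_def[abs_def] by (intro continuous_intros)

lemma C1_step_le_0: "x \<le> 0 \<Longrightarrow> C1_step x = 0"
  by (simp add: C1_step_def)

lemma C1_step_ge_1: "x \<ge> 1 \<Longrightarrow> C1_step x = 1"
  by (simp add: C1_step_def power2_eq_square algebra_simps)

lemma C1_step_deriv_outside: "x \<le> 0 \<or> x \<ge> 1 \<Longrightarrow> C1_step_deriv x = 0"
  by (auto simp: C1_step_deriv_def)

lemma continuous_integer_valued_imp_constant: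
  fixes f :: "'a::topological_space \<Rightarrow> real"
  assumes "connected S" "continuous_on S f" "\<And>x. x \<in> S \<Longrightarrow> f x \<in> \<int>"
  shows "f constant_on S"
proof (rule continuous_discrete_range_constant[OF assms(1,2)])
  fix x assume x: "x \<in> S"
  have "1 \<le> norm (f y - f x)" if "y \<in> S" "f y \<noteq> f x" for y
    using Ints_nonzero_abs_ge1[of "f y - f x"] assms(3) x that by simp
  then show "\<exists>e>0. \<forall>y. y \<in> S \<and> f y \<noteq> f x \<longrightarrow> e \<le> norm (f y - f x)"
    by (intro exI[of _ 1]) auto
qed

lemma exp_2pi_i_eq_iff: "exp (\<i> * of_real (2 * pi * a)) = exp (\<i> * of_real (2 * pi * b)) \<longleftrightarrow> a - b \<in> \<int>"
proof -
  have "exp (\<i> * of_real (2 * pi * a)) = exp (\<i> * of_real (2 * pi * b))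
      \<longleftrightarrow> (\<exists>n::int. 2 * pi * a = 2 * pi * b + 2 * pi * of_int n)"
    by (subst exp_eq) (simp add: complex_eq_iff algebra_simps)
  also have "\<dots> \<longleftrightarrow> (\<exists>n::int. 2 * pi * (a - b) = 2 * pi * of_int n)"
    by (simp add: algebra_simps)
  also have "\<dots> \<longleftrightarrow> a - b \<in> \<int>" by (auto elim: Ints_cases)
  finally show ?thesis .
qed

(* exp (2 pi i h) extends by 1 to a circle-valued function on the whole space, which has a logarithm. *)
lemma lift_modulo_integers:
  fixes h :: "'a::real_normed_vector \<Rightarrow> real"
  assumes K: "closed K" and N: "open N" "K \<subseteq> N" and h: "continuous_on N h" "\<And>y. y \<in> N - K \<Longrightarrow> h y \<in> \<int>"
  obtains U where "continuous_on UNIV U" "\<And>y. y \<in> N \<Longrightarrow> U y - h y \<in> \<int>"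
    "\<And>y. y \<notin> K \<Longrightarrow> U y \<in> \<int>"
proof -
  define E where "E y = (if y \<in> N then exp (\<i> * of_real (2 * pi * h y)) else 1)" for y
  have E_int: "E y = 1" if "y \<notin> K" for y
    using exp_2pi_i_eq_iff[of "h y" 0] h(2)[of y] that by (simp add: E_def)
  have "continuous_on N (\<lambda>y. exp (\<i> * of_real (2 * pi * h y)))"
    by (intro continuous_intros h)
  then have "continuous_on N E" by (rule continuous_on_eq) (simp add: E_def)
  moreover have "continuous_on (- K) E"
    by (rule continuous_on_eq[OF continuous_on_const[of _ 1]]) (simp add: E_int)
  ultimately have "continuous_on (N \<union> - K) E"
    using K N by (intro continuous_on_open_Un) auto
  moreover have "N \<union> - K = UNIV" using N by auto
  moreover have "contractible (UNIV :: 'a set)" by (simp add: convex_imp_contractible)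
  moreover have "E y \<noteq> 0" for y by (simp add: E_def)
  ultimately obtain l where l: "continuous_on UNIV l" "\<And>y. E y = exp (l y)"
    by (metis continuous_logarithm_on_contractible UNIV_I)
  define U where "U y = Im (l y) / (2 * pi)" for y
  have E_U: "E y = exp (\<i> * of_real (2 * pi * U y))" for y
  proof -
    have "norm (E y) = 1" by (simp add: E_def)
    then have "Re (l y) = 0" using l(2)[of y] by simp
    then have "l y = \<i> * of_real (2 * pi * U y)" by (simp add: U_def complex_eq_iff)
    then show ?thesis using l(2) by simp
  qed
  show thesis
  proof (rule that)
    show "continuous_on UNIV U" unfolding U_def using l(1) by (intro continuous_intros) auto
    show "U y - h y \<in> \<int>" if "y \<in> N" for y
      using E_U[of y] that exp_2pi_i_eq_iff[of "U y" "h y"] by (simp add: E_def)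
    show "U y \<in> \<int>" if "y \<notin> K" for y
      using E_U[of y] E_int[OF that] exp_2pi_i_eq_iff[of "U y" 0] by simp
  qed
qed

lemma bounded_range_if_integer_valued_off_bounded:
  fixes U :: "'a::euclidean_space \<Rightarrow> real"
  assumes dim: "2 \<le> DIM('a)" and U: "continuous_on UNIV U" and K: "bounded K" "\<And>y. y \<notin> K \<Longrightarrow> U y \<in> \<int>"
  shows "bounded (range U)"
proof -
  have cont: "continuous_on S U" for S by (rule continuous_on_subset[OF U subset_UNIV])
  obtain \<rho> where \<rho>: "K \<subseteq> cball 0 \<rho>" using K(1) by (meson bounded_subset_ballD ball_subset_cball order_trans)
  have "connected (- cball 0 \<rho> :: 'a set)"
    by (rule connected_complement_bounded_convex[OF bounded_cball convex_cball dim])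
  moreover have "U y \<in> \<int>" if "y \<in> - cball 0 \<rho>" for y
    using that K(2) \<rho> by blast
  ultimately have "U constant_on - cball 0 \<rho>"
    by (rule continuous_integer_valued_imp_constant[OF _ cont])
  then obtain c where "\<And>y. y \<in> - cball 0 \<rho> \<Longrightarrow> U y = c"
    unfolding constant_on_def by blast
  then have "U ` (- cball 0 \<rho>) \<subseteq> {c}" by (intro image_subsetI) simp
  then have "bounded (U ` (- cball 0 \<rho>))" by (rule bounded_subset[rotated]) simp
  moreover have "bounded (U ` cball 0 \<rho>)"
    by (rule compact_imp_bounded[OF compact_continuous_image[OF cont compact_cball]])
  ultimately have "bounded (U ` (- cball 0 \<rho> \<union> cball 0 \<rho>))"
    unfolding image_Un bounded_Un by simp
  then show ?thesis by (simp only: Un_commute[of "- cball 0 \<rho>"] Compl_partition)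
qed

section \<open>The collar of an embedded torus\<close>

definition lattice_equiv :: "(real \<times> real) \<times> real \<Rightarrow> (real \<times> real) \<times> real \<Rightarrow> bool" where
  "lattice_equiv z w \<longleftrightarrow> (\<exists>m n :: int. z = w + ((of_int m, of_int n), 0))"

lemma lattice_equivI: "lattice_equiv (w + ((of_int m, of_int n), 0)) w"
  by (auto simp: lattice_equiv_def)

lemma lattice_equiv_sym: "lattice_equiv z w \<Longrightarrow> lattice_equiv w z"
  unfolding lattice_equiv_def
proof (elim exE)
  fix m n assume "z = w + ((of_int m, of_int n), 0)"
  then have "w = z + ((of_int (- m), of_int (- n)), 0)" by (cases w; cases "fst w") simp
  then show "\<exists>m n. w = z + ((of_int m, of_int n), 0)" by blast
qed

lemma lattice_equiv_trans:
  assumes "lattice_equiv x y" "lattice_equiv y z"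
  shows "lattice_equiv x z"
proof -
  obtain m n m' n' where "x = y + ((of_int m, of_int n), 0)" "y = z + ((of_int m', of_int n'), 0)"
    using assms unfolding lattice_equiv_def by blast
  then have "x = z + ((of_int (m + m'), of_int (n + n')), 0)" by (cases z; cases "fst z") simp
  then show ?thesis unfolding lattice_equiv_def by blast
qed

lemma lattice_equiv_frac: "lattice_equiv ((s, t), r) ((frac s, frac t), r)"
  unfolding lattice_equiv_def
  by (intro exI[of _ "\<lfloor>s\<rfloor>"] exI[of _ "\<lfloor>t\<rfloor>"]) (simp add: frac_def)

lemma lattice_equiv_Ints:
  "lattice_equiv ((s, t), r) ((s', t'), r') \<Longrightarrow> s - s' \<in> \<int> \<and> t - t' \<in> \<int> \<and> r = r'"
  by (auto simp: lattice_equiv_def)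

lemma lattice_equiv_snd: "lattice_equiv z w \<Longrightarrow> snd z = snd w"
  by (auto simp: lattice_equiv_def)

lemma lattice_equiv_close:
  assumes "lattice_equiv ((s, t), r) ((s', t'), r')" "\<bar>s - s'\<bar> < 1" "\<bar>t - t'\<bar> < 1"
  shows "((s, t), r) = ((s', t'), r')"
  using lattice_equiv_Ints[OF assms(1)] Ints_nonzero_abs_less1[of "s - s'"]
      Ints_nonzero_abs_less1[of "t - t'"]
    assms(2,3) by simp

locale embedded_torus =
  fixes f :: "real \<times> real \<Rightarrow> real^3"
  assumes embedding: "torus_smooth_embedding f"
begin

abbreviation \<nu> :: "real \<times> real \<Rightarrow> real^3" where "\<nu> \<equiv> unit_normal f"

definition \<Phi> :: "(real \<times> real) \<times> real \<Rightarrow> real^3" where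
  "\<Phi> z = f (fst z) + snd z *\<^sub>R \<nu> (fst z)"

abbreviation "\<Phi>\<^sub>s \<equiv> dir_deriv \<Phi> ((1, 0), 0)"
abbreviation "\<Phi>\<^sub>t \<equiv> dir_deriv \<Phi> ((0, 1), 0)"

lemma shift_eq_\<Phi>: "shift f r x = \<Phi> (x, r)"
  by (simp add: shift_def \<Phi>_def)

lemma f_eq_\<Phi>: "f x = \<Phi> (x, 0)"
  by (simp add: \<Phi>_def)

lemma Ck_differentiable_f: "Ck_differentiable k f"
  using embedding by (simp add: torus_smooth_embedding_def smooth_map_imp_Ck_differentiable)

lemma cross3_tangent_nonzero: "cross3 (d_s f p) (d_t f p) \<noteq> 0"
  using embedding unfolding torus_smooth_embedding_def by blast

lemma Ck_differentiable_\<nu>: "Ck_differentiable k \<nu>"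
proof -
  have "Ck_differentiable k (d_s f)" "Ck_differentiable k (d_t f)"
    using Ck_differentiable_dir_deriv[OF Ck_differentiable_f[of "Suc k"]]
    by (simp_all add: d_s_def[abs_def] d_t_def[abs_def])
  from bounded_bilinear.Ck_differentiable[OF bounded_bilinear_cross3 this] show ?thesis
    unfolding unit_normal_def[abs_def] divide_inverse mult_1
    by (intro bounded_bilinear.Ck_differentiable[OF bounded_bilinear_scaleR] Ck_differentiable_inverse
        Ck_differentiable_norm cross3_tangent_nonzero) (simp_all add: cross3_tangent_nonzero)
qed

lemma Ck_differentiable_\<Phi>: "Ck_differentiable k \<Phi>"
  unfolding \<Phi>_def[abs_def]
  using Ck_differentiable_compose_affine[OF bounded_linear_fst, of k _ 0]
  by (auto intro!: Ck_differentiable_add bounded_bilinear.Ck_differentiable[OF bounded_bilinear_scaleR]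
      bounded_linear.Ck_differentiable[OF bounded_linear_snd] Ck_differentiable_ident
      Ck_differentiable_f Ck_differentiable_\<nu>)

lemma \<Phi>_has_derivative: "(\<Phi> has_derivative frechet_derivative \<Phi> (at z)) (at z)"
  by (rule Ck_differentiable_has_derivative[OF Ck_differentiable_\<Phi>])

lemma linear_\<Phi>_derivative: "linear (frechet_derivative \<Phi> (at z))"
  by (rule has_derivative_linear[OF \<Phi>_has_derivative])

lemma continuous_on_\<Phi>: "continuous_on S g \<Longrightarrow> continuous_on S (\<lambda>x. \<Phi> (g x))"
  by (rule Ck_differentiable_continuous_on_compose[OF Ck_differentiable_\<Phi>])

lemma continuous_on_dir_deriv_\<Phi>: "continuous_on S g \<Longrightarrow> continuous_on S (\<lambda>x. dir_deriv \<Phi> h (g x))"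
  by (rule Ck_differentiable_continuous_on_compose[OF Ck_differentiable_dir_deriv[OF Ck_differentiable_\<Phi>]])

lemma continuous_on_\<nu>: "continuous_on S g \<Longrightarrow> continuous_on S (\<lambda>x. \<nu> (g x))"
  by (rule Ck_differentiable_continuous_on_compose[OF Ck_differentiable_\<nu>])

lemma torus_periodic_f: "torus_periodic f"
  using embedding by (simp add: torus_smooth_embedding_def)

lemma torus_periodic_\<nu>: "torus_periodic \<nu>"
proof -
  have "f (x + (1, 0)) = f x" "f (x + (0, 1)) = f x" for x
    using torus_periodic_f by (cases x; simp add: torus_periodic_def)+
  then have "frechet_derivative f (at (x + (1, 0))) = frechet_derivative f (at x)"
    "frechet_derivative f (at (x + (0, 1))) = frechet_derivative f (at x)" for x
    by (simp_all add: frechet_derivative_periodic)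
  from this[of "(s, t)" for s t] show ?thesis
    by (simp add: torus_periodic_def unit_normal_def d_s_def d_t_def)
qed

lemma torus_periodic_\<Phi>: "torus_periodic (\<lambda>x. \<Phi> (x, r))"
  using torus_periodic_f torus_periodic_\<nu> by (simp add: torus_periodic_def \<Phi>_def)

lemma \<Phi>_lattice: "\<Phi> (z + ((of_int m, of_int n), 0)) = \<Phi> z"
  using torus_periodic_int[OF torus_periodic_\<Phi>[of "snd z"], of "fst z" m n] by (cases z) simp

lemma lattice_equiv_\<Phi>:
  assumes "lattice_equiv z w"
  shows "\<Phi> z = \<Phi> w" "frechet_derivative \<Phi> (at z) = frechet_derivative \<Phi> (at w)"
proof -
  obtain m n :: int where z: "z = w + ((of_int m, of_int n), 0)"
    using assms unfolding lattice_equiv_def by blast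
  show "\<Phi> z = \<Phi> w" unfolding z by (rule \<Phi>_lattice)
  show "frechet_derivative \<Phi> (at z) = frechet_derivative \<Phi> (at w)"
    unfolding z by (rule frechet_derivative_periodic) (rule \<Phi>_lattice)
qed

lemma norm_\<nu>: "norm (\<nu> x) = 1"
  using cross3_tangent_nonzero by (simp add: unit_normal_def)

lemma \<nu>_inner_self: "\<nu> x \<bullet> \<nu> x = 1"
  by (simp add: dot_square_norm norm_\<nu>)

lemma dir_deriv_\<Phi>:
  "dir_deriv \<Phi> h (x, r) = dir_deriv f (fst h) x + r *\<^sub>R dir_deriv \<nu> (fst h) x + snd h *\<^sub>R \<nu> x"
proof -
  have fst: "(fst has_derivative fst) (at (x, r))" for x :: "real \<times> real" and r :: real
    by (auto intro!: derivative_eq_intros)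
  have "((\<lambda>z. f (fst z)) has_derivative (\<lambda>h. dir_deriv f (fst h) x)) (at (x, r))"
    by (rule has_derivative_compose[OF fst]) (simp add:
        Ck_differentiable_has_derivative[OF Ck_differentiable_f])
  moreover have \<nu>_deriv: "((\<lambda>z. \<nu> (fst z)) has_derivative (\<lambda>h. dir_deriv \<nu> (fst h) x)) (at (x, r))"
    by (rule has_derivative_compose[OF fst]) (simp add:
        Ck_differentiable_has_derivative[OF Ck_differentiable_\<nu>])
  have "((\<lambda>z. snd z *\<^sub>R \<nu> (fst z)) has_derivative
      (\<lambda>h. snd (x, r) *\<^sub>R dir_deriv \<nu> (fst h) x + snd h *\<^sub>R \<nu> (fst (x, r)))) (at (x, r))"
    by (rule has_derivative_scaleR[OF _ \<nu>_deriv]) (auto intro!: derivative_eq_intros)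
  ultimately have "(\<Phi> has_derivative (\<lambda>h. dir_deriv f (fst h) x
      + (snd (x, r) *\<^sub>R dir_deriv \<nu> (fst h) x + snd h *\<^sub>R \<nu> (fst (x, r))))) (at (x, r))"
    unfolding \<Phi>_def[abs_def] by (rule has_derivative_add)
  from has_derivative_unique[OF \<Phi>_has_derivative this] show ?thesis
    by (simp add: add.assoc)
qed

lemma dir_deriv_\<Phi>_normal: "dir_deriv \<Phi> ((0, 0), 1) z = \<nu> (fst z)"
  using dir_deriv_\<Phi>[of "fst z" "snd z" "((0, 0), 1)"]
    linear_0[OF has_derivative_linear[OF Ck_differentiable_has_derivative[OF Ck_differentiable_f]],
        of "fst z"]
    linear_0[OF has_derivative_linear[OF Ck_differentiable_has_derivative[OF Ck_differentiable_\<nu>]],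
        of "fst z"]
  by (simp add: zero_prod_def)

lemma lattice_equiv_\<nu>: "lattice_equiv z w \<Longrightarrow> \<nu> (fst z) = \<nu> (fst w)"
  using dir_deriv_\<Phi>_normal[of z] dir_deriv_\<Phi>_normal[of w] by (simp add: lattice_equiv_\<Phi>)

lemma \<nu>_inner_level_tangent: "\<nu> (fst z) \<bullet> dir_deriv \<Phi> (h, 0) z = 0"
proof -
  obtain x r a b where z: "z = (x, r)" and h: "h = (a, b)" by (cases z; cases h)
  have lin: "linear (frechet_derivative f (at x))"
    using has_derivative_linear[OF Ck_differentiable_has_derivative[OF Ck_differentiable_f]] .
  have "dir_deriv f (a, b) x = dir_deriv f (a *\<^sub>R (1, 0) + b *\<^sub>R (0, 1)) x" by simp
  also have "\<dots> = a *\<^sub>R d_s f x + b *\<^sub>R d_t f x"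
    by (simp only: linear_add[OF lin] linear_cmul[OF lin] d_s_def d_t_def)
  finally have "\<nu> x \<bullet> dir_deriv f (a, b) x = 0"
    by (simp add: unit_normal_def inner_add_right dot_cross_self)
  moreover have "\<nu> x \<bullet> dir_deriv \<nu> (a, b) x = 0"
  proof -
    note \<nu>_deriv = Ck_differentiable_has_derivative[OF Ck_differentiable_\<nu>, of x]
    have "((\<lambda>x. 1::real) has_derivative (\<lambda>h. \<nu> x \<bullet> dir_deriv \<nu> h x + dir_deriv \<nu> h x \<bullet> \<nu> x)) (at x)"
      using has_derivative_inner[OF \<nu>_deriv \<nu>_deriv] by (simp only: \<nu>_inner_self)
    from has_derivative_unique[OF this has_derivative_const] show ?thesis
      by (simp add: inner_commute fun_eq_iff)
  qed
  ultimately show ?thesis by (simp add: z h dir_deriv_\<Phi> inner_add_right)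
qed

lemma dir_deriv_\<Phi>_split: "dir_deriv \<Phi> ((a, b), c) z = a *\<^sub>R \<Phi>\<^sub>s z + b *\<^sub>R \<Phi>\<^sub>t z + c *\<^sub>R \<nu> (fst z)"
proof -
  have "dir_deriv \<Phi> ((a, b), c) z = dir_deriv \<Phi> (a *\<^sub>R ((1, 0), 0) + b *\<^sub>R ((0, 1), 0) + c *\<^sub>R ((0, 0), 1)) z"
    by simp
  then show ?thesis
    by (simp only: linear_add[OF linear_\<Phi>_derivative] linear_cmul[OF linear_\<Phi>_derivative] dir_deriv_\<Phi>_normal)
qed

definition Jac :: "(real \<times> real) \<times> real \<Rightarrow> real" where
  "Jac z = cross3 (\<Phi>\<^sub>s z) (\<Phi>\<^sub>t z) \<bullet> \<nu> (fst z)"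

lemma Jac_scaleR_\<nu>: "Jac z *\<^sub>R \<nu> (fst z) = cross3 (\<Phi>\<^sub>s z) (\<Phi>\<^sub>t z)"
proof -
  let ?c = "cross3 (\<Phi>\<^sub>s z) (\<Phi>\<^sub>t z)"
  have "cross3 (\<nu> (fst z)) ?c = 0"
    by (simp add: Lagrange \<nu>_inner_level_tangent)
  moreover have "cross3 (\<nu> (fst z)) (cross3 (\<nu> (fst z)) ?c)
      = (\<nu> (fst z) \<bullet> ?c) *\<^sub>R \<nu> (fst z) - (\<nu> (fst z) \<bullet> \<nu> (fst z)) *\<^sub>R ?c"
    by (rule Lagrange)
  ultimately show ?thesis
    by (simp add: \<nu>_inner_self Jac_def inner_commute)
qed

lemma continuous_on_Jac:
  fixes g :: "'a::t2_space \<Rightarrow> (real \<times> real) \<times> real"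
  shows "continuous_on S g \<Longrightarrow> continuous_on S (\<lambda>x. Jac (g x))"
  unfolding Jac_def
  by (intro continuous_on_inner continuous_on_cross continuous_on_dir_deriv_\<Phi> continuous_on_\<nu>
      continuous_on_fst)

lemma lattice_equiv_Jac: "lattice_equiv z w \<Longrightarrow> Jac z = Jac w"
  by (simp add: Jac_def lattice_equiv_\<Phi> lattice_equiv_\<nu>)

lemma Jac_level_0_pos: "Jac (x, 0) > 0"
  using cross3_tangent_nonzero[of x]
  by (simp add: Jac_def dir_deriv_\<Phi> unit_normal_def power2_norm_eq_inner[symmetric] flip: d_s_def d_t_def)

definition \<Phi>_inverse_deriv :: "(real \<times> real) \<times> real \<Rightarrow> real^3 \<Rightarrow> (real \<times> real) \<times> real" where
  "\<Phi>_inverse_deriv z h =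
    ((h \<bullet> cross3 (\<Phi>\<^sub>t z) (\<nu> (fst z)) / Jac z, h \<bullet> cross3 (\<nu> (fst z)) (\<Phi>\<^sub>s z) / Jac z), h \<bullet> \<nu> (fst z))"

lemma bounded_linear_\<Phi>_inverse_deriv: "bounded_linear (\<Phi>_inverse_deriv z)"
proof -
  have "linear (\<Phi>_inverse_deriv z)"
    by (rule linearI) (auto simp: \<Phi>_inverse_deriv_def inner_add_left add_divide_distrib)
  then show ?thesis using linear_conv_bounded_linear by blast
qed

lemma \<Phi>_inverse_deriv_left_inverse:
  assumes "Jac z \<noteq> 0"
  shows "\<Phi>_inverse_deriv z \<circ> frechet_derivative \<Phi> (at z) = id"
proof
  fix h :: "(real \<times> real) \<times> real"
  obtain a b c where h: "h = ((a, b), c)" by (metis surj_pair)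
  have orth: "\<Phi>\<^sub>s z \<bullet> \<nu> (fst z) = 0" "\<Phi>\<^sub>t z \<bullet> \<nu> (fst z) = 0"
    using \<nu>_inner_level_tangent by (simp_all add: inner_commute)
  have triple: "\<Phi>\<^sub>s z \<bullet> cross3 (\<Phi>\<^sub>t z) (\<nu> (fst z)) = Jac z" "\<Phi>\<^sub>t z \<bullet> cross3 (\<nu> (fst z)) (\<Phi>\<^sub>s z) = Jac z"
    unfolding Jac_def by (simp_all add: cross3_def inner_vec_def sum_3 vector_3 algebra_simps)
  have "\<Phi>_inverse_deriv z (dir_deriv \<Phi> h z) = ((a, b), c)"
    using assms unfolding \<Phi>_inverse_deriv_def h
    by (simp add: dir_deriv_\<Phi>_split[of z a b c] inner_add_left triple orth \<nu>_inner_self dot_cross_self)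
  then show "(\<Phi>_inverse_deriv z \<circ> frechet_derivative \<Phi> (at z)) h = id h" using h by simp
qed

lemma \<Phi>_locally_injective:
  obtains \<rho> where "\<rho> > 0" "inj_on \<Phi> (ball (x, 0) \<rho>)"
proof -
  let ?D = "\<lambda>z. frechet_derivative \<Phi> (at z)"
  have bl: "bounded_linear (?D z)" for z using has_derivative_bounded_linear[OF \<Phi>_has_derivative] .
  have "continuous_on UNIV (\<lambda>z. Blinfun (?D z))"
    by (rule continuous_on_blinfun_componentwise)
      (auto simp: bounded_linear_Blinfun_apply[OF bl] intro!: continuous_on_dir_deriv_\<Phi> continuous_intros)
  then have cont: "\<exists>d>0. \<forall>z. dist z (x, 0) < d \<longrightarrow> dist (Blinfun (?D z)) (Blinfun (?D (x, 0))) < e"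
    if "e > 0" for e using that unfolding continuous_on_iff by (metis UNIV_I)
  have "onorm (\<lambda>v. ?D z v - ?D (x, 0) v) = dist (Blinfun (?D z)) (Blinfun (?D (x, 0)))" for z
    by (simp add: dist_norm norm_blinfun.rep_eq minus_blinfun.rep_eq bounded_linear_Blinfun_apply[OF bl])
  then have cont_onorm: "\<exists>d>0. \<forall>z. dist (x, 0) z < d \<longrightarrow> onorm (\<lambda>v. ?D z v - ?D (x, 0) v) < e"
    if "e > 0" for e using cont[OF that] by (simp add: dist_commute)
  have left_inverse: "\<Phi>_inverse_deriv (x, 0) \<circ> ?D (x, 0) = id"
    using \<Phi>_inverse_deriv_left_inverse Jac_level_0_pos[of x] by simp
  show thesis
    by (rule has_derivative_locally_injective[of "(x, 0)" UNIV "\<Phi>_inverse_deriv (x, 0)" ?D \<Phi>])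
      (use that left_inverse cont_onorm bounded_linear_\<Phi>_inverse_deriv \<Phi>_has_derivative in auto)
qed

abbreviation fundamental_domain :: "((real \<times> real) \<times> real) set" where
  "fundamental_domain \<equiv> ({0..1} \<times> {0..1}) \<times> {0}"

lemma Jac_pos_near: "\<exists>\<delta>>0. \<forall>z. \<bar>snd z\<bar> < \<delta> \<longrightarrow> Jac z > 0"
proof -
  let ?U = "{z. Jac z > 0}"
  have "open ?U"
    using continuous_on_Jac[OF continuous_on_id] by (intro open_Collect_less continuous_on_const) simp
  moreover have "compact fundamental_domain" by (intro compact_Times) auto
  moreover have "fundamental_domain \<subseteq> ?U" "fundamental_domain \<noteq> {}" using Jac_level_0_pos by auto
  ultimately obtain e where e: "e > 0" "{x. infdist x fundamental_domain \<le> e} \<subseteq> ?U"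
    using compact_in_open_separated by metis
  have "Jac z > 0" if "\<bar>snd z\<bar> < e" for z
  proof -
    obtain s t r where z: "z = ((s, t), r)" by (metis surj_pair)
    have "infdist ((frac s, frac t), r) fundamental_domain \<le> dist ((frac s, frac t), r) ((frac s, frac t), 0)"
      by (rule infdist_le) (auto simp: frac_lt_1 less_imp_le)
    also have "\<dots> \<le> e" using that z by (simp add: dist_Pair_Pair)
    finally have "Jac ((frac s, frac t), r) > 0" using e by auto
    then show ?thesis unfolding z using lattice_equiv_Jac[OF lattice_equiv_frac[of s t r]] by simp
  qed
  then show ?thesis using e by blast
qed

definition collisions :: "(((real \<times> real) \<times> real) \<times> ((real \<times> real) \<times> real)) set" where
  "collisions = {(z, w). \<Phi> z = \<Phi> w \<and> \<not> lattice_equiv z w}"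

lemma level_0_not_in_closure_collisions: "((x, 0), (y, 0)) \<notin> closure collisions"
proof (cases "f x = f y")
  case False
  let ?U = "{(z, w). \<Phi> z \<noteq> \<Phi> w}"
  have "open ?U"
    unfolding case_prod_beta
    by (intro open_Collect_neq continuous_on_\<Phi> continuous_on_fst continuous_on_snd continuous_on_id)
  moreover have "((x, 0), (y, 0)) \<in> ?U" using False by (simp add: \<Phi>_def)
  moreover have "?U \<inter> collisions = {}" by (auto simp: collisions_def)
  ultimately show ?thesis using open_Int_closure_eq_empty[of ?U collisions] by blast
next
  case True
  then have "fst x - fst y \<in> \<int> \<and> snd x - snd y \<in> \<int>"
    using embedding unfolding torus_smooth_embedding_def by (metis prod.collapse)
  then obtain m n :: int where "fst x - fst y = of_int m" "snd x - snd y = of_int n"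
      by (auto elim!: Ints_cases)
  then have x: "(x, 0 :: real) = (y, 0) + ((of_int m, of_int n), 0)" 
    by (auto simp: prod_eq_iff)
  obtain \<rho> where \<rho>: "\<rho> > 0" "inj_on \<Phi> (ball (x, 0) \<rho>)" by (rule \<Phi>_locally_injective)
  let ?U = "ball (x, 0 :: real) \<rho> \<times> ball (y, 0 :: real) \<rho>"
  have "lattice_equiv z w" if "(z, w) \<in> ?U" "\<Phi> z = \<Phi> w" for z w
  proof -
    let ?w = "w + ((of_int m, of_int n), 0)"
    have "dist (x, 0) ?w = dist (y, 0) w" unfolding x by (simp only: dist_add_cancel2)
    then have "z = ?w" using \<rho>(2) that by (auto simp: inj_on_def \<Phi>_lattice)
    then show ?thesis using lattice_equivI by simp
  qed
  then have "?U \<inter> collisions = {}" by (auto simp: collisions_def)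
  moreover have "open ?U" "((x, 0), (y, 0)) \<in> ?U" using \<rho>(1) by (auto intro: open_Times)
  ultimately show ?thesis using open_Int_closure_eq_empty[of ?U collisions] by blast
qed

lemma \<Phi>_injective_near:
  "\<exists>\<delta>>0. \<forall>z w. \<bar>snd z\<bar> < \<delta> \<and> \<bar>snd w\<bar> < \<delta> \<and> \<Phi> z = \<Phi> w \<longrightarrow> lattice_equiv z w"
proof -
  let ?K = "fundamental_domain \<times> fundamental_domain"
  have "compact ?K" by (intro compact_Times) auto
  moreover have "open (- closure collisions)" by (simp only: open_Compl closed_closure)
  moreover have "?K \<subseteq> - closure collisions" "?K \<noteq> {}" using level_0_not_in_closure_collisions by auto
  ultimately obtain e where e: "e > 0" "{p. infdist p ?K \<le> e} \<subseteq> - closure collisions"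
    using compact_in_open_separated by metis
  have "lattice_equiv z w" if zw: "\<bar>snd z\<bar> < e / 2" "\<bar>snd w\<bar> < e / 2" "\<Phi> z = \<Phi> w" for z w
  proof -
    obtain s t r s' t' r' where z: "z = ((s, t), r)" and w: "w = ((s', t'), r')" by (metis surj_pair)
    let ?z = "((frac s, frac t), r)" and ?w = "((frac s', frac t'), r')"
    have "infdist (?z, ?w) ?K \<le> dist (?z, ?w) (((frac s, frac t), 0), ((frac s', frac t'), 0))"
      by (rule infdist_le) (auto simp: frac_lt_1 less_imp_le)
    also have "\<dots> \<le> \<bar>r\<bar> + \<bar>r'\<bar>" by (simp add: dist_Pair_Pair sqrt_sum_squares_le_sum_abs)
    also have "\<dots> \<le> e" using zw(1,2) by (simp add: z w)
    finally have "(?z, ?w) \<notin> collisions" using e(2) closure_subset by blast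
    moreover have "\<Phi> ?z = \<Phi> ?w"
      using zw(3) lattice_equiv_\<Phi>(1)[OF lattice_equiv_frac, of s t r]
        lattice_equiv_\<Phi>(1)[OF lattice_equiv_frac, of s' t' r'] by (simp only: z w)
    ultimately have "lattice_equiv ?z ?w" by (simp add: collisions_def)
    then show ?thesis
      unfolding z w
      by (rule lattice_equiv_trans[OF lattice_equiv_frac
          lattice_equiv_trans[OF _ lattice_equiv_sym[OF lattice_equiv_frac]]])
  qed
  then show ?thesis using e(1) by (intro exI[of _ "e / 2"]) auto
qed

definition tube :: "real \<Rightarrow> bool" where
  "tube \<delta> \<longleftrightarrow> \<delta> > 0 \<and> (\<forall>z. \<bar>snd z\<bar> < \<delta> \<longrightarrow> Jac z > 0) \<and>
    (\<forall>z w. \<bar>snd z\<bar> < \<delta> \<and> \<bar>snd w\<bar> < \<delta> \<and> \<Phi> z = \<Phi> w \<longrightarrow> lattice_equiv z w)"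

lemma tube_exists: "\<exists>\<delta>. tube \<delta>"
proof -
  obtain \<delta>1 where "\<delta>1 > 0" "\<forall>z. \<bar>snd z\<bar> < \<delta>1 \<longrightarrow> Jac z > 0"
    using Jac_pos_near by blast
  moreover obtain \<delta>2 where "\<delta>2 > 0"
    "\<forall>z w. \<bar>snd z\<bar> < \<delta>2 \<and> \<bar>snd w\<bar> < \<delta>2 \<and> \<Phi> z = \<Phi> w \<longrightarrow> lattice_equiv z w"
    using \<Phi>_injective_near by blast
  ultimately have "tube (min \<delta>1 \<delta>2)" by (simp add: tube_def)
  then show ?thesis by blast
qed

end

locale torus_collar = embedded_torus +
  fixes \<delta> :: real
  assumes tube: "tube \<delta>"
begin

lemma \<delta>_pos: "\<delta> > 0"
  and Jac_pos: "\<bar>snd z\<bar> < \<delta> \<Longrightarrow> Jac z > 0"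
  and \<Phi>_inj: "\<bar>snd z\<bar> < \<delta> \<Longrightarrow> \<bar>snd w\<bar> < \<delta> \<Longrightarrow> \<Phi> z = \<Phi> w \<Longrightarrow> lattice_equiv z w"
  using tube unfolding tube_def by blast+

definition slab :: "((real \<times> real) \<times> real) set" where
  "slab = UNIV \<times> {-\<delta><..<\<delta>}"

lemma mem_slab: "z \<in> slab \<longleftrightarrow> \<bar>snd z\<bar> < \<delta>"
  by (auto simp: slab_def mem_Times_iff)

lemma open_slab: "open slab"
  unfolding slab_def by (intro open_Times open_UNIV open_greaterThanLessThan)

lemma \<Phi>_chart:
  assumes "z \<in> slab"
  obtains V where "open V" "z \<in> V" "V \<subseteq> slab" "inj_on \<Phi> V"
proof -
  obtain s t r where z: "z = ((s, t), r)" by (metis surj_pair)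
  let ?V = "({s - 1/2 <..< s + 1/2} \<times> {t - 1/2 <..< t + 1/2}) \<times> {-\<delta><..<\<delta>}"
  have "inj_on \<Phi> ?V"
  proof (rule inj_onI)
    fix x y assume xy: "x \<in> ?V" "y \<in> ?V" "\<Phi> x = \<Phi> y"
    obtain s1 t1 r1 s2 t2 r2 where x: "x = ((s1, t1), r1)" and y: "y = ((s2, t2), r2)" by (metis surj_pair)
    have "lattice_equiv x y" using xy by (intro \<Phi>_inj) (auto simp: x y)
    moreover have "\<bar>s1 - s2\<bar> < 1" "\<bar>t1 - t2\<bar> < 1" using xy(1,2) by (simp_all add: x y abs_less_iff)
    ultimately show "x = y" unfolding x y by (rule lattice_equiv_close)
  qed
  moreover have "open ?V" by (intro open_Times open_greaterThanLessThan)
  moreover have "z \<in> ?V" "?V \<subseteq> slab" using assms by (auto simp: z slab_def)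
  ultimately show thesis using that by blast
qed

lemma open_\<Phi>_image_inj:
  assumes "open V" "inj_on \<Phi> V"
  shows "open (\<Phi> ` V)"
  using continuous_on_\<Phi>[OF continuous_on_id] assms by (intro invariance_of_domain_gen) simp_all

lemma open_\<Phi>_image:
  assumes W: "open W" "W \<subseteq> slab"
  shows "open (\<Phi> ` W)"
proof (subst open_subopen, intro ballI)
  fix y assume "y \<in> \<Phi> ` W"
  then obtain z where z: "z \<in> W" "y = \<Phi> z" by blast
  have "z \<in> slab" using z W(2) by blast
  then obtain V where V: "open V" "z \<in> V" "V \<subseteq> slab" "inj_on \<Phi> V" by (rule \<Phi>_chart)
  have "open (\<Phi> ` (V \<inter> W))"
    by (intro open_\<Phi>_image_inj open_Int V(1) W(1) inj_on_subset[OF V(4)] Int_lower1)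
  then show "\<exists>T. open T \<and> y \<in> T \<and> T \<subseteq> \<Phi> ` W" using V(2) z by blast
qed

definition nbhd :: "(real^3) set" where
  "nbhd = \<Phi> ` slab"

lemma open_nbhd: "open nbhd"
  unfolding nbhd_def by (rule open_\<Phi>_image[OF open_slab order.refl])

(* An open continuous surjection is a quotient map. *)
lemma continuous_on_nbhdI:
  fixes g :: "real^3 \<Rightarrow> 'a::topological_space"
  assumes "continuous_on slab (\<lambda>z. g (\<Phi> z))"
  shows "continuous_on nbhd g"
  unfolding continuous_on_open_vimage[OF open_nbhd]
proof (intro allI impI)
  fix B :: "'a set" assume "open B"
  then have "open ((\<lambda>z. g (\<Phi> z)) -` B \<inter> slab)"
    using assms continuous_on_open_vimage[OF open_slab] by blast
  then have "open (\<Phi> ` ((\<lambda>z. g (\<Phi> z)) -` B \<inter> slab))" by (intro open_\<Phi>_image) auto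
  moreover have "\<Phi> ` ((\<lambda>z. g (\<Phi> z)) -` B \<inter> slab) = g -` B \<inter> nbhd" by (auto simp: nbhd_def)
  ultimately show "open (g -` B \<inter> nbhd)" by simp
qed

definition coords :: "real^3 \<Rightarrow> (real \<times> real) \<times> real" where
  "coords = inv_into slab \<Phi>"

definition height :: "real^3 \<Rightarrow> real" where
  "height y = snd (coords y)"

lemma lattice_equiv_coords:
  assumes "z \<in> slab"
  shows "lattice_equiv (coords (\<Phi> z)) z"
proof -
  have "coords (\<Phi> z) \<in> slab" "\<Phi> (coords (\<Phi> z)) = \<Phi> z"
    unfolding coords_def using assms by (auto intro: inv_into_into f_inv_into_f)
  then show ?thesis using assms by (intro \<Phi>_inj) (simp_all add: mem_slab)
qed

lemma height_\<Phi>: "z \<in> slab \<Longrightarrow> height (\<Phi> z) = snd z"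
  unfolding height_def by (rule lattice_equiv_snd[OF lattice_equiv_coords])

lemma \<nu>_coords: "z \<in> slab \<Longrightarrow> \<nu> (fst (coords (\<Phi> z))) = \<nu> (fst z)"
  by (rule lattice_equiv_\<nu>[OF lattice_equiv_coords])

lemma continuous_on_height: "continuous_on nbhd height"
proof (rule continuous_on_nbhdI)
  have "continuous_on slab snd" by (intro continuous_intros)
  then show "continuous_on slab (\<lambda>z. height (\<Phi> z))"
    by (rule continuous_on_eq) (simp add: height_\<Phi>)
qed

lemma height_has_derivative:
  assumes z: "z \<in> slab"
  shows "(height has_derivative (\<lambda>h. \<nu> (fst z) \<bullet> h)) (at (\<Phi> z))"
proof -
  obtain V where V: "open V" "z \<in> V" "V \<subseteq> slab" "inj_on \<Phi> V" by (rule \<Phi>_chart[OF z])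
  let ?\<psi> = "inv_into V \<Phi>"
  have \<psi>: "?\<psi> (\<Phi> w) = w" if "w \<in> V" for w using V(4) that by (rule inv_into_f_f)
  have open_image: "open (\<Phi> ` V)" by (rule open_\<Phi>_image_inj[OF V(1,4)])
  have "continuous_on (\<Phi> ` V) ?\<psi>"
    using continuous_on_\<Phi>[OF continuous_on_id] \<psi> by (intro continuous_on_inverse_open[OF V(1)]) simp_all
  then have "continuous (at (\<Phi> z)) ?\<psi>"
    using V(2) continuous_on_eq_continuous_at[OF open_image] by blast
  then have "(?\<psi> has_derivative \<Phi>_inverse_deriv z) (at (\<Phi> z))"
  proof (rule has_derivative_inverse_basic[rotated 3])
    show "(\<Phi> has_derivative frechet_derivative \<Phi> (at z)) (at (?\<psi> (\<Phi> z)))"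
      unfolding \<psi>[OF V(2)] by (rule \<Phi>_has_derivative)
    show "\<Phi>_inverse_deriv z \<circ> frechet_derivative \<Phi> (at z) = id"
      using Jac_pos[of z] z by (intro \<Phi>_inverse_deriv_left_inverse) (simp add: mem_slab)
  qed (use V(2) open_image in \<open>auto simp: bounded_linear_\<Phi>_inverse_deriv f_inv_into_f\<close>)
  then have "((\<lambda>y. snd (?\<psi> y)) has_derivative (\<lambda>h. \<nu> (fst z) \<bullet> h)) (at (\<Phi> z))"
    using has_derivative_snd by (fastforce simp: \<Phi>_inverse_deriv_def inner_commute)
  then show ?thesis
    by (rule has_derivative_transform_within_open[OF _ open_image])
      (use V height_\<Phi> \<psi> in auto)
qed

lemma compact_\<Phi>_image: "compact (\<Phi> ` (UNIV \<times> {a..b}))"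
proof -
  let ?Q = "({0..1} \<times> {0..1}) \<times> {a..b}"
  have "\<Phi> ((s, t), r) \<in> \<Phi> ` ?Q" if "r \<in> {a..b}" for s t r
    unfolding lattice_equiv_\<Phi>(1)[OF lattice_equiv_frac[of s t r]]
    by (intro imageI) (use that in \<open>auto simp: frac_lt_1 less_imp_le\<close>)
  then have "\<Phi> ` (UNIV \<times> {a..b}) = \<Phi> ` ?Q" by auto
  moreover have "compact (\<Phi> ` ?Q)"
    using continuous_on_\<Phi>[OF continuous_on_id]
    by (intro compact_continuous_image compact_Times compact_Icc) simp
  ultimately show ?thesis by simp
qed

section \<open>The jump function of the torus\<close>

definition core :: "(real^3) set" where
  "core = \<Phi> ` (UNIV \<times> {-\<delta>/2..0})"

lemma compact_core: "compact core"
  unfolding core_def by (rule compact_\<Phi>_image)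

lemma core_subset_nbhd: "core \<subseteq> nbhd"
  unfolding core_def nbhd_def slab_def using \<delta>_pos by (intro image_mono) auto

lemma height_off_core:
  assumes "y \<in> nbhd" "y \<notin> core"
  shows "height y < -\<delta>/2 \<or> 0 < height y"
proof -
  obtain z where z: "z \<in> slab" "y = \<Phi> z" using assms(1) by (auto simp: nbhd_def)
  then have "z \<notin> UNIV \<times> {-\<delta>/2..0}" using assms(2) unfolding core_def by blast
  then show ?thesis using z by (auto simp: height_\<Phi> mem_Times_iff)
qed

definition cutoff :: "real \<Rightarrow> real" where
  "cutoff r = C1_step (1 + 2 * r / \<delta>)"

definition cutoff_deriv :: "real \<Rightarrow> real" where
  "cutoff_deriv r = C1_step_deriv (1 + 2 * r / \<delta>) * (2 / \<delta>)"

lemma cutoff_has_real_derivative: "(cutoff has_real_derivative cutoff_deriv r) (at r within S)"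
proof -
  have "((\<lambda>r. 1 + 2 * r / \<delta>) has_real_derivative 2 / \<delta>) (at r)"
    using \<delta>_pos by (auto intro!: derivative_eq_intros)
  from DERIV_chain2[OF C1_step_has_real_derivative this] show ?thesis
    unfolding cutoff_def[abs_def] cutoff_deriv_def by (rule DERIV_subset) simp
qed

lemma continuous_on_cutoff: "continuous_on S g \<Longrightarrow> continuous_on S (\<lambda>x. cutoff (g x))"
  by (rule continuous_on_compose2[OF DERIV_continuous_on[OF cutoff_has_real_derivative, of UNIV]]) auto

lemma continuous_on_cutoff_deriv: "continuous_on S g \<Longrightarrow> continuous_on S (\<lambda>x. cutoff_deriv (g x))"
  unfolding cutoff_deriv_def
  by (intro continuous_intros continuous_on_compose2[OF continuous_on_C1_step_deriv[of UNIV]])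
      (use \<delta>_pos in auto)

lemma cutoff_below: "r \<le> -\<delta>/2 \<Longrightarrow> cutoff r = 0"
  using \<delta>_pos by (simp add: cutoff_def C1_step_le_0 field_simps)

lemma cutoff_above: "0 \<le> r \<Longrightarrow> cutoff r = 1"
  using \<delta>_pos by (simp add: cutoff_def C1_step_ge_1)

lemma cutoff_deriv_outside: "r \<le> -\<delta>/2 \<or> 0 \<le> r \<Longrightarrow> cutoff_deriv r = 0"
  using \<delta>_pos by (auto simp: cutoff_deriv_def field_simps intro!: C1_step_deriv_outside)

definition jump_gradient :: "real^3 \<Rightarrow> real^3" where
  "jump_gradient y = (if y \<in> nbhd then cutoff_deriv (height y) *\<^sub>R \<nu> (fst (coords y)) else 0)"

lemma jump_gradient_\<Phi>: "z \<in> slab \<Longrightarrow> jump_gradient (\<Phi> z) = cutoff_deriv (snd z) *\<^sub>R \<nu> (fst z)"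
  by (auto simp: jump_gradient_def nbhd_def height_\<Phi> \<nu>_coords)

lemma jump_gradient_off_core: "y \<notin> core \<Longrightarrow> jump_gradient y = 0"
  using height_off_core[of y] cutoff_deriv_outside[of "height y"] by (auto simp: jump_gradient_def)

lemma continuous_on_nbhd_core:
  assumes "continuous_on nbhd g" "continuous_on (- core) g"
  shows "continuous_on UNIV g"
proof -
  have "continuous_on (nbhd \<union> - core) g"
    using assms open_nbhd compact_imp_closed[OF compact_core] by (intro continuous_on_open_Un) auto
  moreover have "nbhd \<union> - core = UNIV" using core_subset_nbhd by blast
  ultimately show ?thesis by simp
qed

lemma continuous_on_jump_gradient: "continuous_on UNIV jump_gradient"
proof (rule continuous_on_nbhd_core)
  have "continuous_on slab (\<lambda>z. cutoff_deriv (snd z) *\<^sub>R \<nu> (fst z))"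
    by (intro continuous_intros continuous_on_cutoff_deriv continuous_on_\<nu>)
  then have "continuous_on slab (\<lambda>z. jump_gradient (\<Phi> z))"
    by (rule continuous_on_eq) (simp add: jump_gradient_\<Phi>)
  then show "continuous_on nbhd jump_gradient" by (rule continuous_on_nbhdI)
  show "continuous_on (- core) jump_gradient"
    by (rule continuous_on_eq[OF continuous_on_const[of _ 0]]) (simp add: jump_gradient_off_core)
qed

(* Modulo integers the cutoff extends by 0 to the whole space; U is a lift. *)
lemma jump_function_exists:
  obtains U where "continuous_on UNIV U" "\<And>z. z \<in> slab \<Longrightarrow> U (\<Phi> z) = cutoff (snd z) - 1"
    "\<And>y. y \<notin> core \<Longrightarrow> U y \<in> \<int>"
proof -
  have "continuous_on nbhd (\<lambda>y. cutoff (height y))"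
    by (rule continuous_on_cutoff[OF continuous_on_height])
  moreover have "cutoff (height y) \<in> \<int>" if "y \<in> nbhd - core" for y
    using height_off_core[of y] that cutoff_below[of "height y"] cutoff_above[of "height y"] by auto
  ultimately obtain U where U: "continuous_on UNIV U" "\<And>y. y \<in> nbhd \<Longrightarrow> U y - cutoff (height y) \<in> \<int>"
    "\<And>y. y \<notin> core \<Longrightarrow> U y \<in> \<int>"
    using lift_modulo_integers[OF compact_imp_closed[OF compact_core] open_nbhd core_subset_nbhd] by blast
  let ?d = "\<lambda>z. U (\<Phi> z) - cutoff (snd z)"
  have int: "?d z \<in> \<int>" if "z \<in> slab" for z
    using U(2)[of "\<Phi> z"] that by (auto simp: nbhd_def height_\<Phi>)
  have "?d constant_on slab"
  proof (rule continuous_integer_valued_imp_constant[OF _ _ int])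
    show "connected slab" unfolding slab_def by (intro convex_connected convex_Times) auto
    show "continuous_on slab ?d"
      by (intro continuous_intros continuous_on_cutoff continuous_on_compose2[OF U(1)] continuous_on_\<Phi>) auto
  qed
  then obtain k where k: "\<And>z. z \<in> slab \<Longrightarrow> ?d z = k" unfolding constant_on_def by blast
  have "(0, 0) \<in> slab" using \<delta>_pos by (simp add: mem_slab)
  then have "k \<in> \<int>" using int[of "(0, 0)"] k[of "(0, 0)"] by simp
  show thesis
  proof (rule that)
    show "continuous_on UNIV (\<lambda>y. U y - k - 1)" by (intro continuous_intros U(1))
    show "U (\<Phi> z) - k - 1 = cutoff (snd z) - 1" if "z \<in> slab" for z using k[OF that] by simp
    show "U y - k - 1 \<in> \<int>" if "y \<notin> core" for y using U(3)[OF that] \<open>k \<in> \<int>\<close> by simp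
  qed
qed

lemma jump_function_has_derivative:
  assumes U: "continuous_on UNIV U" "\<And>z. z \<in> slab \<Longrightarrow> U (\<Phi> z) = cutoff (snd z) - 1"
    "\<And>y. y \<notin> core \<Longrightarrow> U y \<in> \<int>"
  shows "(U has_derivative (\<lambda>h. jump_gradient y \<bullet> h)) (at y)"
proof (cases "y \<in> nbhd")
  case True
  then obtain z where z: "z \<in> slab" "y = \<Phi> z" by (auto simp: nbhd_def)
  have "(cutoff has_derivative (\<lambda>h. cutoff_deriv (snd z) * h)) (at (height y))"
    using cutoff_has_real_derivative[of "snd z" UNIV] z by (simp add: has_field_derivative_def height_\<Phi>)
  from has_derivative_compose[OF height_has_derivative[OF z(1), folded z(2)] this]
  have "((\<lambda>y. cutoff (height y)) has_derivative (\<lambda>h. jump_gradient y \<bullet> h)) (at y)"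
    using z by (simp add: jump_gradient_\<Phi>)
  then have "((\<lambda>y. cutoff (height y) - 1) has_derivative (\<lambda>h. jump_gradient y \<bullet> h)) (at y)"
    using has_derivative_diff[OF _ has_derivative_const[of 1]] by fastforce
  then show ?thesis
    by (rule has_derivative_transform_within_open[OF _ open_nbhd True]) (auto simp: nbhd_def height_\<Phi> U(2))
next
  case False
  then have "y \<in> - core" using core_subset_nbhd by blast
  then obtain e where e: "e > 0" "ball y e \<subseteq> - core"
    using openE[OF open_Compl[OF compact_imp_closed[OF compact_core]]] by blast
  have "U constant_on ball y e"
    by (rule continuous_integer_valued_imp_constant[OF connected_ball continuous_on_subset[OF U(1)]])
      (use U(3) e(2) in auto)
  then obtain k where "\<And>x. x \<in> ball y e \<Longrightarrow> k = U x" unfolding constant_on_def by metis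
  then have "(U has_derivative (\<lambda>h. 0)) (at y)"
    by (rule has_derivative_transform_within_open[OF has_derivative_const[of k] open_ball
          centre_in_ball[THEN iffD2, OF e(1)]])
  then show ?thesis using False by (simp add: jump_gradient_def)
qed

lemma separating_function:
  obtains U where "\<And>y. (U has_derivative (\<lambda>h. jump_gradient y \<bullet> h)) (at y)"
    "\<And>y. y \<in> \<Phi> ` (UNIV \<times> {0..<\<delta>}) \<Longrightarrow> U y = 0" "bounded (range U)"
proof -
  obtain U where U: "continuous_on UNIV U" "\<And>z. z \<in> slab \<Longrightarrow> U (\<Phi> z) = cutoff (snd z) - 1"
    "\<And>y. y \<notin> core \<Longrightarrow> U y \<in> \<int>"
    using jump_function_exists by blast
  show thesis
  proof (rule that)
    show "(U has_derivative (\<lambda>h. jump_gradient y \<bullet> h)) (at y)" for y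
      by (rule jump_function_has_derivative[OF U])
    show "U y = 0" if "y \<in> \<Phi> ` (UNIV \<times> {0..<\<delta>})" for y
      using that U(2) cutoff_above by (auto simp: mem_slab)
    show "bounded (range U)"
      by (rule bounded_range_if_integer_valued_off_bounded[OF _ U(1)
          compact_imp_bounded[OF compact_core] U(3)]) simp
  qed
qed

end

section \<open>Divergence of a cut-off cross product\<close>

lemma trace_matrix_cross3_symmetric:
  fixes T :: "real^3 \<Rightarrow> real^3"
  assumes sym: "\<And>a b. T a \<bullet> b = T b \<bullet> a"
  shows "trace (matrix (\<lambda>h. cross3 b (T h))) = 0"
proof -
  have "T (axis i 1) $ j = T (axis j 1) $ i" for i j
    using sym[of "axis i 1" "axis j 1"] by (simp add: inner_axis)
  from this[of 1 2] this[of 1 3] this[of 2 3] show ?thesis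
    by (simp add: trace_def matrix_def sum_3 cross3_def vector_3)
qed

lemma trace_matrix_scaleR_add_inner:
  fixes g x :: "real^'n"
  shows "trace (matrix (\<lambda>h. u *\<^sub>R L h + (g \<bullet> h) *\<^sub>R x)) = u * trace (matrix L) + g \<bullet> x"
  by (simp add: trace_def matrix_def inner_axis sum.distrib sum_distrib_left) (simp add: inner_vec_def)

definition cross_deriv :: "(real^3 \<Rightarrow> real^3) \<Rightarrow> (real^3 \<Rightarrow> (real^3) \<Rightarrow>\<^sub>L (real^3)) \<Rightarrow>
    (real^3 \<Rightarrow> real^3) \<Rightarrow> (real^3 \<Rightarrow> (real^3) \<Rightarrow>\<^sub>L (real^3)) \<Rightarrow> real^3 \<Rightarrow> real^3 \<Rightarrow> real^3" where
  "cross_deriv W1 W1' W2 W2' p h = cross3 (W1 p) (W2' p h) + cross3 (W1' p h) (W2 p)"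

lemma cross_has_derivative:
  assumes "irrotational_on \<Omega> W1 W1'" "irrotational_on \<Omega> W2 W2'" "p \<in> \<Omega>"
  shows "((\<lambda>p. cross3 (W1 p) (W2 p)) has_derivative cross_deriv W1 W1' W2 W2' p) (at p)"
  using bounded_bilinear.FDERIV[OF bounded_bilinear_cross3 irrotational_on_has_derivative[OF assms(1,3)]
      irrotational_on_has_derivative[OF assms(2,3)]]
  by (simp add: cross_deriv_def[abs_def])

lemma continuous_on_cross_deriv:
  assumes "irrotational_on \<Omega> W1 W1'" "irrotational_on \<Omega> W2 W2'"
  shows "continuous_on \<Omega> (\<lambda>p. cross3 (W1 p) (W2 p))" "continuous_on \<Omega> (\<lambda>p. cross_deriv W1 W1' W2 W2' p h)"
  unfolding cross_deriv_def
  by (intro continuous_intros continuous_on_cross assms[THEN irrotational_on_continuous_on]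
      assms[THEN irrotational_on_continuous_on_deriv])+

lemma trace_cross_deriv:
  assumes "irrotational_on \<Omega> W1 W1'" "irrotational_on \<Omega> W2 W2'" "p \<in> \<Omega>"
  shows "trace (matrix (cross_deriv W1 W1' W2 W2' p)) = 0"
proof -
  have "trace (matrix (\<lambda>h. cross3 (W1 p) (W2' p h))) = 0" "trace (matrix (\<lambda>h. cross3 (W2 p) (W1' p h))) = 0"
    using assms by (auto intro!: trace_matrix_cross3_symmetric irrotational_on_symmetric)
  moreover have "cross_deriv W1 W1' W2 W2' p = (\<lambda>h. cross3 (W1 p) (W2' p h) - cross3 (W2 p) (W1' p h))"
    by (auto simp: cross_deriv_def cross_skew[of "blinfun_apply (W1' p) _" "W2 p"])
  ultimately show ?thesis
    by (simp add: trace_def matrix_def sum_subtractf)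
qed

lemma scaleR_cross3_decay:
  fixes U :: "'a::real_normed_vector \<Rightarrow> real"
  assumes U: "bounded (range U)" and "C1 \<ge> 0" and W: "\<forall>\<^sub>F p in at_infinity. norm (W1 p) \<le> C1 / norm p ^ 2"
    "\<forall>\<^sub>F p in at_infinity. norm (W2 p) \<le> C2 / norm p ^ 2"
  shows "((\<lambda>p. norm p ^ 2 * norm (U p *\<^sub>R cross3 (W1 p) (W2 p))) \<longlongrightarrow> 0) at_infinity"
proof -
  obtain M where M: "M > 0" "\<And>p. \<bar>U p\<bar> \<le> M" using U unfolding bounded_pos by auto
  have "\<forall>\<^sub>F p :: 'a in at_infinity. 0 < norm p"
    by (auto simp: eventually_at_infinity intro!: exI[of _ 1])
  with W have "\<forall>\<^sub>F p in at_infinity. norm (norm p ^ 2 * norm (U p *\<^sub>R cross3 (W1 p) (W2 p)))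
      \<le> M * (C1 * C2) / norm p ^ 2"
  proof eventually_elim
    case (elim p)
    have "norm (cross3 (W1 p) (W2 p)) \<le> (C1 / norm p ^ 2) * (C2 / norm p ^ 2)"
      by (rule order_trans[OF norm_cross3_le mult_mono]) (use elim \<open>C1 \<ge> 0\<close> in auto)
    then have "norm p ^ 2 * (\<bar>U p\<bar> * norm (cross3 (W1 p) (W2 p)))
        \<le> norm p ^ 2 * (M * ((C1 / norm p ^ 2) * (C2 / norm p ^ 2)))"
      using M by (intro mult_left_mono mult_mono) auto
    also have "\<dots> = M * (C1 * C2) / norm p ^ 2" using elim by (simp add: power2_eq_square)
    finally show ?case by simp
  qed
  moreover have "((\<lambda>p. M * (C1 * C2) / norm p ^ 2) \<longlongrightarrow> 0) (at_infinity :: 'a filter)"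
    by (intro tendsto_divide_0[OF tendsto_const] filterlim_at_top_imp_at_infinity
        filterlim_pow_at_top filterlim_norm_at_top) simp
  ultimately show ?thesis by (rule Lim_null_comparison)
qed

(* The divergence of U (W1 x W2) is the inner product of grad U with W1 x W2. *)
lemma integral_gradient_inner_cross_irrotational:
  fixes U :: "real^3 \<Rightarrow> real"
  assumes \<Omega>: "open \<Omega>" and irr: "irrotational_on \<Omega> W1 W1'" "irrotational_on \<Omega> W2 W2'"
    and U: "\<And>p. (U has_derivative (\<lambda>h. G p \<bullet> h)) (at p)" "continuous_on UNIV G" "bounded (range U)"
    and N: "open N" "\<And>p. p \<in> N \<Longrightarrow> U p = 0" "\<And>p. p \<in> N \<Longrightarrow> G p = 0" "\<Omega> \<union> N = UNIV"
    and supp: "\<forall>\<^sub>F p in at_infinity. G p = 0"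
    and decay: "C1 \<ge> 0" "\<forall>\<^sub>F p in at_infinity. norm (W1 p) \<le> C1 / norm p ^ 2"
      "\<forall>\<^sub>F p in at_infinity. norm (W2 p) \<le> C2 / norm p ^ 2"
  shows "((\<lambda>p. G p \<bullet> cross3 (W1 p) (W2 p)) has_integral 0) UNIV"
proof -
  let ?X = "\<lambda>p. cross3 (W1 p) (W2 p)" and ?X' = "cross_deriv W1 W1' W2 W2'"
  define Y' where "Y' p h = U p *\<^sub>R ?X' p h + (G p \<bullet> h) *\<^sub>R ?X p" for p h
  have cover: "p \<in> \<Omega> \<or> p \<in> N" for p using N(4) by blast
  have deriv: "((\<lambda>p. U p *\<^sub>R ?X p) has_derivative Y' p) (at p)" for p
    using cover[of p]
  proof
    assume p: "p \<in> \<Omega>"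
    from has_derivative_scaleR[OF U(1) cross_has_derivative[OF irr p]] show ?thesis
      by (simp add: Y'_def[abs_def])
  next
    assume p: "p \<in> N"
    then have "((\<lambda>p. U p *\<^sub>R ?X p) has_derivative (\<lambda>h. 0)) (at p)"
      by (rule has_derivative_transform_within_open[OF has_derivative_const[of 0] N(1)]) (simp add: N(2))
    then show ?thesis using p by (simp add: Y'_def[abs_def] N(2,3))
  qed
  have cont: "continuous_on UNIV (\<lambda>p. Y' p h)" for h
  proof -
    have "continuous_on UNIV U"
      using U(1) by (meson continuous_at_imp_continuous_on has_derivative_continuous)
    then have "continuous_on \<Omega> (\<lambda>p. Y' p h)"
      unfolding Y'_def using continuous_on_subset[OF U(2) subset_UNIV] continuous_on_subset[of UNIV U \<Omega>]
      by (intro continuous_intros continuous_on_cross_deriv[OF irr]) auto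
    moreover have "continuous_on N (\<lambda>p. Y' p h)"
      by (rule continuous_on_eq[OF continuous_on_const[of _ 0]]) (simp add: Y'_def N(2,3))
    ultimately show ?thesis using continuous_on_open_Un[OF \<Omega> N(1)] N(4) by metis
  qed
  have trace: "trace (matrix (Y' p)) = G p \<bullet> ?X p" for p
    using cover[of p]
  proof
    assume p: "p \<in> \<Omega>"
    show ?thesis
      unfolding Y'_def trace_matrix_scaleR_add_inner by (simp add: trace_cross_deriv[OF irr p])
  qed (simp add: N(2,3) Y'_def trace_def matrix_def)
  have "((\<lambda>p. trace (matrix (Y' p))) has_integral 0) UNIV"
  proof (rule divergence_integral_zero[OF deriv cont scaleR_cross3_decay[OF U(3) decay]])
    show "\<forall>\<^sub>F p in at_infinity. trace (matrix (Y' p)) = 0"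
      unfolding trace using supp by eventually_elim simp
  qed
  then show ?thesis by (simp only: trace)
qed

section \<open>Integration over the collar\<close>

lemma absolutely_integrable_on_compact:
  fixes f :: "'a::euclidean_space \<Rightarrow> 'b::euclidean_space"
  assumes "compact S" "continuous_on S f"
  shows "f absolutely_integrable_on S"
  using borel_integrable_compact[OF assms]
  by (simp add: set_integrable_def integrable_completion borel_measurable_integrable)

lemma integral_change_of_variables_real:
  fixes g :: "real^'m::{finite,wellorder} \<Rightarrow> real^'m::_" and f :: "real^'m::_ \<Rightarrow> real"
  assumes S: "S \<in> sets lebesgue" and g: "\<And>x. x \<in> S \<Longrightarrow> (g has_derivative g' x) (at x within S)" "inj_on g S"
    and f: "f absolutely_integrable_on g ` S"
  shows "integral S (\<lambda>x. \<bar>det (matrix (g' x))\<bar> * f (g x)) = integral (g ` S) f"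
proof -
  let ?F = "\<lambda>y. f y *\<^sub>R (axis 1 1 :: real^1)"
  have F: "?F absolutely_integrable_on g ` S"
    using absolutely_integrable_linear[OF f bounded_linear_scaleR_left] by (simp add: o_def)
  then have "(\<lambda>x. \<bar>det (matrix (g' x))\<bar> *\<^sub>R ?F (g x)) absolutely_integrable_on S"
    "integral S (\<lambda>x. \<bar>det (matrix (g' x))\<bar> *\<^sub>R ?F (g x)) = integral (g ` S) ?F"
    using has_absolute_integral_change_of_variables[OF S g, where f="?F" and b="integral (g ` S) ?F"] by auto
  then show ?thesis
    using integral_component_eq_cart[of "\<lambda>x. \<bar>det (matrix (g' x))\<bar> *\<^sub>R ?F (g x)" S 1]
      integral_component_eq_cart[of ?F "g ` S" 1] F
    by (simp add: set_lebesgue_integral_eq_integral(1))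
qed

lemma negligible_cell_boundary: "negligible ({v::real^3. v$1 = 1} \<union> {v. v$2 = 1})"
proof -
  have "negligible {v::real^3. v$i = 1}" for i
    using negligible_standard_hyperplane[of "axis i (1::real) :: real^3" 1]
        by (simp add: inner_axis axis_in_Basis_iff)
  then show ?thesis by (intro negligible_Un)
qed

context torus_collar
begin

definition slab_point :: "real^3 \<Rightarrow> (real \<times> real) \<times> real" where
  "slab_point v = ((v$1, v$2), v$3)"

definition cell :: "real \<Rightarrow> real \<Rightarrow> (real^3) set" where
  "cell a b = {v. v$1 \<in> {0..<1} \<and> v$2 \<in> {0..<1} \<and> v$3 \<in> {a..b}}"

lemma slab_point_vec3: "slab_point (vec3 (s, t, r)) = ((s, t), r)"
  by (simp add: slab_point_def)

lemma slab_point_has_derivative: "(slab_point has_derivative slab_point) (at v within S)"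
  unfolding slab_point_def[abs_def]
  by (intro has_derivative_Pair bounded_linear_imp_has_derivative bounded_linear_vec_nth)

lemma sets_cell: "cell a b \<in> sets lebesgue"
proof -
  have "cell a b = ({v. 0 \<le> v$1} \<inter> {v. v$1 < 1})
      \<inter> (({v. 0 \<le> v$2} \<inter> {v. v$2 < 1}) \<inter> ({v. a \<le> v$3} \<inter> {v. v$3 \<le> b}))"
    by (auto simp: cell_def)
  moreover have "closed {v::real^3. c \<le> v$i}" "closed {v::real^3. v$i \<le> c}" "open {v::real^3. v$i < c}"
      for c i
    by (intro closed_Collect_le open_Collect_less continuous_intros)+
  ultimately show ?thesis
    by (auto intro!: sets_completionI_sets sets.Int borel_closed borel_open)
qed

lemma inj_on_\<Phi>_cell:
  assumes "-\<delta> < a" "b < \<delta>"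
  shows "inj_on (\<lambda>v. \<Phi> (slab_point v)) (cell a b)"
proof (rule inj_onI)
  fix v w assume v: "v \<in> cell a b" and w: "w \<in> cell a b" and eq: "\<Phi> (slab_point v) = \<Phi> (slab_point w)"
  have "lattice_equiv ((v$1, v$2), v$3) ((w$1, w$2), w$3)"
    using eq v w assms unfolding slab_point_def by (intro \<Phi>_inj) (auto simp: cell_def)
  moreover have "\<bar>v$1 - w$1\<bar> < 1" "\<bar>v$2 - w$2\<bar> < 1"
    using v w by (auto simp: cell_def)
  ultimately have "((v$1, v$2), v$3) = ((w$1, w$2), w$3)" by (rule lattice_equiv_close)
  then show "v = w" by (simp add: vec_eq_iff forall_3)
qed

lemma \<Phi>_image_cell: "(\<lambda>v. \<Phi> (slab_point v)) ` cell a b = \<Phi> ` (UNIV \<times> {a..b})"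
proof
  show "(\<lambda>v. \<Phi> (slab_point v)) ` cell a b \<subseteq> \<Phi> ` (UNIV \<times> {a..b})"
    by (auto simp: cell_def slab_point_def)
  have "\<Phi> ((s, t), r) \<in> (\<lambda>v. \<Phi> (slab_point v)) ` cell a b" if "r \<in> {a..b}" for s t r
  proof (rule image_eqI)
    show "\<Phi> ((s, t), r) = \<Phi> (slab_point (vec3 (frac s, frac t, r)))"
      unfolding slab_point_vec3 by (rule lattice_equiv_\<Phi>(1)[OF lattice_equiv_frac])
    show "vec3 (frac s, frac t, r) \<in> cell a b" using that by (simp add: cell_def frac_lt_1)
  qed
  then show "\<Phi> ` (UNIV \<times> {a..b}) \<subseteq> (\<lambda>v. \<Phi> (slab_point v)) ` cell a b" by auto
qed

lemma det_\<Phi>_slab_point: "det (matrix (\<lambda>h. dir_deriv \<Phi> (slab_point h) z)) = Jac z"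
proof -
  have "slab_point (axis 1 1) = ((1, 0), 0)" "slab_point (axis 2 1) = ((0, 1), 0)"
      "slab_point (axis 3 1) = ((0, 0), 1)"
    by (simp_all add: slab_point_def axis_def)
  then show ?thesis
    by (simp add: det_3 matrix_def Jac_def dir_deriv_\<Phi>_normal cross3_def inner_vec_def sum_3
        vector_3 algebra_simps)
qed

lemma integral_cell:
  fixes F :: "real^3 \<Rightarrow> real"
  assumes F: "continuous_on UNIV F" and ab: "-\<delta> < a" "b < \<delta>"
  shows "integral (cell a b) (\<lambda>v. Jac (slab_point v) * F (\<Phi> (slab_point v)))
      = integral (\<Phi> ` (UNIV \<times> {a..b})) F"
proof -
  let ?g = "\<lambda>v. \<Phi> (slab_point v)" and ?g' = "\<lambda>v h. dir_deriv \<Phi> (slab_point h) (slab_point v)"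
  have "F absolutely_integrable_on ?g ` cell a b"
    unfolding \<Phi>_image_cell
    by (rule absolutely_integrable_on_compact[OF compact_\<Phi>_image continuous_on_subset[OF F]]) simp
  moreover have "(?g has_derivative ?g' v) (at v within cell a b)" for v
    by (rule has_derivative_compose[OF slab_point_has_derivative \<Phi>_has_derivative])
  ultimately have "integral (cell a b) (\<lambda>v. \<bar>det (matrix (?g' v))\<bar> * F (?g v)) = integral (?g ` cell a b) F"
    by (intro integral_change_of_variables_real[OF sets_cell _ inj_on_\<Phi>_cell[OF ab]]) auto
  moreover have "\<bar>det (matrix (?g' v))\<bar> = Jac (slab_point v)" if "v \<in> cell a b" for v
    unfolding det_\<Phi>_slab_point using that ab by (auto intro!: abs_of_pos Jac_pos simp:
        cell_def slab_point_def)
  ultimately show ?thesis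
    unfolding \<Phi>_image_cell by (simp cong: integral_cong)
qed

lemma integral_collar:
  fixes F :: "real^3 \<Rightarrow> real"
  assumes F: "continuous_on UNIV F" "\<And>y. y \<notin> \<Phi> ` (UNIV \<times> {a..b}) \<Longrightarrow> F y = 0"
    and ab: "-\<delta> < a" "a \<le> b" "b < \<delta>"
  shows "integral UNIV F
    = integral {a..b} (\<lambda>r. integral {0..1} (\<lambda>s. integral {0..1} (\<lambda>t. Jac ((s, t), r) * F (\<Phi> ((s, t), r)))))"
proof -
  let ?q = "\<lambda>z. Jac z * F (\<Phi> z)" and ?C = "cbox (vec3 (0, 0, a)) (vec3 (1, 1, b))"
  have q: "continuous_on S (\<lambda>x. ?q (h x))" if "continuous_on S h" for S :: "'a::t2_space set" and h
    by (intro continuous_intros continuous_on_Jac continuous_on_compose2[OF F(1)] continuous_on_\<Phi> that) auto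
  have "integral UNIV F = integral (\<Phi> ` (UNIV \<times> {a..b})) F"
    by (subst integral_restrict_UNIV[symmetric]) (auto intro!: integral_cong F(2))
  also have "\<dots> = integral (cell a b) (\<lambda>v. ?q (slab_point v))"
    using integral_cell[OF F(1) ab(1,3)] by simp
  also have "\<dots> = integral ?C (\<lambda>v. ?q (slab_point v))"
    by (rule integral_spike_set) (rule negligible_subset[OF negligible_cell_boundary], auto simp: cell_def
        mem_cbox_real3)+
  also have "\<dots> = integral {0..1} (\<lambda>s. integral {0..1} (\<lambda>t. integral {a..b} (\<lambda>r. ?q ((s, t), r))))"
    by (subst integral_cbox_vec3) (auto simp: slab_point_vec3 intro!: q continuous_intros
        simp: slab_point_def)
  also have "\<dots> = integral {0..1} (\<lambda>t. integral {a..b} (\<lambda>r. integral {0..1} (\<lambda>s. ?q ((s, t), r))))"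
    by (rule triple_integral_rotate) (auto simp: case_prod_beta intro!: q continuous_intros)
  also have "\<dots> = integral {a..b} (\<lambda>r. integral {0..1} (\<lambda>s. integral {0..1} (\<lambda>t. ?q ((s, t), r))))"
    by (rule triple_integral_rotate) (auto simp: case_prod_beta intro!: q continuous_intros)
  finally show ?thesis .
qed

end

section \<open>The Seifert form\<close>

context embedded_torus
begin

definition loop :: "real \<times> real \<Rightarrow> int \<times> int \<Rightarrow> real \<Rightarrow> real \<Rightarrow> real^3" where
  "loop x c r u = \<Phi> (x + u *\<^sub>R (of_int (fst c), of_int (snd c)), r)"

definition loop' :: "real \<times> real \<Rightarrow> int \<times> int \<Rightarrow> real \<Rightarrow> real \<Rightarrow> real^3" where
  "loop' x c r u = dir_deriv \<Phi> ((of_int (fst c), of_int (snd c)), 0)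
    (x + u *\<^sub>R (of_int (fst c), of_int (snd c)), r)"

lemma continuous_on_loop:
  assumes "continuous_on S r" "continuous_on S u"
  shows "continuous_on S (\<lambda>p. loop x c (r p) (u p))" "continuous_on S (\<lambda>p. loop' x c (r p) (u p))"
  unfolding loop_def loop'_def
  by (intro continuous_on_\<Phi> continuous_on_dir_deriv_\<Phi> continuous_intros assms)+

lemma closed_curve_loop: "closed_curve (loop x c r) (loop' x c r)"
  unfolding closed_curve_def
proof (intro conjI allI)
  fix u
  let ?v = "(real_of_int (fst c), real_of_int (snd c))"
  have "((\<lambda>u. (x + u *\<^sub>R ?v, r)) has_vector_derivative (?v, 0)) (at u)"
    by (intro has_vector_derivative_Pair has_vector_derivative_line has_vector_derivative_const)
  from has_vector_derivative_compose[OF this \<Phi>_has_derivative]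
  show "(loop x c r has_vector_derivative loop' x c r u) (at u)"
    by (simp add: loop_def[abs_def] loop'_def)
  have "(x + (u + 1) *\<^sub>R ?v, r) = (x + u *\<^sub>R ?v, r) + (?v, 0)"
    by (simp add: scaleR_add_left algebra_simps)
  then show "loop x c r (u + 1) = loop x c r u"
    unfolding loop_def by (metis \<Phi>_lattice)
qed (intro continuous_on_loop continuous_intros)

lemma loop_shift:
  "loop (x - a *\<^sub>R (of_int (fst c), of_int (snd c))) c r u = loop x c r (u - a)"
  "loop' (x - a *\<^sub>R (of_int (fst c), of_int (snd c))) c r u = loop' x c r (u - a)"
proof -
  have "x - a *\<^sub>R v + u *\<^sub>R v = x + (u - a) *\<^sub>R v" for v :: "real \<times> real"
    by (simp only: scaleR_diff_left) simp
  then show "loop (x - a *\<^sub>R (of_int (fst c), of_int (snd c))) c r u = loop x c r (u - a)"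
    "loop' (x - a *\<^sub>R (of_int (fst c), of_int (snd c))) c r u = loop' x c r (u - a)"
    by (simp_all only: loop_def loop'_def)
qed

end

context torus_collar
begin

lemma \<Phi>_levels_disjoint:
  assumes "r \<in> {-\<delta><..<\<delta>}" "\<rho> \<in> {-\<delta><..<\<delta>}" "r \<noteq> \<rho>"
  shows "\<Phi> (x, r) \<noteq> \<Phi> (y, \<rho>)"
  using \<Phi>_inj[of "(x, r)" "(y, \<rho>)"] lattice_equiv_snd[of "(x, r)" "(y, \<rho>)"] assms by auto

lemma disjoint_loops:
  assumes "r \<in> {-\<delta><..<\<delta>}" "\<rho> \<in> {-\<delta><..<\<delta>}" "r \<noteq> \<rho>"
  shows "disjoint_closed_curves (loop x b r) (loop' x b r) (loop y c \<rho>) (loop' y c \<rho>)"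
proof
  show "range (loop x b r) \<inter> range (loop y c \<rho>) = {}"
    using \<Phi>_levels_disjoint[OF assms] unfolding loop_def by blast
qed (rule closed_curve_loop)+

lemma \<Phi>_notin_range_loop:
  assumes "r \<in> {-\<delta><..<\<delta>}" "\<rho> \<in> {-\<delta><..<\<delta>}" "r \<noteq> \<rho>"
  shows "\<Phi> (x, r) \<notin> range (loop y c \<rho>)"
  using \<Phi>_levels_disjoint[OF assms] unfolding loop_def by blast

lemma loop_potential_exists:
  assumes I: "open I" "convex I" "I \<subseteq> {-\<delta><..<\<delta>}" and \<rho>: "\<rho> \<in> {-\<delta><..<\<delta>}" "\<rho> \<notin> I"
  obtains a b p where "torus_potential (biot_savart (loop y c \<rho>) (loop' y c \<rho>)) \<Phi> I a b p"
proof (rule torus_potential_exists[OF irrotational_on_biot_savart[OF closed_curve_loop]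
    Ck_differentiable_\<Phi> torus_periodic_\<Phi> I(1,2)])
  show "\<Phi> (x, r) \<in> - range (loop y c \<rho>)" if "r \<in> I" for x r
    using \<Phi>_notin_range_loop[of r \<rho>] that I(3) \<rho> by blast
qed (rule that)

lemma linking_number_loop_potential:
  assumes p: "torus_potential (biot_savart (loop y c \<rho>) (loop' y c \<rho>)) \<Phi> I a b p"
    and I: "I \<subseteq> {-\<delta><..<\<delta>}" "r \<in> I" and \<rho>: "\<rho> \<in> {-\<delta><..<\<delta>}" "\<rho> \<notin> I"
  shows "linking_number (loop y c \<rho>) (loop x d r) = (of_int (fst d) * a + of_int (snd d) * b) / (4 * pi)"
proof -
  interpret disjoint_closed_curves "loop y c \<rho>" "loop' y c \<rho>" "loop x d r" "loop' x d r"
    by (rule disjoint_loops) (use I \<rho> in auto)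
  have "integral {0..1} (\<lambda>v. biot_savart (loop y c \<rho>) (loop' y c \<rho>) (loop x d r v) \<bullet> loop' x d r v)
      = of_int (fst d) * a + of_int (snd d) * b"
    unfolding loop_def[of x d r] loop'_def[of x d r]
        by (rule integral_unique[OF torus_potential_period[OF p I(2)]])
  then show ?thesis by (simp add: linking_number_biot_savart)
qed

lemma linking_number_loop_linear:
  assumes I: "open I" "convex I" "I \<subseteq> {-\<delta><..<\<delta>}" "r \<in> I" "r' \<in> I" and \<rho>: "\<rho> \<in> {-\<delta><..<\<delta>}" "\<rho> \<notin> I"
  shows "linking_number (loop y c \<rho>) (loop x d r) =
    of_int (fst d) * linking_number (loop y c \<rho>) (loop 0 (1, 0) r')
    + of_int (snd d) * linking_number (loop y c \<rho>) (loop 0 (0, 1) r')"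
proof -
  obtain a b p where p: "torus_potential (biot_savart (loop y c \<rho>) (loop' y c \<rho>)) \<Phi> I a b p"
    by (rule loop_potential_exists[OF I(1-3) \<rho>])
  note lk = linking_number_loop_potential[OF p I(3) _ \<rho>]
  show ?thesis unfolding lk[OF I(4)] lk[OF I(5)] by (simp add: add_divide_distrib)
qed

lemma linking_number_loop_cong:
  assumes "open I" "convex I" "I \<subseteq> {-\<delta><..<\<delta>}" "r \<in> I" "r' \<in> I" "\<rho> \<in> {-\<delta><..<\<delta>}" "\<rho> \<notin> I"
  shows "linking_number (loop y c \<rho>) (loop x d r) = linking_number (loop y c \<rho>) (loop x' d r')"
  by (rule trans[OF linking_number_loop_linear[OF assms]
      linking_number_loop_linear[OF assms(1-3,5,5,6,7), symmetric]])

definition seifert_form :: "int \<times> int \<Rightarrow> int \<times> int \<Rightarrow> real" where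
  "seifert_form b c = linking_number (loop 0 b 0) (loop 0 c (\<delta>/2))"

lemma linking_number_loops_commute:
  assumes "r \<in> {-\<delta><..<\<delta>}" "\<rho> \<in> {-\<delta><..<\<delta>}" "r \<noteq> \<rho>"
  shows "linking_number (loop x b r) (loop y c \<rho>) = linking_number (loop y c \<rho>) (loop x b r)"
  by (rule linking_number_commute[OF disjoint_loops[OF assms]])

(* First move the upper loop above both levels, then the lower one to level 0, then the upper one to
    level delta/2. *)
lemma linking_number_loops:
  assumes "-\<delta> < \<sigma>" "\<sigma> < \<rho>" "\<rho> < \<delta>"
  shows "linking_number (loop x b \<sigma>) (loop y c \<rho>) = seifert_form b c"
proof -
  define \<tau> where "\<tau> = max \<rho> (\<delta>/2)"
  have \<tau>: "\<sigma> < \<tau>" "0 < \<tau>" "\<tau> < \<delta>" "\<rho> \<le> \<tau>" "\<delta>/2 \<le> \<tau>" using assms \<delta>_pos by (auto simp: \<tau>_def)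
  have "linking_number (loop x b \<sigma>) (loop y c \<rho>) = linking_number (loop x b \<sigma>) (loop 0 c \<tau>)"
    by (rule linking_number_loop_cong[of "{\<sigma><..<\<delta>}"]) (use assms \<tau> in auto)
  also have "\<dots> = linking_number (loop 0 c \<tau>) (loop x b \<sigma>)"
    by (rule linking_number_loops_commute) (use assms \<tau> in auto)
  also have "\<dots> = linking_number (loop 0 c \<tau>) (loop 0 b 0)"
    by (rule linking_number_loop_cong[of "{-\<delta><..<\<tau>}"]) (use assms \<tau> in auto)
  also have "\<dots> = linking_number (loop 0 b 0) (loop 0 c \<tau>)"
    by (rule linking_number_loops_commute) (use \<tau> in auto)
  also have "\<dots> = linking_number (loop 0 b 0) (loop 0 c (\<delta>/2))"
    by (rule linking_number_loop_cong[of "{0<..<\<delta>}"]) (use \<tau> \<delta>_pos in auto)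
  finally show ?thesis by (simp add: seifert_form_def)
qed

lemma seifert_lk_eq_seifert_form:
  assumes "0 < eps" "eps < \<delta>"
  shows "seifert_lk f eps b c = seifert_form b c"
proof -
  have "f \<circ> torus_loop b = loop 0 b 0" "shift f eps \<circ> torus_loop c = loop 0 c eps"
    by (auto simp: fun_eq_iff torus_loop_def loop_def f_eq_\<Phi> shift_eq_\<Phi> mult.commute)
  then show ?thesis
    unfolding seifert_lk_def using assms \<delta>_pos by (simp add: linking_number_loops)
qed

lemma seifert_form_linear_right:
  "seifert_form b c = of_int (fst c) * seifert_form b (1, 0) + of_int (snd c) * seifert_form b (0, 1)"
  unfolding seifert_form_def
  by (rule linking_number_loop_linear[of "{0<..<\<delta>}"]) (use \<delta>_pos in auto)

lemma seifert_form_eq_upper: "seifert_form b c = linking_number (loop 0 c (\<delta>/2)) (loop 0 b 0)"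
  unfolding seifert_form_def by (rule linking_number_loops_commute) (use \<delta>_pos in auto)

lemma seifert_form_linear_left:
  "seifert_form b c = of_int (fst b) * seifert_form (1, 0) c + of_int (snd b) * seifert_form (0, 1) c"
  unfolding seifert_form_eq_upper
  by (rule linking_number_loop_linear[of "{-\<delta><..<\<delta>/2}"]) (use \<delta>_pos in auto)

lemma seifert_form_integer: "seifert_form b c \<in> \<int>"
  unfolding seifert_form_def
  by (rule disjoint_closed_curves.linking_number_integer[OF disjoint_loops]) (use \<delta>_pos in auto)

section \<open>The skew part of the Seifert form\<close>

abbreviation "longitude \<equiv> loop 0 (1, 0) 0"
abbreviation "longitude' \<equiv> loop' 0 (1, 0) 0"
abbreviation "meridian \<equiv> loop 0 (0, 1)"
abbreviation "meridian' \<equiv> loop' 0 (0, 1)"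

lemma longitude_meridian_apart:
  assumes "\<bar>r\<bar> < \<delta>" "\<bar>u\<bar> \<le> 1/2" "\<bar>v\<bar> \<le> 1/2" "(u, v, r) \<noteq> 0"
  shows "longitude u \<noteq> meridian r v"
proof
  assume "longitude u = meridian r v"
  then have "\<Phi> ((u, 0), 0) = \<Phi> ((0, v), r)" by (simp add: loop_def)
  then have "lattice_equiv ((u, 0), 0) ((0, v), r)"
    using assms \<delta>_pos by (intro \<Phi>_inj) auto
  then have "((u, 0), 0) = ((0, v), r)"
    by (rule lattice_equiv_close) (use assms in auto)
  then show False using assms(4) by (simp add: zero_prod_def)
qed

lemma longitude_meridian_difference_has_derivative:
  "((\<lambda>q. longitude (fst q) - meridian (snd (snd q)) (fst (snd q))) has_derivative
    (\<lambda>q. fst q *\<^sub>R \<Phi>\<^sub>s 0 - (fst (snd q) *\<^sub>R \<Phi>\<^sub>t 0 + snd (snd q) *\<^sub>R \<nu> 0))) (at 0)"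
proof -
  have "((\<lambda>q :: real \<times> real \<times> real. ((fst q, 0 :: real), 0 :: real))
      has_derivative (\<lambda>q. ((fst q, 0), 0))) (at 0)"
    "((\<lambda>q :: real \<times> real \<times> real. ((0 :: real, fst (snd q)), snd (snd q)))
        has_derivative (\<lambda>q. ((0, fst (snd q)), snd (snd q)))) (at 0)"
    by (auto intro!: derivative_eq_intros)
  from has_derivative_diff[OF has_derivative_compose[OF this(1) \<Phi>_has_derivative]
      has_derivative_compose[OF this(2) \<Phi>_has_derivative]]
  have "((\<lambda>q. \<Phi> ((fst q, 0), 0) - \<Phi> ((0, fst (snd q)), snd (snd q))) has_derivative
      (\<lambda>q. dir_deriv \<Phi> ((fst q, 0), 0) 0 - dir_deriv \<Phi> ((0, fst (snd q)), snd (snd q)) 0)) (at 0)"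
    by (simp flip: zero_prod_def)
  moreover have "dir_deriv \<Phi> ((fst q, 0), 0) 0 - dir_deriv \<Phi> ((0, fst (snd q)), snd (snd q)) 0
      = fst q *\<^sub>R \<Phi>\<^sub>s 0 - (fst (snd q) *\<^sub>R \<Phi>\<^sub>t 0 + snd (snd q) *\<^sub>R \<nu> 0)" for q
    using dir_deriv_\<Phi>_split[of 0 "fst q" 0 0] dir_deriv_\<Phi>_split[of 0 0 "fst (snd q)" "snd (snd q)"] by simp
  moreover have "longitude u = \<Phi> ((u, 0), 0)" "meridian r v = \<Phi> ((0, v), r)" for u v r
    by (simp_all add: loop_def)
  ultimately show ?thesis by (simp only:)
qed

lemma longitude_meridian_crossing:
  obtains \<alpha> \<beta> \<eta> \<epsilon> where "curve_crossing longitude longitude' meridian meridian' \<alpha> \<beta> (\<nu> 0) (1/2) \<eta> \<epsilon>" "\<epsilon> < \<delta>"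
proof -
  have \<nu>: "norm (\<nu> 0) = 1" "\<Phi>\<^sub>s 0 \<bullet> \<nu> 0 = 0" "\<Phi>\<^sub>t 0 \<bullet> \<nu> 0 = 0" and orient: "cross3 (\<Phi>\<^sub>s 0) (\<Phi>\<^sub>t 0) \<bullet> \<nu> 0 > 0"
    using norm_\<nu> \<nu>_inner_level_tangent[of 0] Jac_level_0_pos[of 0]
    by (simp_all add: inner_commute Jac_def flip: zero_prod_def)
  obtain \<alpha> \<beta> where frame: "norm \<alpha> = 1" "norm \<beta> = 1" "\<alpha> \<bullet> \<beta> = 0" "cross3 \<alpha> \<beta> = \<nu> 0"
    and adapted: "\<Phi>\<^sub>s 0 = norm (\<Phi>\<^sub>s 0) *\<^sub>R \<alpha>" "\<Phi>\<^sub>t 0 \<bullet> \<beta> > 0"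
    by (rule adapted_orthonormal_frame[OF \<nu>(1,2) orient])
  have "\<Phi>\<^sub>s 0 \<noteq> 0" using orient by auto
  note lin = orthonormal_frame_homotopy_nonzero[OF frame adapted(1) this adapted(2) \<nu>(3)]
  let ?L0 = "\<lambda>q :: real \<times> real \<times> real. fst q *\<^sub>R \<alpha> - (fst (snd q) *\<^sub>R \<beta> + snd (snd q) *\<^sub>R \<nu> 0)"
  have "linear ?L0" by (rule linearI) (simp_all add: algebra_simps)
  from differentiable_homotopy_nonzero[OF this longitude_meridian_difference_has_derivative]
  obtain d where d: "d > 0" "\<And>x q. \<lbrakk>x \<in> {0..1}; q \<noteq> 0; norm q < d\<rbrakk> \<Longrightarrow>
      (1 - x) *\<^sub>R ?L0 q + x *\<^sub>R (longitude (fst q) - meridian (snd (snd q)) (fst (snd q))) \<noteq> 0"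
    using lin by (auto simp: loop_def)
  define \<eta> \<epsilon> where "\<eta> = min (d/4) (1/4)" and "\<epsilon> = min (d/4) (\<delta>/2)"
  have small: "\<eta> \<le> d/4" "\<epsilon> \<le> d/4" by (simp_all add: \<eta>_def \<epsilon>_def)
  have "curve_crossing longitude longitude' meridian meridian' \<alpha> \<beta> (\<nu> 0) (1/2) \<eta> \<epsilon>"
  proof
    fix r x y z :: real
    assume q: "r \<in> {-\<epsilon>..\<epsilon>}" "x \<in> {0..1}" "y \<in> {-\<eta>..\<eta>}" "z \<in> {-\<eta>..\<eta>}" "(y, z, r) \<noteq> 0"
    have "norm (y, z, r) \<le> \<bar>y\<bar> + (\<bar>z\<bar> + \<bar>r\<bar>)"
      using norm_Pair_le[of y "(z, r)"] norm_Pair_le[of z r] by simp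
    also have "\<dots> < d"
      using q(1,3,4) d(1) small unfolding atLeastAtMost_iff by linarith
    finally show "(1 - x) *\<^sub>R (y *\<^sub>R \<alpha> - (z *\<^sub>R \<beta> + r *\<^sub>R \<nu> 0)) + x *\<^sub>R (longitude y - meridian r z) \<noteq> 0"
      using d(2)[OF q(2,5)] by simp
  next
    fix r u v :: real assume "r \<in> {-\<epsilon>..\<epsilon>}" "u \<in> {-(1/2)..1/2}" "v \<in> {-(1/2)..1/2}" "(u, v, r) \<noteq> 0"
    then show "longitude u \<noteq> meridian r v"
      using \<delta>_pos by (intro longitude_meridian_apart) (auto simp: \<epsilon>_def)
  qed (use d(1) \<delta>_pos in \<open>auto simp: frame \<eta>_def \<epsilon>_def case_prod_beta
      intro!: closed_curve_has_vector_derivative[OF closed_curve_loop] continuous_on_loop continuous_intros\<close>)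
  moreover have "\<epsilon> < \<delta>" using \<delta>_pos by (simp add: \<epsilon>_def)
  ultimately show thesis by (rule that)
qed

lemma longitude_meridian_linking:
  assumes "\<bar>r\<bar> < \<delta>" "r \<noteq> 0"
  shows "integral {-(1/2)..1/2} (\<lambda>u. integral {-(1/2)..1/2}
      (gauss_integrand longitude longitude' (meridian r) (meridian' r) u)) =
    4 * pi * (if r < 0 then seifert_form (0, 1) (1, 0) else seifert_form (1, 0) (0, 1))"
proof -
  define x where "x = 0 - (1/2 :: real) *\<^sub>R (real_of_int (fst (1, 0 :: int)), real_of_int (snd (1 :: int, 0)))"
  define y where "y = 0 - (1/2 :: real) *\<^sub>R (real_of_int (fst (0, 1 :: int)), real_of_int (snd (0 :: int, 1)))"
  have shift: "integral {-(1/2)..1/2} g = integral {0..1} (\<lambda>u. g (u - 1/2))" for g :: "real \<Rightarrow> real"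
    using integral_shift_Icc_real[of 0 1 g "-1/2"] by (simp add: o_def add.commute)
  interpret disjoint_closed_curves "loop x (1, 0) 0" "loop' x (1, 0) 0" "loop y (0, 1) r" "loop' y (0, 1) r"
    by (rule disjoint_loops) (use assms in auto)
  have "integral {-(1/2)..1/2} (\<lambda>u. integral {-(1/2)..1/2}
      (gauss_integrand longitude longitude' (meridian r) (meridian' r) u))
      = 4 * pi * linking_number (loop x (1, 0) 0) (loop y (0, 1) r)"
    
    unfolding linking_number_eq_iterated shift gauss_integrand_def unfolding x_def y_def loop_shift by simp
  moreover have "linking_number (loop x (1, 0) 0) (loop y (0, 1) r)
      = linking_number (loop y (0, 1) r) (loop x (1, 0) 0)"
    by (rule linking_number_loops_commute) (use assms in auto)
  ultimately show ?thesis
    using linking_number_loops[of 0 r x "(1, 0)" y "(0, 1)"]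
        linking_number_loops[of r 0 y "(0, 1)" x "(1, 0)"] assms
    by simp
qed

lemma seifert_form_skew: "seifert_form (0, 1) (1, 0) - seifert_form (1, 0) (0, 1) = 1"
proof -
  let ?J = "\<lambda>r. integral {-(1/2)..1/2} (\<lambda>u. integral {-(1/2)..1/2}
      (gauss_integrand longitude longitude' (meridian r) (meridian' r) u))"
  let ?c = "4 * pi * (seifert_form (0, 1) (1, 0) - seifert_form (1, 0) (0, 1))"
  obtain \<alpha> \<beta> \<eta> \<epsilon> where "curve_crossing longitude longitude' meridian meridian' \<alpha> \<beta> (\<nu> 0) (1/2) \<eta> \<epsilon>" "\<epsilon> < \<delta>"
    by (rule longitude_meridian_crossing)
  then have "((\<lambda>r. ?J (- r) - ?J r) \<longlongrightarrow> 4 * pi) (at_right 0)"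
    using curve_crossing.gauss_integral_jump by blast
  moreover have "\<forall>\<^sub>F r in at_right 0. ?J (- r) - ?J r = ?c"
    unfolding eventually_at_right_field
    using \<delta>_pos by (auto simp: longitude_meridian_linking right_diff_distrib intro!: exI[of _ \<delta>])
  ultimately have "((\<lambda>r::real. ?c) \<longlongrightarrow> 4 * pi) (at_right 0)"
    by (rule Lim_transform_eventually)
  then show ?thesis by (simp add: tendsto_const_iff)
qed

end

section \<open>Degeneracy of the Seifert form\<close>

context torus_collar
begin

abbreviation "B1 \<equiv> biot_savart (loop 0 (1, 0) (\<delta>/2)) (loop' 0 (1, 0) (\<delta>/2))"
abbreviation "B2 \<equiv> biot_savart (loop 0 (0, 1) (\<delta>/2)) (loop' 0 (0, 1) (\<delta>/2))"

definition off_loops :: "(real^3) set" where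
  "off_loops = - (range (loop 0 (1, 0) (\<delta>/2)) \<union> range (loop 0 (0, 1) (\<delta>/2)))"

lemma open_off_loops: "open off_loops"
  unfolding off_loops_def
  by (intro open_Compl closed_Un compact_imp_closed compact_range_closed_curve[OF closed_curve_loop])

lemma irrotational_on_off_loops:
  obtains B1' B2' where "irrotational_on off_loops B1 B1'" "irrotational_on off_loops B2 B2'"
  by (rule that; rule irrotational_on_subset[OF irrotational_on_biot_savart[OF closed_curve_loop]])
    (auto simp: off_loops_def)

lemma \<Phi>_mem_off_loops: "-\<delta> < r \<Longrightarrow> r < \<delta>/2 \<Longrightarrow> \<Phi> (x, r) \<in> off_loops"
  using \<Phi>_notin_range_loop[of r "\<delta>/2"] \<delta>_pos by (simp add: off_loops_def)

lemma core_subset_off_loops: "core \<subseteq> off_loops"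
  using \<delta>_pos by (auto simp: core_def intro!: \<Phi>_mem_off_loops)

definition flux :: "real^3 \<Rightarrow> real" where
  "flux y = jump_gradient y \<bullet> cross3 (B1 y) (B2 y)"

lemma flux_off_core: "y \<notin> core \<Longrightarrow> flux y = 0"
  by (simp add: flux_def jump_gradient_off_core)

lemma continuous_on_flux: "continuous_on UNIV flux"
proof -
  obtain B1' B2' where B: "irrotational_on off_loops B1 B1'" "irrotational_on off_loops B2 B2'"
    by (rule irrotational_on_off_loops)
  have "continuous_on off_loops flux"
    unfolding flux_def
    by (intro continuous_on_inner continuous_on_cross B[THEN irrotational_on_continuous_on]
        continuous_on_subset[OF continuous_on_jump_gradient]) simp
  moreover have "continuous_on (- core) flux"
    by (rule continuous_on_eq[OF continuous_on_const[of _ 0]]) (simp add: flux_off_core)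
  ultimately have "continuous_on (off_loops \<union> - core) flux"
    using open_off_loops compact_imp_closed[OF compact_core] by (intro continuous_on_open_Un) auto
  moreover have "off_loops \<union> - core = UNIV" using core_subset_off_loops by blast
  ultimately show ?thesis by simp
qed

lemma flux_has_integral_0: "(flux has_integral 0) UNIV"
proof -
  obtain U where U: "\<And>y. (U has_derivative (\<lambda>h. jump_gradient y \<bullet> h)) (at y)"
    "\<And>y. y \<in> \<Phi> ` (UNIV \<times> {0..<\<delta>}) \<Longrightarrow> U y = 0" "bounded (range U)"
    by (rule separating_function) (rule that)
  obtain B1' B2' where B: "irrotational_on off_loops B1 B1'" "irrotational_on off_loops B2 B2'"
    by (rule irrotational_on_off_loops)
  obtain C1 where C1: "C1 \<ge> 0" "\<forall>\<^sub>F y in at_infinity. norm (B1 y) \<le> C1 / norm y ^ 2"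
    by (rule biot_savart_decay[OF closed_curve_loop])
  obtain C2 where C2: "C2 \<ge> 0" "\<forall>\<^sub>F y in at_infinity. norm (B2 y) \<le> C2 / norm y ^ 2"
    by (rule biot_savart_decay[OF closed_curve_loop])
  let ?N = "\<Phi> ` (UNIV \<times> {0<..<\<delta>})"
  show ?thesis
    unfolding flux_def[abs_def]
  proof (rule integral_gradient_inner_cross_irrotational[OF open_off_loops B U(1)
      continuous_on_jump_gradient U(3) _ _ _ _ _ C1 C2(2)])
    show "open ?N" using \<delta>_pos by (intro open_\<Phi>_image open_Times) (auto simp: slab_def)
    show "U y = 0" if "y \<in> ?N" for y using that by (intro U(2)) auto
    show "jump_gradient y = 0" if "y \<in> ?N" for y
      using that by (auto simp: jump_gradient_\<Phi> mem_slab cutoff_deriv_outside)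
    have "y \<in> ?N" if "y \<notin> off_loops" for y
      using that \<delta>_pos by (auto simp: off_loops_def loop_def)
    then show "off_loops \<union> ?N = UNIV" by blast
    show "\<forall>\<^sub>F y in at_infinity. jump_gradient y = 0"
    proof -
      obtain R where "\<And>y. y \<in> core \<Longrightarrow> norm y \<le> R"
        using compact_imp_bounded[OF compact_core] unfolding bounded_iff by blast
      then have "y \<notin> core" if "R + 1 \<le> norm y" for y using that by force
      then show ?thesis
        unfolding eventually_at_infinity using jump_gradient_off_core by blast
    qed
  qed
qed

definition wedge :: "(real \<times> real) \<times> real \<Rightarrow> real" where
  "wedge z = (B1 (\<Phi> z) \<bullet> \<Phi>\<^sub>s z) * (B2 (\<Phi> z) \<bullet> \<Phi>\<^sub>t z) - (B1 (\<Phi> z) \<bullet> \<Phi>\<^sub>t z) * (B2 (\<Phi> z) \<bullet> \<Phi>\<^sub>s z)"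

lemma Jac_flux:
  assumes "z \<in> slab"
  shows "Jac z * flux (\<Phi> z) = cutoff_deriv (snd z) * wedge z"
proof -
  have "Jac z * flux (\<Phi> z) = cutoff_deriv (snd z) * ((Jac z *\<^sub>R \<nu> (fst z)) \<bullet> cross3 (B1 (\<Phi> z)) (B2 (\<Phi> z)))"
    by (simp add: flux_def jump_gradient_\<Phi>[OF assms])
  also have "(Jac z *\<^sub>R \<nu> (fst z)) \<bullet> cross3 (B1 (\<Phi> z)) (B2 (\<Phi> z)) = wedge z"
    unfolding Jac_scaleR_\<nu> wedge_def dot_cross by (simp add: inner_commute mult.commute)
  finally show ?thesis .
qed

lemma Ck_differentiable_level: "Ck_differentiable k (\<lambda>x. \<Phi> (x, r))"
proof -
  have "bounded_linear (\<lambda>x :: real \<times> real. (x, 0 :: real))"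
    by (intro bounded_linear_Pair bounded_linear_ident bounded_linear_zero)
  from Ck_differentiable_compose_affine[OF this Ck_differentiable_\<Phi>, of k "(0, r)"] show ?thesis by simp
qed

lemma dir_deriv_level: "dir_deriv (\<lambda>x. \<Phi> (x, r)) h x = dir_deriv \<Phi> (h, 0) (x, r)"
proof -
  have "((\<lambda>x. (x, r)) has_derivative (\<lambda>h. (h, 0))) (at x)"
    by (intro has_derivative_Pair has_derivative_ident has_derivative_const)
  from has_derivative_compose[OF this \<Phi>_has_derivative] show ?thesis
    by (metis frechet_derivative_at)
qed

lemma integral_wedge_level:
  assumes p1: "torus_potential B1 \<Phi> {-\<delta><..<\<delta>/2} a1 b1 p1" and p2: "torus_potential B2 \<Phi> {-\<delta><..<\<delta>/2} a2 b2 p2"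
    and r: "-\<delta> < r" "r < \<delta>/2"
  shows "integral {0..1} (\<lambda>s. integral {0..1} (\<lambda>t. wedge ((s, t), r))) = a1 * b2 - b1 * a2"
proof -
  let ?\<Psi> = "\<lambda>x. \<Phi> (x, r)"
  obtain B1' B2' where B: "irrotational_on off_loops B1 B1'" "irrotational_on off_loops B2 B2'"
    by (rule irrotational_on_off_loops)
  have img: "?\<Psi> ` UNIV \<subseteq> off_loops" using \<Phi>_mem_off_loops[OF r] by blast
  obtain W1' where W1: "irrotational_on UNIV (pullback_field ?\<Psi> B1) W1'"
    by (rule irrotational_on_pullback_field[OF B(1) Ck_differentiable_level img])
  obtain W2' where W2: "irrotational_on UNIV (pullback_field ?\<Psi> B2) W2'"
    by (rule irrotational_on_pullback_field[OF B(2) Ck_differentiable_level img])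
  have inner: "pullback_field ?\<Psi> C x \<bullet> h = C (\<Phi> (x, r)) \<bullet> dir_deriv \<Phi> (h, 0) (x, r)" for C x h
    unfolding dir_deriv_level[symmetric]
    by (rule pullback_field_inner) (rule differentiableI[OF
        Ck_differentiable_has_derivative[OF Ck_differentiable_level]])
  have r': "r \<in> {-\<delta><..<\<delta>/2}" using r by simp
  note level1 = torus_potential_level[OF p1 r', folded inner]
      and level2 = torus_potential_level[OF p2 r', folded inner]
  show ?thesis
    using riemann_bilinear_relation[OF level1 level2 irrotational_on_continuous_on[OF W1] W2]
    by (simp add: inner wedge_def)
qed

(* In collar coordinates the integral 0 of the flux is the determinant of the periods times the increment 1
  of the cutoff. *)
lemma periods_det:
  assumes p1: "torus_potential B1 \<Phi> {-\<delta><..<\<delta>/2} a1 b1 p1" and p2: "torus_potential B2 \<Phi> {-\<delta><..<\<delta>/2} a2 b2 p2"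
  shows "a1 * b2 = b1 * a2"
proof -
  have "0 = integral UNIV flux" using flux_has_integral_0 by (simp add: integral_unique)
  also have "\<dots> = integral {-\<delta>/2..0} (\<lambda>r. integral {0..1}
      (\<lambda>s. integral {0..1} (\<lambda>t. Jac ((s, t), r) * flux (\<Phi> ((s, t), r)))))"
    using \<delta>_pos by (intro integral_collar[OF continuous_on_flux flux_off_core[unfolded core_def]]) auto
  also have "\<dots> = integral {-\<delta>/2..0} (\<lambda>r. cutoff_deriv r * (a1 * b2 - b1 * a2))"
  proof (rule integral_cong)
    fix r assume "r \<in> {-\<delta>/2..0}"
    then have "-\<delta> < r" "r < \<delta>/2" using \<delta>_pos by auto
    then show "integral {0..1} (\<lambda>s. integral {0..1} (\<lambda>t. Jac ((s, t), r) * flux (\<Phi> ((s, t), r))))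
        = cutoff_deriv r * (a1 * b2 - b1 * a2)"
      using integral_wedge_level[OF p1 p2] by (simp add: Jac_flux mem_slab)
  qed
  also have "\<dots> = integral {-\<delta>/2..0} cutoff_deriv * (a1 * b2 - b1 * a2)" by simp
  also have "integral {-\<delta>/2..0} cutoff_deriv = cutoff 0 - cutoff (-\<delta>/2)"
    using \<delta>_pos by (intro integral_real_derivative cutoff_has_real_derivative) auto
  finally show ?thesis by (simp add: cutoff_above cutoff_below)
qed

lemma seifert_form_det:
  "seifert_form (1, 0) (1, 0) * seifert_form (0, 1) (0, 1)
      = seifert_form (1, 0) (0, 1) * seifert_form (0, 1) (1, 0)"
proof -
  let ?I = "{-\<delta><..<\<delta>/2}"
  have I: "open ?I" "convex ?I" "?I \<subseteq> {-\<delta><..<\<delta>}" "0 \<in> ?I" and \<rho>: "\<delta>/2 \<in> {-\<delta><..<\<delta>}" "\<delta>/2 \<notin> ?I"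
    using \<delta>_pos by auto
  obtain a1 b1 p1 where p1: "torus_potential B1 \<Phi> ?I a1 b1 p1" by (rule loop_potential_exists[OF I(1-3) \<rho>])
  obtain a2 b2 p2 where p2: "torus_potential B2 \<Phi> ?I a2 b2 p2" by (rule loop_potential_exists[OF I(1-3) \<rho>])
  have "seifert_form b (1, 0) = (of_int (fst b) * a1 + of_int (snd b) * b1) / (4 * pi)"
    "seifert_form b (0, 1) = (of_int (fst b) * a2 + of_int (snd b) * b2) / (4 * pi)" for b
    using linking_number_loop_potential[OF p1 I(3,4) \<rho>] linking_number_loop_potential[OF p2 I(3,4) \<rho>]
    by (simp_all add: seifert_form_eq_upper)
  then show ?thesis using periods_det[OF p1 p2] by (simp add: algebra_simps)
qed

end

section \<open>Integral bilinear forms of rank one\<close>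

definition int_form :: "int \<Rightarrow> int \<Rightarrow> int \<Rightarrow> int \<Rightarrow> int \<times> int \<Rightarrow> int \<times> int \<Rightarrow> int" where
  "int_form a b c d u v = fst u * (fst v * a + snd v * b) + snd u * (fst v * c + snd v * d)"

lemma rank_one_factorisation:
  fixes a b c d :: int
  assumes det: "a * d = b * c"
  obtains \<alpha> \<beta> \<gamma> \<omega> :: int where "a = \<alpha> * \<gamma>" "b = \<alpha> * \<omega>" "c = \<beta> * \<gamma>" "d = \<beta> * \<omega>"
proof (cases "gcd a b = 0")
  case True
  then show thesis using that[of 0 c d 1] by simp
next
  case False
  then obtain \<gamma> \<omega> where ab: "a = \<gamma> * gcd a b" "b = \<omega> * gcd a b" "coprime \<gamma> \<omega>"
    using gcd_coprime_exists by blast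
  have "gcd a b * (\<gamma> * d) = gcd a b * (\<omega> * c)"
    using det ab(1,2) by (metis mult.assoc mult.commute)
  then have eq: "\<gamma> * d = \<omega> * c" using False by auto
  obtain r s where rs: "r * \<gamma> + s * \<omega> = 1" using bezout_int[of \<gamma> \<omega>] ab(3) by auto
  then have "c = (r * c + s * d) * \<gamma>" "d = (r * c + s * d) * \<omega>"
    using eq by algebra+
  then show thesis using that[of "gcd a b" \<gamma> \<omega>] ab by (simp add: mult.commute)
qed

(* The form factors as phi(u) psi(v); the basis is p in ker psi and q in ker phi. *)
lemma rank_one_form_normal_form:
  assumes det: "a * d = b * c" and skew: "c - b = 1"
  obtains p q :: "int \<times> int" where "fst p * snd q - snd p * fst q = 1"
    "\<And>x1 y1 x2 y2. int_form a b c d (x1 * fst p + y1 * fst q, x1 * snd p + y1 * snd q)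
      (x2 * fst p + y2 * fst q, x2 * snd p + y2 * snd q) = - (x1 * y2)"
proof -
  obtain \<alpha> \<beta> \<gamma> \<omega> where fac: "a = \<alpha> * \<gamma>" "b = \<alpha> * \<omega>" "c = \<beta> * \<gamma>" "d = \<beta> * \<omega>"
    by (rule rank_one_factorisation[OF det])
  have one: "\<beta> * \<gamma> - \<alpha> * \<omega> = 1" using skew fac by simp
  have form: "int_form a b c d u v = (\<alpha> * fst u + \<beta> * snd u) * (\<gamma> * fst v + \<omega> * snd v)" for u v
    by (simp add: int_form_def fac algebra_simps)
  show thesis
  proof (rule that[of "(\<omega>, - \<gamma>)" "(\<beta>, - \<alpha>)"])
    show "fst (\<omega>, - \<gamma>) * snd (\<beta>, - \<alpha>) - snd (\<omega>, - \<gamma>) * fst (\<beta>, - \<alpha>) = 1"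
      using one by (simp add: algebra_simps)
    fix x1 y1 x2 y2
    have "\<alpha> * (x1 * \<omega> + y1 * \<beta>) + \<beta> * (x1 * - \<gamma> + y1 * - \<alpha>) = - x1 * (\<beta> * \<gamma> - \<alpha> * \<omega>)"
      "\<gamma> * (x2 * \<omega> + y2 * \<beta>) + \<omega> * (x2 * - \<gamma> + y2 * - \<alpha>) = y2 * (\<beta> * \<gamma> - \<alpha> * \<omega>)"
      by algebra+
    then show "int_form a b c d (x1 * fst (\<omega>, - \<gamma>) + y1 * fst (\<beta>, - \<alpha>), x1 * snd (\<omega>, - \<gamma>) + y1 * snd (\<beta>, - \<alpha>))
        (x2 * fst (\<omega>, - \<gamma>) + y2 * fst (\<beta>, - \<alpha>), x2 * snd (\<omega>, - \<gamma>) + y2 * snd (\<beta>, - \<alpha>)) = - (x1 * y2)"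
      unfolding form one fst_conv snd_conv by simp
  qed
qed

lemma (in torus_collar) seifert_matrix:
  obtains a b c d where "\<And>u v. seifert_form u v = of_int (int_form a b c d u v)" "a * d = b * c" "c - b = 1"
proof -
  obtain a b c d where m: "seifert_form (1, 0) (1, 0) = of_int a" "seifert_form (1, 0) (0, 1) = of_int b"
      "seifert_form (0, 1) (1, 0) = of_int c" "seifert_form (0, 1) (0, 1) = of_int d"
    using seifert_form_integer by (metis Ints_cases)
  have "seifert_form u v = of_int (int_form a b c d u v)" for u v
    using seifert_form_linear_left[of u v] seifert_form_linear_right[of "(1, 0)" v]
        seifert_form_linear_right[of "(0, 1)" v]
    by (simp add: m int_form_def)
  moreover have "real_of_int (a * d) = of_int (b * c)" "real_of_int (c - b) = of_int 1"
    using seifert_form_det seifert_form_skew unfolding m by simp_all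
  then have "a * d = b * c" "c - b = 1" by (simp_all only: of_int_eq_iff)
  ultimately show thesis by (rule that)
qed

theorem theorem4:
  fixes f :: "real \<times> real \<Rightarrow> real^3"
  assumes "torus_smooth_embedding f"
  shows "\<exists>(p :: int \<times> int) (q :: int \<times> int) (\<epsilon> :: int).
           (fst p * snd q - snd p * fst q = 1 \<or> fst p * snd q - snd p * fst q = -1) \<and>
           (\<epsilon> = 1 \<or> \<epsilon> = -1) \<and>
           (\<forall>x1 y1 x2 y2 :: int.
              \<forall>\<^sub>F eps in at_right 0.
                seifert_lk f eps (x1 * fst p + y1 * fst q, x1 * snd p + y1 * snd q)
                                 (x2 * fst p + y2 * fst q, x2 * snd p + y2 * snd q)
                = of_int (\<epsilon> * x1 * y2))"
proof -
  interpret embedded_torus f using assms by unfold_locales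
  obtain \<delta> where "tube \<delta>" using tube_exists by blast
  then interpret torus_collar f \<delta> by unfold_locales
  obtain a b c d where form: "\<And>u v. seifert_form u v = of_int (int_form a b c d u v)"
    and matrix: "a * d = b * c" "c - b = 1"
    by (rule seifert_matrix) (rule that)
  obtain p q where det: "fst p * snd q - snd p * fst q = 1"
    and normal: "\<And>x1 y1 x2 y2. int_form a b c d (x1 * fst p + y1 * fst q, x1 * snd p + y1 * snd q)
      (x2 * fst p + y2 * fst q, x2 * snd p + y2 * snd q) = - (x1 * y2)"
    by (rule rank_one_form_normal_form[OF matrix]) (rule that)
  have "\<forall>\<^sub>F eps in at_right 0. 0 < eps \<and> eps < \<delta>"
    using \<delta>_pos unfolding eventually_at_right_field by auto
  then have "\<forall>\<^sub>F eps in at_right 0. seifert_lk f eps (x1 * fst p + y1 * fst q, x1 * snd p + y1 * snd q)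
      (x2 * fst p + y2 * fst q, x2 * snd p + y2 * snd q) = of_int (- 1 * x1 * y2)" for x1 y1 x2 y2
    by eventually_elim (simp add: seifert_lk_eq_seifert_form form normal)
  with det show ?thesis
    by (intro exI[of _ p] exI[of _ q] exI[of _ "- 1"]) simp
qed

end
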